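(* Let $V^*:=V(x_0,x^* )>0$. To compute an $\varepsilon$-solution of $\min_{x\in X} f(x)+g(x)$, the PFUGS algorithm (described in the context; it uses no knowledge of $\nu$, $M_\nu$, $L$ or $V^*$ beyond the initial guess $M_0\in(0,L]$) requires at most $$(4\sqrt{2}+3)\sqrt{\frac{LV^*}{\varepsilon}}$$ evaluations of $\nabla g$ and at most $$D\Big(\tfrac{\overline{M}_{\nu,\varepsilon}V^*}{\varepsilon}\Big)^{\frac{1+\nu}{1+3\nu}}+\Big[(4\sqrt{2}+3)\Big(\tfrac{LV^*}{\varepsilon}\Big)^{\frac12}+\log_2\Big(\tfrac{8\overline{M}_{\nu,\varepsilon}V^*}{\varepsilon}\Big)\Big]\Big[\tfrac{13+3\nu}{3\nu+1}+\tfrac{2+2\nu}{3\nu+1}\log_2\Big(\tfrac{\overline{M}_{\nu,\varepsilon}V^*}{\varepsilon}\Big)+\tfrac{1-\nu}{3\nu+1}\log_2\Big(\tfrac{LV^*}{\varepsilon}\Big)\Big]$$ evaluations of $f'$, where $D:=(32+16\sqrt{2})(1+\sqrt{5})^{\frac{1-\nu}{1+3\nu}}2^{\frac{1+\nu}{1+3\nu}}$.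
   Context: **Setting.** $X\subseteq\mathbb{R}^n$ is a nonempty closed convex set, $\|\cdot\|$ a norm on $\mathbb{R}^n$, $\varepsilon>0$. $f:\mathbb{R}^n\to\mathbb{R}$ is convex, $g:\mathbb{R}^n\to\mathbb{R}$ is convex and differentiable, and there are $\nu\in[0,1]$, $M_\nu,L>0$ with, for all $x,y\in\mathbb{R}^n$, $f(y)-f(x)-\langle f'(x),y-x\rangle\le\frac{M_\nu}{1+\nu}\|y-x\|^{1+\nu}$ for every $f'(x)\in\partial f(x)$, and $g(y)-g(x)-\langle\nabla g(x),y-x\rangle\le\frac L2\|y-x\|^2$. An evaluation of $f'$ at $x$ returns some element $f'(x)\in\partial f(x)$. Put $\overline{M}_{\nu,\varepsilon}:=\big[\frac{1-\nu}{1+\nu}\cdot\frac1\varepsilon\big]^{\frac{1-\nu}{1+\nu}}M_\nu^{\frac{2}{1+\nu}}$ (convention $0^0=1$) and assume $L\le\overline{M}_{\nu,\varepsilon}$. $V(x,z):=\omega(z)-\omega(x)-\langle\nabla\omega(x),z-x\rangle$ is the Bregman divergence of a differentiable function $\omega:X\to\mathbb{R}$ that is strongly convex with modulus 1, so $V(x,z)\ge\frac12\|z-x\|^2$ for $x,z\in X$. $x^*$ is any optimal solution of $\min_{x\in X}f(x)+g(x)$ (assumed to exist). A point $\hat x\in X$ is an $\varepsilon$-solution if $f(\hat x)+g(\hat x)-f(x^* )-g(x^* )\le\varepsilon$. **Subroutine $\mathcal{A}$** (for given $k,s\ge1$, with $x_{k-1},\tilde x_{k-1},\overline x_{k-1}\in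 X$, $L_k^s>0$, $\gamma_k^s\in(0,1]$, $\eta_k^s=L_k^s\gamma_k^s$, $\underline x_k^s$, $M_k^{0,s}$ given). Set $x_k^{0,s}=x_{k-1}$, $\tilde x_k^{0,s}=\tilde x_{k-1}$, $c_k^{0,s}=1$. For $t=1,2,\dots$: set $M_k^{t,s}=2^{i_k^{t,s}}c_k^{t-1,s}M_k^{t-1,s}$, where $i_k^{t,s}$ is the smallest nonnegative integer such that test (F) below holds for the quantities computed from this $M_k^{t,s}$: $\alpha_k^{1,s}=1$, and for $t\ge2$, $\alpha_k^{t,s}>0$ solves $M_k^{t,s}(\alpha_k^{t,s})^2=M_k^{t-1,s}(\alpha_k^{t-1,s})^2(1-\alpha_k^{t,s})$; $p_k^{t,s}=L_k^s\gamma_k^s(1-\alpha_k^{t,s})/\alpha_k^{t,s}+\gamma_k^sM_k^{t,s}\alpha_k^{t,s}$; $\underline x_k^{t,s}=(1-\gamma_k^s)\overline x_{k-1}+\gamma_k^s[(1-\alpha_k^{t,s})\tilde x_k^{t-1,s}+\alpha_k^{t,s}x_k^{t-1,s}]$; $x_k^{t,s}=\operatorname{argmin}_{x\in X}\langle\nabla g(\underline x_k^s)+f'(\underline x_k^{t,s}),x\rangle+\eta_k^sV(x_{k-1},x)+p_k^{t,s}V(x_k^{t-1,s},x)$; $\tilde x_k^{t,s}=(1-\alpha_k^{t,s})\tilde x_k^{t-1,s}+\alpha_k^{t,s}x_k^{t,s}$; $\overline x_k^{t,s}=(1-\gamma_k^s)\overline x_{k-1}+\gamma_k^s\tilde x_k^{t,s}$.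 (F): $f(\overline x_k^{t,s})\le f(\underline x_k^{t,s})+\langle f'(\underline x_k^{t,s}),\overline x_k^{t,s}-\underline x_k^{t,s}\rangle+\frac{M_k^{t,s}}2\|\overline x_k^{t,s}-\underline x_k^{t,s}\|^2+\frac{\gamma_k^s\alpha_k^{t,s}\varepsilon}{2}$. Then: if $M_k^{t,s}(\alpha_k^{t,s})^2=L_k^s$, set $T_k^s=t$, terminate and output $x_k^s=x_k^{t,s}$, $\tilde x_k^s=\tilde x_k^{t,s}$, $\overline x_k^s=\overline x_k^{t,s}$; else if $M_k^{t,s}[(\alpha_k^{t,s})^4+2(\alpha_k^{t,s})^2-(\alpha_k^{t,s})^3\sqrt{(\alpha_k^{t,s})^2+4}]/2\le L_k^s$, set $c_k^{t,s}=L_k^s(\alpha_k^{t,s})^4M_k^{t,s}/[M_k^{t,s}(\alpha_k^{t,s})^2-L_k^s]^2$; otherwise set $c_k^{t,s}=1$; go to $t+1$. **PFUGS.** Initialize $x_0=\tilde x_0=\overline x_0\in X$ and $M_0\in(0,L]$. *Iteration $k=1$* ($\gamma_1^s=1$, $\underline x_1^s=x_0$, $\eta_1^s=L_1^s$ for all $s$). For $s=1$: set $L_1^1=M_1^{1,1}=2^{i}M_0$ and $x_1^{1,1}=\operatorname{argmin}_{x\in X}\langle\nabla g(x_0)+f'(x_0),x\rangle+L_1^1V(x_0,x)+M_1^{1,1}V(x_0,x)$, with $i$ the smallest nonnegative integer such that both $g(x_1^{1,1})\le g(x_0)+\langle\nabla g(x_0),x_1^{1,1}-x_0\rangle+\frac{L_1^1}2\|x_1^{1,1}-x_0\|^2$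 and $f(x_1^{1,1})\le f(x_0)+\langle f'(x_0),x_1^{1,1}-x_0\rangle+\frac{M_1^{1,1}}2\|x_1^{1,1}-x_0\|^2+\frac\varepsilon2$; set $x_1^1=\tilde x_1^1=\overline x_1^1=x_1^{1,1}$, $T_1^1=1$. For $s=2,3,\dots$: set $L_1^s=L_1^1/2^{s-1}$, $M_1^{0,s}=\max\{M_0,L_1^s\}$, run $\mathcal A$; if test (G) below holds with $k=1$, go to $s+1$; otherwise set $S_1=s-1$, $L_1=L_1^{S_1}$, $x_1=x_1^{S_1}$, $\tilde x_1=\tilde x_1^{S_1}$, $\overline x_1=\overline x_1^{S_1}$ and go to $k=2$. (G): $g(\overline x_k^s)\le g(\underline x_k^s)+\langle\nabla g(\underline x_k^s),\overline x_k^s-\underline x_k^s\rangle+\frac{L_k^s}2\|\overline x_k^s-\underline x_k^s\|^2$. *Iterations $k\ge2$.* For $s=1,2,\dots$: set $L_k^s=2^{s-1}L_{k-1}$; $\gamma_k^s>0$ solves $L_k^s(\gamma_k^s)^2=L_{k-1}(\gamma_{k-1}^{S_{k-1}})^2(1-\gamma_k^s)$; $\eta_k^s=L_k^s\gamma_k^s$; $M_k^{0,s}=\max\{M_0,L_k^s\}$; $\underline x_k^s=(1-\gamma_k^s)\overline x_{k-1}+\gamma_k^sx_{k-1}$; run $\mathcal A$; if (G) holds set $S_k=s$, $L_k=L_k^s$, $x_k=x_k^s$, $\tilde x_k=\tilde x_k^s$, $\overline x_k=\overline x_k^s$ and go to $k+1$; otherwise go to $s+1$. **Counting.** An $\varepsilon$-solution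 is computed once some $\overline x_N$ ($N\ge1$), or some trial point $\overline x_1^s$ of the first iteration for which (G) holds (taken as $\overline x_1$), is an $\varepsilon$-solution. Values $\nabla g(x_0)$ and, for $k=s=1$, $f'(x_0)$ are evaluated once and reused; for each $(k,s)$ with $k\ge2$ one evaluation of $\nabla g$ is used; in $\mathcal A$, inner iteration $t$ uses $i_k^{t,s}+1$ evaluations of $f'$ (one per trial value of $M_k^{t,s}$).
   Formalization: It is additionally assumed that (4√2+3)√(LV*/ε) ≥ 1; otherwise the claimed bound on evaluations of ∇g is below 1 and fails, since the algorithm always evaluates ∇g(x₀). *)

theory Defs
  imports "HOL-Analysis.Analysis"
begin

section \<open>The problem class\<close>

text \<open>The norm is an arbitrary one, unrelated to the Euclidean \<^const>\<open>norm\<close>.\<close>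

definition is_norm :: "('a::real_vector \<Rightarrow> real) \<Rightarrow> bool" where
  "is_norm nrm \<longleftrightarrow>
     (\<forall>x. nrm x = 0 \<longleftrightarrow> x = 0) \<and>
     (\<forall>c x. nrm (c *\<^sub>R x) = \<bar>c\<bar> * nrm x) \<and>
     (\<forall>x y. nrm (x + y) \<le> nrm x + nrm y)"

definition subdifferential :: "('a::real_inner \<Rightarrow> real) \<Rightarrow> 'a \<Rightarrow> 'a set" where
  "subdifferential f x = {v. \<forall>y. f y \<ge> f x + v \<bullet> (y - x)}"

definition strongly_convex_on ::
  "'a::real_vector set \<Rightarrow> ('a \<Rightarrow> real) \<Rightarrow> real \<Rightarrow> ('a \<Rightarrow> real) \<Rightarrow> bool" where
  "strongly_convex_on X nrm \<mu> \<omega> \<longleftrightarrow> convex X \<and>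
     (\<forall>x\<in>X. \<forall>y\<in>X. \<forall>u\<ge>0. \<forall>v\<ge>0. u + v = 1 \<longrightarrow>
        \<omega> (u *\<^sub>R x + v *\<^sub>R y) \<le> u * \<omega> x + v * \<omega> y - \<mu> / 2 * u * v * (nrm (x - y))\<^sup>2)"

definition bregman :: "('a::real_inner \<Rightarrow> real) \<Rightarrow> ('a \<Rightarrow> 'a) \<Rightarrow> 'a \<Rightarrow> 'a \<Rightarrow> real" where
  "bregman \<omega> grad_\<omega> x z = \<omega> z - \<omega> x - grad_\<omega> x \<bullet> (z - x)"

text \<open>The case distinction implements \<open>0\<^sup>0 = 1\<close> at \<open>\<nu> = 1\<close>, because \<open>0 powr 0 = 0\<close>.\<close>

definition M_bar :: "real \<Rightarrow> real \<Rightarrow> real \<Rightarrow> real" where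
  "M_bar \<nu> M\<^sub>\<nu> \<epsilon> =
     (if \<nu> = 1 then 1 else ((1 - \<nu>) / (1 + \<nu>) * (1 / \<epsilon>)) powr ((1 - \<nu>) / (1 + \<nu>)))
       * M\<^sub>\<nu> powr (2 / (1 + \<nu>))"

definition eps_solution ::
  "'a set \<Rightarrow> ('a \<Rightarrow> real) \<Rightarrow> ('a \<Rightarrow> real) \<Rightarrow> real \<Rightarrow> 'a \<Rightarrow> 'a \<Rightarrow> bool" where
  "eps_solution X f g \<epsilon> xs z \<longleftrightarrow> z \<in> X \<and> f z + g z - f xs - g xs \<le> \<epsilon>"

section \<open>The algorithm\<close>

definition pos_root :: "real \<Rightarrow> real \<Rightarrow> real" where
  "pos_root a b = (THE r. r > 0 \<and> a * r\<^sup>2 = b * (1 - r))"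

text \<open>
  The input of one call of the subroutine: \<open>c_x\<close>, \<open>c_xt\<close>, \<open>c_xb\<close> are
  \<open>x\<close>, \<open>x\<close>-tilde, \<open>x\<close>-bar with subscript \<open>k - 1\<close>; \<open>c_xu\<close> is the point at which
  the gradient of \<open>g\<close> is taken; \<open>c_M0\<close> is the initial estimate \<open>M\<^sub>k\<close> with superscript \<open>0,s\<close>.
\<close>

record 'a call =
  c_k :: nat
  c_s :: nat
  c_x :: 'a
  c_xt :: 'a
  c_xb :: 'a
  c_L :: real
  c_\<gamma> :: real
  c_xu :: 'a
  c_M0 :: real

text \<open>
  The quantities of one inner iteration; \<open>i_xu\<close> is the point at which \<open>f\<close> is linearised
  and \<open>i_v\<close> the subgradient received there.
\<close>

record 'a inner =
  i_x :: 'a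
  i_xt :: 'a
  i_xb :: 'a
  i_xu :: 'a
  i_v :: 'a
  i_M :: real
  i_\<alpha> :: real

record 'a iterate =
  o_x :: 'a
  o_xt :: 'a
  o_xb :: 'a
  o_L :: real
  o_\<gamma> :: real

text \<open>
  \<open>Passed1 s P\<close>: the trial point \<open>P\<close> number \<open>s\<close> of iteration 1 satisfies test (G).
  \<open>Done k P\<close>: iteration \<open>k\<close> is finished with final output \<open>P\<close>.
  \<open>Trial k s P\<close>: trial \<open>s\<close> of iteration \<open>k \<ge> 2\<close> is about to start, where \<open>P\<close> is the
  final output of iteration \<open>k - 1\<close>.
\<close>

datatype 'a config =
    Passed1 nat "'a iterate"
  | Done nat "'a iterate"
  | Trial nat nat "'a iterate"

text \<open>
  The algorithm sees the parameters of this locale only; in particular it does not see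
  \<open>\<nu>\<close>, \<open>M\<^sub>\<nu>\<close>, \<open>L\<close> or the distance to a solution. The subgradient oracle \<open>f' k s t i\<close>
  answers the evaluation made in trial \<open>s\<close> of iteration \<open>k\<close>, inner iteration \<open>t\<close>, for the
  \<open>i\<close>-th trial value of the inner estimate. Repeated evaluations at the same point may thus
  return different subgradients; for a fixed oracle the algorithm is deterministic.
\<close>

locale pfugs =
  fixes X :: "'a::euclidean_space set"
    and nrm :: "'a \<Rightarrow> real"
    and f g :: "'a \<Rightarrow> real"
    and f' :: "nat \<Rightarrow> nat \<Rightarrow> nat \<Rightarrow> nat \<Rightarrow> 'a \<Rightarrow> 'a"
    and grad_g :: "'a \<Rightarrow> 'a"
    and \<omega> :: "'a \<Rightarrow> real"
    and grad_\<omega> :: "'a \<Rightarrow> 'a"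
    and \<epsilon> M0 :: real
    and x0 :: 'a
begin

abbreviation V :: "'a \<Rightarrow> 'a \<Rightarrow> real" where
  "V \<equiv> bregman \<omega> grad_\<omega>"

subsection \<open>The subroutine\<close>

text \<open>The state before inner iteration 1; the remaining fields are never read.\<close>

definition inner_start :: "'a call \<Rightarrow> 'a inner" where
  "inner_start C = \<lparr>i_x = c_x C, i_xt = c_xt C, i_xb = c_xb C, i_xu = c_xu C, i_v = 0,
     i_M = c_M0 C, i_\<alpha> = 1\<rparr>"

definition inner_stop :: "'a call \<Rightarrow> nat \<Rightarrow> 'a inner \<Rightarrow> bool" where
  "inner_stop C t I \<longleftrightarrow> t \<ge> 1 \<and> i_M I * (i_\<alpha> I)\<^sup>2 = c_L C"

text \<open>The factor \<open>c\<close> set at the end of inner iteration \<open>t\<close>, with \<open>c = 1\<close> for \<open>t = 0\<close>.\<close>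

definition inner_fac :: "'a call \<Rightarrow> nat \<Rightarrow> 'a inner \<Rightarrow> real" where
  "inner_fac C t I = (let M = i_M I; \<alpha> = i_\<alpha> I in
     if t \<ge> 1 \<and> M * (\<alpha> ^ 4 + 2 * \<alpha>\<^sup>2 - \<alpha> ^ 3 * sqrt (\<alpha>\<^sup>2 + 4)) / 2 \<le> c_L C
     then c_L C * \<alpha> ^ 4 * M / (M * \<alpha>\<^sup>2 - c_L C)\<^sup>2
     else 1)"

text \<open>
  The quantities of inner iteration \<open>t + 1\<close>, computed from the state \<open>I\<close> after inner
  iteration \<open>t\<close>, for the exponent \<open>i\<close> of the line search.
\<close>

definition inner_trial :: "'a call \<Rightarrow> nat \<Rightarrow> 'a inner \<Rightarrow> nat \<Rightarrow> 'a inner" where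
  "inner_trial C t I i = (let
     L = c_L C; \<gamma> = c_\<gamma> C; \<eta> = L * \<gamma>;
     M = 2 ^ i * inner_fac C t I * i_M I;
     \<alpha> = (if t = 0 then 1 else pos_root M (i_M I * (i_\<alpha> I)\<^sup>2));
     p = L * \<gamma> * (1 - \<alpha>) / \<alpha> + \<gamma> * M * \<alpha>;
     xu = (1 - \<gamma>) *\<^sub>R c_xb C + \<gamma> *\<^sub>R ((1 - \<alpha>) *\<^sub>R i_xt I + \<alpha> *\<^sub>R i_x I);
     v = f' (c_k C) (c_s C) (t + 1) i xu;
     x = arg_min_on (\<lambda>z. (grad_g (c_xu C) + v) \<bullet> z + \<eta> * V (c_x C) z + p * V (i_x I) z) X;
     xt = (1 - \<alpha>) *\<^sub>R i_xt I + \<alpha> *\<^sub>R x;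
     xb = (1 - \<gamma>) *\<^sub>R c_xb C + \<gamma> *\<^sub>R xt
   in \<lparr>i_x = x, i_xt = xt, i_xb = xb, i_xu = xu, i_v = v, i_M = M, i_\<alpha> = \<alpha>\<rparr>)"

definition test_F :: "'a call \<Rightarrow> 'a inner \<Rightarrow> bool" where
  "test_F C I \<longleftrightarrow> f (i_xb I) \<le> f (i_xu I) + i_v I \<bullet> (i_xb I - i_xu I)
     + i_M I / 2 * (nrm (i_xb I - i_xu I))\<^sup>2 + c_\<gamma> C * i_\<alpha> I * \<epsilon> / 2"

text \<open>
  \<open>inner_reach C t I n\<close>: inner iteration \<open>t\<close> has been completed with state \<open>I\<close>, and
  \<open>n\<close> evaluations of \<open>f'\<close> have been used so far in this call.
\<close>

inductive inner_reach :: "'a call \<Rightarrow> nat \<Rightarrow> 'a inner \<Rightarrow> nat \<Rightarrow> bool" for C where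
  start: "inner_reach C 0 (inner_start C) 0"
| step: "\<lbrakk>inner_reach C t I n; \<not> inner_stop C t I;
          test_F C (inner_trial C t I i); \<forall>j<i. \<not> test_F C (inner_trial C t I j)\<rbrakk>
         \<Longrightarrow> inner_reach C (t + 1) (inner_trial C t I i) (n + (i + 1))"

definition subroutine :: "'a call \<Rightarrow> 'a inner \<Rightarrow> nat \<Rightarrow> bool" where
  "subroutine C I n \<longleftrightarrow> (\<exists>t. inner_reach C t I n \<and> inner_stop C t I)"

subsection \<open>The outer iterations\<close>

definition call_output :: "'a call \<Rightarrow> 'a inner \<Rightarrow> 'a iterate" where
  "call_output C I = \<lparr>o_x = i_x I, o_xt = i_xt I, o_xb = i_xb I, o_L = c_L C, o_\<gamma> = c_\<gamma> C\<rparr>"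

definition test_G :: "real \<Rightarrow> 'a \<Rightarrow> 'a \<Rightarrow> bool" where
  "test_G L xu xb \<longleftrightarrow> g xb \<le> g xu + grad_g xu \<bullet> (xb - xu) + L / 2 * (nrm (xb - xu))\<^sup>2"

text \<open>The trial of iteration 1 with \<open>s = 1\<close>; the single value \<open>f' 1 1 1 0 x0\<close> is reused for all \<open>i\<close>.\<close>

definition first_point :: "nat \<Rightarrow> 'a iterate" where
  "first_point i = (let
     M = 2 ^ i * M0;
     x = arg_min_on (\<lambda>z. (grad_g x0 + f' 1 1 1 0 x0) \<bullet> z + M * V x0 z + M * V x0 z) X
   in \<lparr>o_x = x, o_xt = x, o_xb = x, o_L = M, o_\<gamma> = 1\<rparr>)"

definition first_test :: "nat \<Rightarrow> bool" where
  "first_test i \<longleftrightarrow> (let x = o_x (first_point i); M = 2 ^ i * M0 in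
     test_G M x0 x \<and>
     f x \<le> f x0 + f' 1 1 1 0 x0 \<bullet> (x - x0) + M / 2 * (nrm (x - x0))\<^sup>2 + \<epsilon> / 2)"

text \<open>
  Iteration 1, trial \<open>s \<ge> 2\<close>, where \<open>P\<close> is the output of trial \<open>s - 1\<close>: halving the
  previous constant amounts to dividing the constant of trial 1 by \<open>2 ^ (s - 1)\<close>.
\<close>

definition call1 :: "nat \<Rightarrow> 'a iterate \<Rightarrow> 'a call" where
  "call1 s P = (let L = o_L P / 2 in
     \<lparr>c_k = 1, c_s = s, c_x = x0, c_xt = x0, c_xb = x0, c_L = L, c_\<gamma> = 1, c_xu = x0,
      c_M0 = max M0 L\<rparr>)"

text \<open>Iteration \<open>k \<ge> 2\<close>, trial \<open>s\<close>, starting from the final output \<open>P\<close> of iteration \<open>k - 1\<close>.\<close>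

definition call2 :: "nat \<Rightarrow> nat \<Rightarrow> 'a iterate \<Rightarrow> 'a call" where
  "call2 k s P = (let
     L = 2 ^ (s - 1) * o_L P;
     \<gamma> = pos_root L (o_L P * (o_\<gamma> P)\<^sup>2)
   in \<lparr>c_k = k, c_s = s, c_x = o_x P, c_xt = o_xt P, c_xb = o_xb P, c_L = L, c_\<gamma> = \<gamma>,
       c_xu = (1 - \<gamma>) *\<^sub>R o_xb P + \<gamma> *\<^sub>R o_x P, c_M0 = max M0 L\<rparr>)"

text \<open>
  \<open>reach c ng nf\<close>: the algorithm arrives at \<open>c\<close>, having used \<open>ng\<close> evaluations of \<open>grad_g\<close> and
  \<open>nf\<close> evaluations of \<open>f'\<close>. A line search, call or loop that did not terminate would leave
  no successor, so termination is never presupposed.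
\<close>

inductive reach :: "'a config \<Rightarrow> nat \<Rightarrow> nat \<Rightarrow> bool" where
  first: "\<lbrakk>first_test i; \<forall>j<i. \<not> first_test j\<rbrakk> \<Longrightarrow> reach (Passed1 1 (first_point i)) 1 1"
| halve: "\<lbrakk>reach (Passed1 s P) ng nf; C = call1 (s + 1) P;
           subroutine C I n; test_G (c_L C) (c_xu C) (i_xb I)\<rbrakk>
          \<Longrightarrow> reach (Passed1 (s + 1) (call_output C I)) ng (nf + n)"
| finish1: "\<lbrakk>reach (Passed1 s P) ng nf; C = call1 (s + 1) P;
             subroutine C I n; \<not> test_G (c_L C) (c_xu C) (i_xb I)\<rbrakk>
            \<Longrightarrow> reach (Done 1 P) ng (nf + n)"
| enter: "reach (Done k P) ng nf \<Longrightarrow> reach (Trial (k + 1) 1 P) ng nf"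
| accept: "\<lbrakk>reach (Trial k s P) ng nf; C = call2 k s P;
            subroutine C I n; test_G (c_L C) (c_xu C) (i_xb I)\<rbrakk>
           \<Longrightarrow> reach (Done k (call_output C I)) (ng + 1) (nf + n)"
| reject: "\<lbrakk>reach (Trial k s P) ng nf; C = call2 k s P;
            subroutine C I n; \<not> test_G (c_L C) (c_xu C) (i_xb I)\<rbrakk>
           \<Longrightarrow> reach (Trial k (s + 1) P) (ng + 1) (nf + n)"

definition computes :: "'a \<Rightarrow> nat \<Rightarrow> nat \<Rightarrow> bool" where
  "computes z ng nf \<longleftrightarrow>
     (\<exists>s P. reach (Passed1 s P) ng nf \<and> z = o_xb P) \<or>
     (\<exists>k P. reach (Done k P) ng nf \<and> z = o_xb P)"

text \<open>
  The evaluation at \<open>x0\<close> is always needed, so an upper bound on the number of evaluations of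
  \<open>grad_g\<close> can only hold if it is at least 1. The complexity theorem assumes this of its
  bound; by the lemma, that assumption is implied by the asserted bound itself.
\<close>

lemma computes_grad_evals_ge_1:
  assumes "computes z ng nf"
  shows "ng \<ge> 1"
proof -
  have "reach c ng nf \<Longrightarrow> ng \<ge> 1" for c ng nf
    by (induction rule: reach.induct) auto
  then show ?thesis
    using assms unfolding computes_def by blast
qed

end

end

theory Submission
  imports Defs
begin

text \<open>
  Write \<open>\<Gamma>\<^sub>k = L\<^sub>k \<gamma>\<^sub>k\<^sup>2\<close>, \<open>a = (1 + \<nu>) / (1 + 3\<nu>)\<close> and \<open>M\<close> for the constant \<open>M_bar\<close>.
  The optimality gap \<open>e\<^sub>k\<close> satisfies \<open>e\<^sub>k \<le> 2 \<Gamma>\<^sub>k V* + \<epsilon> / 2\<close>, so an iterate that is not an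
  \<open>\<epsilon>\<close>-solution has \<open>\<Gamma>\<^sub>k > \<epsilon> / (4 V*)\<close>. Every accepted trial increases \<open>1 / sqrt \<Gamma>\<close> by at
  least \<open>1 / (2 sqrt L\<^sub>k)\<close>, which bounds the evaluations of the gradient of \<open>g\<close>.

  A call of the subroutine lowers \<open>\<Lambda>\<^sub>t = M\<^sub>t \<alpha>\<^sub>t\<^sup>2\<close> from at least \<open>L\<^sub>k\<close> to exactly \<open>L\<^sub>k\<close>. Its line
  searches stop by Young's inequality, and since \<open>1 / sqrt \<Lambda>\<^sub>t\<close> grows steadily the call uses at
  most \<open>2 Y + 2 log\<^sub>2 Y\<close> evaluations of \<open>f'\<close>, where \<open>Y = (2 M / \<Gamma>) powr a * \<gamma>\<close>. The terms \<open>Y\<close> of the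
  trials of one iteration are dominated by a geometric series of ratio \<open>1 / sqrt 2\<close>, and over the
  iterations they telescope because
  \<open>\<Gamma>\<^sub>k powr (-a) * \<gamma>\<^sub>k \<le> 2 (\<Gamma>\<^sub>k powr (-a) - \<Gamma>\<^sub>k\<^sub>-\<^sub>1 powr (-a))\<close>. The terms \<open>2 log\<^sub>2 Y\<close> are at most the
  last bracket of the bound, once per call of the iterations \<open>k \<ge> 2\<close>. The factor with
  \<open>1 + sqrt 5\<close> comes from \<open>\<gamma>\<^sub>k\<^sup>2 \<le> 1 - \<gamma>\<^sub>k\<close>, which gives \<open>\<Gamma>\<^sub>k\<^sub>-\<^sub>1 / \<Gamma>\<^sub>k \<le> (3 + sqrt 5) / 2\<close>.
\<close>

section \<open>Elementary estimates\<close>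

lemma ln_le_tangent:
  fixes w c :: real
  assumes "w > 0" "c > 0"
  shows "ln w \<le> ln c + w / c - 1"
  using ln_le_minus_one[of "w / c"] assms by (simp add: ln_div)

lemma exp_1_ge: "exp (1::real) \<ge> 8 / 3"
proof -
  have "(\<lambda>k. 1 / fact k :: real) sums exp 1"
    using exp_converges[of "1::real"] by (simp add: divide_inverse)
  then have "(\<Sum>k<4. 1 / fact k :: real) \<le> exp 1"
    using sum_le_suminf[of "\<lambda>k. 1 / fact k :: real" "{..<4}"] by (auto simp: sums_iff)
  then show ?thesis by (simp add: eval_nat_numeral)
qed

text \<open>The tangent of \<open>ln\<close> at \<open>8 / 3\<close>, a rational point just below e,
  together with \<open>ln 2 \<ge> 2 / 3\<close>. The slope \<open>9 / 16\<close> is a rational upper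
  bound for the optimal slope 1 / (e * ln 2).\<close>

lemma log2_le_linear:
  fixes w :: real
  assumes "w > 0"
  shows "log 2 w \<le> 9 / 16 * w"
proof -
  have "ln (8 / 3 :: real) \<le> ln (exp 1)"
    using exp_1_ge by (subst ln_le_cancel_iff) auto
  then have "ln w \<le> 3 / 8 * w"
    using ln_le_tangent[OF assms, of "8 / 3"] by simp
  also have "\<dots> = 9 / 16 * w * (2 / 3)" by simp
  also have "\<dots> \<le> 9 / 16 * w * ln 2"
    using ln2_ge_two_thirds assms by (intro mult_left_mono) auto
  finally show ?thesis by (simp add: log_def pos_divide_le_eq)
qed

text \<open>Starts the count of gradient evaluations at the end of iteration 1, with sqrt (2 L / l)
  for \<open>r\<close>. The tangent of \<open>ln\<close> at \<open>3 / 2\<close> is precise enough,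
  where (3/2)^3 <= 2^2 controls \<open>ln (3 / 2)\<close>.\<close>

lemma two_log2_le:
  fixes r :: real
  assumes "r \<ge> 1"
  shows "2 * log 2 r \<le> 2 * r - 1"
proof -
  have "(3 / 2) ^ 3 \<le> (2::real) ^ 2" by (simp add: eval_nat_numeral)
  then have "ln ((3 / 2 :: real) ^ 3) \<le> ln (2 ^ 2)" by (subst ln_le_cancel_iff) auto
  then have "3 * ln (3 / 2 :: real) \<le> 2 * ln 2" by (subst (asm) (1 2) ln_realpow) auto
  moreover have "ln r \<le> ln (3 / 2) + 2 / 3 * r - 1"
    using ln_le_tangent[of r "3 / 2"] assms by simp
  ultimately have *: "ln r \<le> 2 / 3 * ln 2 + (2 / 3 * r - 1)" by simp
  \<comment> \<open>The shift \<open>7 / 6\<close> is dictated by the goal: 4/3 + 2 * (r - 7/6) = 2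
    * r - 1.\<close>
  have "2 / 3 * r - 1 \<le> (r - 7 / 6) * ln 2"
  proof (cases "r \<ge> 7 / 6")
    case True
    have "(r - 7 / 6) * (2 / 3) \<le> (r - 7 / 6) * ln 2"
      using ln2_ge_two_thirds True by (intro mult_left_mono) auto
    then show ?thesis using True by simp
  next
    case False
    have "ln (2::real) \<le> 1" using ln_le_minus_one[of 2] by simp
    then have "(r - 7 / 6) * 1 \<le> (r - 7 / 6) * ln 2"
      using False by (intro mult_left_mono_neg) auto
    then show ?thesis using assms by simp
  qed
  then have "2 * ln r \<le> (2 * r - 1) * ln 2" using * by (simp add: algebra_simps)
  then show ?thesis by (simp add: log_def pos_divide_le_eq)
qed

section \<open>The quadratic equation for the step sizes\<close>

lemma pos_root_unique:
  fixes a b r s :: real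
  assumes "a > 0" "b > 0" "r > 0" "s > 0" "a * r\<^sup>2 = b * (1 - r)" "a * s\<^sup>2 = b * (1 - s)"
  shows "r = s"
proof -
  have "(r - s) * (a * (r + s) + b) = 0"
    using assms(5,6) by (simp add: power2_eq_square algebra_simps)
  moreover have "a * (r + s) + b > 0"
    using assms by (simp add: add_pos_pos)
  ultimately show ?thesis by auto
qed

lemma pos_root_eqI:
  assumes "a > 0" "b > 0" "r > 0" "a * r\<^sup>2 = b * (1 - r)"
  shows "pos_root a b = r"
  unfolding pos_root_def using assms pos_root_unique[of a b] by (intro the_equality) blast+

lemma pos_root:
  assumes "a > 0" "b > 0"
  shows pos_root_pos: "pos_root a b > 0"
    and pos_root_eq: "a * (pos_root a b)\<^sup>2 = b * (1 - pos_root a b)"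
    and pos_root_less_1: "pos_root a b < 1"
proof -
  define r where "r = (sqrt (b\<^sup>2 + 4 * a * b) - b) / (2 * a)"
  have "sqrt (b\<^sup>2) < sqrt (b\<^sup>2 + 4 * a * b)"
    using assms by (intro real_sqrt_less_mono) simp
  then have "r > 0" unfolding r_def using assms by simp
  have sq: "(sqrt (b\<^sup>2 + 4 * a * b))\<^sup>2 = b\<^sup>2 + 4 * a * b"
    using assms by (intro real_sqrt_pow2) simp
  have "2 * a * r + b = sqrt (b\<^sup>2 + 4 * a * b)"
    unfolding r_def using assms by simp
  then have "(2 * a * r + b)\<^sup>2 = b\<^sup>2 + 4 * a * b" using sq by simp
  then have "4 * a * (a * r\<^sup>2) = 4 * a * (b * (1 - r))"
    by (simp add: power2_eq_square algebra_simps)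
  then have eq: "a * r\<^sup>2 = b * (1 - r)" using assms by simp
  have root: "pos_root a b = r" using pos_root_eqI assms \<open>r > 0\<close> eq by blast
  show "pos_root a b > 0" using root \<open>r > 0\<close> by simp
  show "a * (pos_root a b)\<^sup>2 = b * (1 - pos_root a b)" using root eq by simp
  have "b * (1 - r) > 0" using eq \<open>r > 0\<close> assms by (metis mult_pos_pos zero_less_power)
  then show "pos_root a b < 1" using root assms by (simp add: zero_less_mult_iff)
qed

lemma pos_root_antimono:
  assumes "a > 0" "b > 0" "a \<le> a'"
  shows "pos_root a' b \<le> pos_root a b"
proof (rule ccontr)
  let ?r = "pos_root a b" and ?r' = "pos_root a' b"
  assume "\<not> ?r' \<le> ?r"
  then have less: "?r < ?r'" by simp
  have "a * ?r\<^sup>2 \<le> a' * ?r'\<^sup>2"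
    using assms less pos_root_pos[of a b] by (intro mult_mono power_mono) auto
  then have "b * (1 - ?r) \<le> b * (1 - ?r')"
    using pos_root_eq[of a b] pos_root_eq[of a' b] assms by simp
  then show False using less assms by simp
qed

text \<open>The root \<open>r\<close> gives two expressions for \<open>sqrt \<Lambda>'\<close>,
  namely \<open>sqrt M * r\<close> and \<open>sqrt \<Lambda> * sqrt (1 - r)\<close>. Multiplied by
  it, the claim becomes \<open>sqrt (1 - r) + r / 2 \<le> 1\<close>. Applied to \<open>lam I\<close>
  it counts inner iterations, applied to \<open>gam P\<close> outer ones.\<close>

lemma inverse_sqrt_pos_root_increment:
  assumes "M > 0" "\<Lambda> > 0"
  defines "\<Lambda>' \<equiv> M * (pos_root M \<Lambda>)\<^sup>2"
  shows "1 / sqrt \<Lambda>' \<ge> 1 / sqrt \<Lambda> + 1 / (2 * sqrt M)"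
proof -
  let ?r = "pos_root M \<Lambda>"
  have r: "?r > 0" "?r < 1" "\<Lambda>' = \<Lambda> * (1 - ?r)"
    using pos_root[of M \<Lambda>] assms by (auto simp: \<Lambda>'_def)
  have sq': "sqrt \<Lambda>' = sqrt M * ?r"
    unfolding \<Lambda>'_def using r(1) by (simp add: real_sqrt_mult)
  have sq: "sqrt \<Lambda>' = sqrt \<Lambda> * sqrt (1 - ?r)"
    by (simp add: r real_sqrt_mult)
  have "1 - ?r \<le> (1 - ?r / 2)\<^sup>2" by (simp add: power2_eq_square algebra_simps)
  then have "sqrt (1 - ?r) \<le> 1 - ?r / 2"
    using r by (intro real_le_lsqrt) auto
  have "1 / sqrt \<Lambda> + 1 / (2 * sqrt M) = (sqrt (1 - ?r) + ?r / 2) / sqrt \<Lambda>'"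
  proof -
    have "1 / sqrt \<Lambda> = sqrt (1 - ?r) / sqrt \<Lambda>'" using r(2) assms(1,2) unfolding sq by simp
    moreover have "1 / (2 * sqrt M) = (?r / 2) / sqrt \<Lambda>'" using r(1) assms(1,2) unfolding sq' by simp
    ultimately show ?thesis by (simp add: add_divide_distrib)
  qed
  also have "\<dots> \<le> 1 / sqrt \<Lambda>'"
    using \<open>sqrt (1 - ?r) \<le> 1 - ?r / 2\<close> r assms by (intro divide_right_mono) (auto simp: sq')
  finally show ?thesis .
qed

section \<open>From Hoelder growth to quadratic growth with slack\<close>

text \<open>Young's inequality with weights \<open>\<theta> = (1 + \<nu>) / 2\<close> and
  \<open>1 - \<theta>\<close> splits the Hoelder term into a quadratic and a constant. The case
  \<open>\<nu> = 1\<close>, where the second weight vanishes, is separate.\<close>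

lemma holder_le_quadratic:
  fixes M M\<^sub>\<nu> \<delta> \<nu> r :: real
  assumes \<nu>: "0 \<le> \<nu>" "\<nu> \<le> 1" and "M\<^sub>\<nu> > 0" "\<delta> > 0" "r \<ge> 0"
    and M: "M \<ge> M_bar \<nu> M\<^sub>\<nu> \<delta>"
  shows "M\<^sub>\<nu> / (1 + \<nu>) * r powr (1 + \<nu>) \<le> M / 2 * r\<^sup>2 + \<delta> / 2"
proof (cases "\<nu> = 1 \<or> r = 0")
  case True
  show ?thesis
  proof (cases "r = 0")
    case False
    with True assms have "r > 0" "\<nu> = 1" "M\<^sub>\<nu> \<le> M" by (auto simp: M_bar_def)
    then show ?thesis
      using \<open>\<delta> > 0\<close> mult_right_mono[of "M\<^sub>\<nu>" M "r\<^sup>2"]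
      by (simp add: add_increasing2)
  qed (use \<open>\<delta> > 0\<close> in simp)
next
  case False
  define \<theta> where "\<theta> = (1 + \<nu>) / 2"
  \<comment> \<open>\<open>A\<close> is the base of the power in \<open>M_bar\<close>. Its partner
    \<open>B\<close> below is chosen so that \<open>(1 - \<theta>) * B\<close> is the slack
    \<open>\<delta> / 2\<close>; then \<open>A * B = 1 / (2 * \<theta>)\<close>, which produces the
    constant \<open>1 / (1 + \<nu>)\<close>.\<close>
  define A where "A = (1 - \<nu>) / ((1 + \<nu>) * \<delta>)"
  have \<theta>: "0 < \<theta>" "0 < 1 - \<theta>" "1 + \<nu> = 2 * \<theta>" "1 - \<nu> = 2 * (1 - \<theta>)" and "r > 0" and "A > 0"
    using False assms by (auto simp: \<theta>_def A_def field_simps intro!: divide_pos_pos add_pos_nonneg)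
  have Mb: "M_bar \<nu> M\<^sub>\<nu> \<delta> = A powr ((1 - \<theta>) / \<theta>) * M\<^sub>\<nu> powr (1 / \<theta>)"
  proof -
    have *: "(1 - \<nu>) / (1 + \<nu>) = (1 - \<theta>) / \<theta>" "2 / (1 + \<nu>) = 1 / \<theta>"
      unfolding \<theta>(3,4) using \<theta>(1) by (simp_all add: field_simps)
    have A: "(1 - \<theta>) / \<theta> * (1 / \<delta>) = A" unfolding *(1)[symmetric] by (simp add: A_def)
    have "\<nu> \<noteq> 1" using False by simp
    then show ?thesis by (simp only: M_bar_def A * if_False)
  qed
  have "M\<^sub>\<nu> * A powr (1 - \<theta>) = (M_bar \<nu> M\<^sub>\<nu> \<delta>) powr \<theta>"
    using \<theta> \<open>M\<^sub>\<nu> > 0\<close> by (simp add: Mb powr_mult powr_powr)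
  also have "\<dots> \<le> M powr \<theta>"
    using M \<theta> by (intro powr_mono2) (auto simp: Mb)
  finally have *: "M\<^sub>\<nu> * A powr (1 - \<theta>) \<le> M powr \<theta>" .
  have "M_bar \<nu> M\<^sub>\<nu> \<delta> > 0" using \<open>A > 0\<close> \<open>M\<^sub>\<nu> > 0\<close> by (simp add: Mb)
  then have "M > 0" using M by simp
  define B where "B = \<delta> / (2 * (1 - \<theta>))"
  have "B > 0" and AB: "A * B = 1 / (2 * \<theta>)"
    using \<theta> \<open>\<delta> > 0\<close> by (auto simp: B_def A_def \<theta>(3,4))
  have "M\<^sub>\<nu> / (1 + \<nu>) * r powr (1 + \<nu>) = M\<^sub>\<nu> * A powr (1 - \<theta>) * ((r\<^sup>2 / (2 * \<theta>)) powr \<theta> * B powr (1 - \<theta>))"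
  proof -
    have 1: "A powr (1 - \<theta>) * B powr (1 - \<theta>) = (1 / (2 * \<theta>)) powr (1 - \<theta>)"
      using \<open>A > 0\<close> \<open>B > 0\<close> AB by (simp add: powr_mult flip: AB)
    have 2: "(r\<^sup>2 / (2 * \<theta>)) powr \<theta> = r powr (1 + \<nu>) * (1 / (2 * \<theta>)) powr \<theta>"
    proof -
      have "(r\<^sup>2 / (2 * \<theta>)) powr \<theta> = (r\<^sup>2) powr \<theta> * (1 / (2 * \<theta>)) powr \<theta>"
        using powr_mult[of "r\<^sup>2" "1 / (2 * \<theta>)" \<theta>] \<theta> by simp
      also have "(r\<^sup>2) powr \<theta> = r powr (1 + \<nu>)"
        using \<open>r > 0\<close> powr_powr[of r 2 \<theta>] by (simp add: \<theta>(3) powr_numeral)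
      finally show ?thesis .
    qed
    have 3: "(1 / (2 * \<theta>)) powr \<theta> * (1 / (2 * \<theta>)) powr (1 - \<theta>) = 1 / (1 + \<nu>)"
      using \<theta> by (simp flip: powr_add)
    have "M\<^sub>\<nu> * A powr (1 - \<theta>) * ((r\<^sup>2 / (2 * \<theta>)) powr \<theta> * B powr (1 - \<theta>))
        = M\<^sub>\<nu> * r powr (1 + \<nu>) * ((1 / (2 * \<theta>)) powr \<theta> * (A powr (1 - \<theta>) * B powr (1 - \<theta>)))"
      unfolding 2 by (simp only: mult_ac)
    then show ?thesis unfolding 1 3 by simp
  qed
  also have "\<dots> \<le> M powr \<theta> * ((r\<^sup>2 / (2 * \<theta>)) powr \<theta> * B powr (1 - \<theta>))"
    by (intro mult_right_mono *) simp
  also have "\<dots> = (M * (r\<^sup>2 / (2 * \<theta>))) powr \<theta> * B powr (1 - \<theta>)"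
    using powr_mult[of M "r\<^sup>2 / (2 * \<theta>)" \<theta>] \<open>M > 0\<close> \<theta> by simp
  also have "\<dots> \<le> \<theta> * (M * (r\<^sup>2 / (2 * \<theta>))) + (1 - \<theta>) * B"
    using \<theta> \<open>M > 0\<close> \<open>r > 0\<close> \<open>B > 0\<close> by (intro Youngs_inequality_0) auto
  also have "\<dots> = M / 2 * r\<^sup>2 + \<delta> / 2"
    using \<theta>(1,2) by (simp add: B_def field_simps)
  finally show ?thesis .
qed

lemma M_bar_pos:
  assumes "0 \<le> \<nu>" "\<nu> \<le> 1" "M\<^sub>\<nu> > 0" "\<epsilon> > 0"
  shows "M_bar \<nu> M\<^sub>\<nu> \<epsilon> > 0"
  using assms by (auto simp: M_bar_def)

lemma M_bar_scale:
  assumes \<nu>: "0 \<le> \<nu>" "\<nu> \<le> 1" and "\<epsilon> > 0" "c > 0"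
  shows "M_bar \<nu> M\<^sub>\<nu> (c * \<epsilon>) = M_bar \<nu> M\<^sub>\<nu> \<epsilon> * c powr (- ((1 - \<nu>) / (1 + \<nu>)))"
proof (cases "\<nu> = 1")
  case False
  have "(1 - \<nu>) / (1 + \<nu>) * (1 / (c * \<epsilon>)) = ((1 - \<nu>) / (1 + \<nu>) * (1 / \<epsilon>)) * (1 / c)"
    by simp
  then show ?thesis
    using assms False by (simp add: M_bar_def powr_mult powr_divide powr_minus_divide del: times_divide_eq_right) simp
qed (use assms in \<open>simp add: M_bar_def\<close>)

section \<open>The logarithmic factor of the bound\<close>

text \<open>The last square bracket of the bound, where \<open>m\<close> and \<open>u\<close> stand
  for V* / \<epsilon> times \<open>M_bar\<close> and L respectively.\<close>

definition log_bracket :: "real \<Rightarrow> real \<Rightarrow> real \<Rightarrow> real" where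
  "log_bracket \<nu> m u = (13 + 3 * \<nu>) / (3 * \<nu> + 1) + (2 + 2 * \<nu>) / (3 * \<nu> + 1) * log 2 m
     + (1 - \<nu>) / (3 * \<nu> + 1) * log 2 u"

text \<open>The square of the golden ratio.\<close>

definition golden_sq :: real where "golden_sq = (3 + sqrt 5) / 2"

lemma sqrt_2_bounds: "707 / 500 \<le> sqrt (2::real)" "sqrt (2::real) \<le> 14143 / 10000"
  by (rule real_le_rsqrt, simp add: power2_eq_square)
     (rule real_le_lsqrt; simp add: power2_eq_square)

lemma sqrt_5_bounds: "559 / 250 \<le> sqrt (5::real)" "sqrt (5::real) \<le> 22361 / 10000"
  by (rule real_le_rsqrt, simp add: power2_eq_square)
     (rule real_le_lsqrt; simp add: power2_eq_square)

lemma log_bracket_eq: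
  assumes "\<nu> \<ge> 0"
  shows "(3 * \<nu> + 1) * log_bracket \<nu> m u
     = 13 + 3 * \<nu> + (2 + 2 * \<nu>) * log 2 m + (1 - \<nu>) * log 2 u"
proof -
  have *: "d * (A / d + B / d * x + C / d * y) = A + B * x + C * y" if "d \<noteq> 0"
    for d A B C x y :: real
    using that by (simp add: distrib_left)
  show ?thesis unfolding log_bracket_def using assms by (intro *) simp
qed

lemma log2_ge_of_ge_inverse_75:
  assumes "x \<ge> 1 / 75"
  shows "log 2 x \<ge> - 25 / 4"
proof -
  have "4 * log 2 (75::real) = log 2 (75 ^ 4)" by (subst log_nat_power) simp_all
  also have "\<dots> \<le> log 2 (2 ^ 25)" by (subst log_le_cancel_iff) auto
  also have "\<dots> = 25" by (subst log_nat_power) auto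
  finally have "log 2 (1 / 75) \<ge> - 25 / (4::real)" by (simp add: log_divide)
  moreover have "log 2 (1 / 75) \<le> log 2 x" using assms by simp
  ultimately show ?thesis by linarith
qed

lemma log2_21_bounds: "35 / 8 \<le> log 2 (21::real)" "log 2 (21::real) \<le> 22 / 5"
proof -
  have "35 = log 2 ((2::real) ^ 35)" by (subst log_nat_power) auto
  also have "\<dots> \<le> log 2 (21 ^ 8)" by (subst log_le_cancel_iff) auto
  also have "\<dots> = 8 * log 2 (21::real)" by (subst log_nat_power) simp_all
  finally show "35 / 8 \<le> log 2 (21::real)" by simp
  have "5 * log 2 (21::real) = log 2 (21 ^ 5)" by (subst log_nat_power) simp_all
  also have "\<dots> \<le> log 2 (2 ^ 22)" by (subst log_le_cancel_iff) auto
  also have "\<dots> = 22" by (subst log_nat_power) auto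
  finally show "log 2 (21::real) \<le> 22 / 5" by simp
qed

text \<open>Inserting \<open>log 2 m \<ge> - 3\<close> and \<open>log 2 u \<ge> - 25 / 4\<close>
  leaves a numerator of at least 3/4 + 13/4 * \<nu>.\<close>

lemma log_bracket_nonneg:
  assumes \<nu>: "0 \<le> \<nu>" "\<nu> \<le> 1" and "u \<ge> 1 / 75" "m \<ge> 1 / 8"
  shows "log_bracket \<nu> m u \<ge> 0"
proof -
  have "log 2 (1 / 8) \<le> log 2 m" using assms by simp
  moreover have "log 2 (1 / 8 :: real) = - 3" using log_nat_power[of 2 2 3] by (simp add: log_divide)
  ultimately have "(2 + 2 * \<nu>) * log 2 m \<ge> (2 + 2 * \<nu>) * (- 3)"
    using \<nu> by (intro mult_left_mono) auto
  moreover have "(1 - \<nu>) * log 2 u \<ge> (1 - \<nu>) * (- 25 / 4)"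
    using \<nu> log2_ge_of_ge_inverse_75[OF assms(3)] by (intro mult_left_mono) auto
  moreover have "(1 - \<nu>) * (- 25 / 4) = - 25 / 4 + 25 / 4 * \<nu>" "(2 + 2 * \<nu>) * (- 3) = - 6 - 6 * \<nu>"
    by (simp_all add: field_simps)
  ultimately have "(3 * \<nu> + 1) * log_bracket \<nu> m u \<ge> 0"
    using \<nu> unfolding log_bracket_eq[OF \<nu>(1)] by linarith
  then show ?thesis using \<nu> by (simp add: zero_le_mult_iff)
qed

text \<open>
  If \<open>m \<le> 1 / 8\<close>, the logarithmic factors of the bound may be negative or have opposite signs. The
  bound still exceeds 1 because it is assumed that \<open>v \<ge> 1\<close>, where \<open>v = (4 * sqrt 2 + 3) * sqrt u\<close>
  and \<open>(4 * sqrt 2 + 3)\<^sup>2 < 75\<close>.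
\<close>

lemma log_bracket_product_ge:
  assumes \<nu>: "0 \<le> \<nu>" "\<nu> \<le> 1" and u: "1 / 75 \<le> u" "u \<le> m" and m: "m \<le> 1 / 8"
    and v: "1 \<le> v" "v\<^sup>2 \<le> 75 * u"
  shows "1 \<le> min 16 (320 * m) + (v + log 2 (8 * m)) * log_bracket \<nu> m u"
proof -
  define lm lu K B where "lm = log 2 m" and "lu = log 2 u" and "K = v + log 2 (8 * m)"
    and "B = log_bracket \<nu> m u"
  have "m \<ge> 1 / 75" "m > 0" "u > 0" using u by auto
  have lm: "lm \<ge> - 25 / 4" "lu \<ge> - 25 / 4" "lu \<le> lm"
    using log2_ge_of_ge_inverse_75 \<open>m \<ge> 1 / 75\<close> u \<open>u > 0\<close> by (auto simp: lm_def lu_def)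
  have "log 2 (8::real) = 3" using log_nat_power[of 2 2 3] by simp
  then have log8: "log 2 (8 * m) = 3 + lm"
    using \<open>m > 0\<close> by (simp add: log_mult lm_def)
  then have K: "K = v + 3 + lm" by (simp add: K_def)
  have "log 2 (8 * m) \<le> 0" using m \<open>m > 0\<close> by simp
  then have lm_le: "lm \<le> - 3" using log8 by simp
  have B: "(3 * \<nu> + 1) * B = 13 + 3 * \<nu> + (2 + 2 * \<nu>) * lm + (1 - \<nu>) * lu"
    unfolding B_def lm_def lu_def by (rule log_bracket_eq[OF \<nu>(1)])
  have Bge: "(3 * \<nu> + 1) * B \<ge> 27 / 4 + 37 / 4 * \<nu> + (2 + 2 * \<nu>) * lm"
  proof -
    have "(1 - \<nu>) * lu \<ge> (1 - \<nu>) * (- 25 / 4)"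
      using \<nu> lm by (intro mult_left_mono) auto
    then show ?thesis unfolding B by (simp add: field_simps)
  qed
  have lower: "B \<ge> - c" if "(3 * \<nu> + 1) * B \<ge> - c * (3 * \<nu> + 1)" for c
  proof -
    have "(3 * \<nu> + 1) * (- c) \<le> (3 * \<nu> + 1) * B" using that by (simp add: mult.commute)
    then show ?thesis using \<nu> by (simp only: mult_le_cancel_left_pos)
  qed
  have goal: "1 \<le> min 16 (320 * m) + K * B"
  \<comment> \<open>As \<open>m \<ge> 1 / 75\<close>, the minimum is always above 4.2, so any
    product \<open>K * B\<close> of at least \<open>- 16 / 5\<close> is harmless.\<close>
  proof (cases "K * B \<ge> 0")
    case True
    then show ?thesis using \<open>m \<ge> 1 / 75\<close> by (simp add: min_def)
  next
    case False
    then consider (neg) "K < 0" "B > 0" | (pos) "K > 0" "B < 0"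
      by (auto simp: not_le mult_less_0_iff)
    then show ?thesis
    proof cases
      case neg
      then have "lm < - 4" using K v by simp
      have "(1 - \<nu>) * lu \<le> (1 - \<nu>) * lm" using \<nu> lm by (intro mult_left_mono) auto
      then have "(3 * \<nu> + 1) * B \<le> 13 + 3 * \<nu> + (3 + \<nu>) * lm"
        unfolding B by (simp add: algebra_simps)
      also have "(3 + \<nu>) * lm \<le> (3 + \<nu>) * (- 4)"
        using \<open>lm < - 4\<close> \<nu> by (intro mult_left_mono) auto
      also have "13 + 3 * \<nu> + (3 + \<nu>) * (- 4) \<le> (3 * \<nu> + 1) * 1"
        using \<nu> by (simp add: algebra_simps)
      finally have "B \<le> 1" using \<nu> by (simp only: mult_le_cancel_left_pos)
      have "K \<ge> - 9 / 4" using K v lm by simp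
      have "(- K) * B \<le> 9 / 4 * 1"
        using neg \<open>B \<le> 1\<close> \<open>K \<ge> - 9 / 4\<close> by (intro mult_mono) auto
      then show ?thesis using \<open>m \<ge> 1 / 75\<close> by (simp add: min_def)
    next
      case pos
      show ?thesis
      \<comment> \<open>For \<open>m \<ge> 1 / 21\<close> the term \<open>320 * m\<close> exceeds 15
        and absorbs a product down to -31/10 * 41/20. For smaller \<open>m\<close> the bounds on
        \<open>v\<close> and \<open>lm\<close> leave so little for \<open>K\<close> that the product
        stays above \<open>- 16 / 5\<close>.\<close>
      proof (cases "m \<ge> 1 / 21")
        case True
        then have "log 2 (1 / 21) \<le> lm" by (simp add: lm_def)
        then have "lm \<ge> - 22 / 5" using log2_21_bounds by (simp add: log_divide)
        then have "(2 + 2 * \<nu>) * lm \<ge> (2 + 2 * \<nu>) * (- 22 / 5)"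
          using \<nu> by (intro mult_left_mono) auto
        moreover have "(2 + 2 * \<nu>) * (- 22 / 5) = - 44 / 5 - 44 / 5 * \<nu>"
          "- (41 / 20) * (3 * \<nu> + 1) = - 41 / 20 - 123 / 20 * \<nu>" by (simp_all add: field_simps)
        ultimately have "B \<ge> - (41 / 20)" using Bge \<nu> by (intro lower) linarith
        have "v \<le> 31 / 10"
          using v u m by (intro power2_le_imp_le[of v "31 / 10"]) (auto simp: power2_eq_square)
        then have "K \<le> 31 / 10" using K lm_le by simp
        then have "K * (- B) \<le> 31 / 10 * (41 / 20)"
          using pos \<open>B \<ge> - (41 / 20)\<close> by (intro mult_mono) auto
        then show ?thesis using True by (simp add: min_def)
      next
        case False
        then have "lm \<le> log 2 (1 / 21)" using \<open>m > 0\<close> by (simp add: lm_def)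
        then have "lm \<le> - 35 / 8" using log2_21_bounds by (simp add: log_divide)
        have "(2 + 2 * \<nu>) * lm \<ge> (2 + 2 * \<nu>) * (- 25 / 4)"
          using \<nu> lm by (intro mult_left_mono) auto
        moreover have "(2 + 2 * \<nu>) * (- 25 / 4) = - 25 / 2 - 25 / 2 * \<nu>"
          "- (23 / 4) * (3 * \<nu> + 1) = - 23 / 4 - 69 / 4 * \<nu>" by (simp_all add: field_simps)
        ultimately have "B \<ge> - (23 / 4)" using Bge \<nu> by (intro lower) linarith
        have "v \<le> 19 / 10"
          using v u False by (intro power2_le_imp_le[of v "19 / 10"]) (auto simp: power2_eq_square)
        then have "K \<le> 21 / 40" using K \<open>lm \<le> - 35 / 8\<close> by simp
        then have "K * (- B) \<le> 21 / 40 * (23 / 4)"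
          using pos \<open>B \<ge> - (23 / 4)\<close> by (intro mult_mono) auto
        then show ?thesis using \<open>m \<ge> 1 / 75\<close> by (simp add: min_def)
      qed
    qed
  qed
  then show ?thesis by (simp add: K_def B_def)
qed

section \<open>The constant of the leading term\<close>

text \<open>The weight of the credit for the trials of one iteration. Here \<open>2 + sqrt 2\<close>
  is the sum of the geometric series of ratio 1 / sqrt 2, the 2 comes from the cost 2 Y of a call,
  and \<open>golden_sq powr a\<close> bounds the growth of \<Gamma> powr (-a) in one
  iteration.\<close>

definition f_weight :: "real \<Rightarrow> real" where
  "f_weight a = 2 * (2 + sqrt 2) * golden_sq powr a"

text \<open>What remains of the constant D after splitting off \<open>f_weight\<close>. Being at
  least 2 it covers the telescoping, and \<open>f_factor - 1\<close> pays for iteration 1.\<close>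

definition f_factor :: real where
  "f_factor = 8 / (1 + sqrt 5)"

lemma golden_sq_bounds: "2617 / 1000 \<le> golden_sq" "golden_sq \<le> 2619 / 1000"
  using sqrt_5_bounds by (auto simp: golden_sq_def)

text \<open>The exponent of 1 + sqrt 5 in D is \<open>2 * a - 1\<close>, and the square of 1 + sqrt
  5 is 4 times \<open>golden_sq\<close>; the powers of 4 and 2 then merge into one of 8.\<close>

lemma leading_term_eq:
  assumes "m > 0"
  shows "(32 + 16 * sqrt 2) * (1 + sqrt 5) powr (2 * a - 1) * 2 powr a * m powr a
    = f_factor * f_weight a * (8 * m) powr a"
proof -
  have "(1 + sqrt 5) powr (2 * a - 1) = (1 + sqrt 5) powr (2 * a) / (1 + sqrt 5)"
    by (simp add: powr_diff add_pos_nonneg)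
  also have "(1 + sqrt 5) powr (2 * a) = ((1 + sqrt 5)\<^sup>2) powr a"
    using powr_powr[of "1 + sqrt 5" 2 a] by (simp add: powr_numeral add_pos_nonneg)
  also have "(1 + sqrt 5)\<^sup>2 = golden_sq * 4"
    by (simp add: golden_sq_def power2_eq_square algebra_simps)
  also have "(golden_sq * 4) powr a = golden_sq powr a * 4 powr a"
    using golden_sq_bounds by (intro powr_mult)
  finally have 1: "(1 + sqrt 5) powr (2 * a - 1) = golden_sq powr a * 4 powr a / (1 + sqrt 5)" .
  have "(4::real) powr a * 2 powr a = 8 powr a"
    using powr_mult[of 4 2 a] by simp
  moreover have "(8 * m) powr a = 8 powr a * m powr a"
    using assms by (intro powr_mult)
  moreover have "(32 + 16 * sqrt 2) * (golden_sq powr a * 4 powr a / (1 + sqrt 5)) * 2 powr a * m powr a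
      = (32 + 16 * sqrt 2) / (1 + sqrt 5) * golden_sq powr a * (4 powr a * 2 powr a) * m powr a"
    by simp
  moreover have "(32 + 16 * sqrt 2) / (1 + sqrt 5) = f_factor * (2 * (2 + sqrt 2))"
    by (simp add: f_factor_def)
  ultimately show ?thesis
    unfolding 1 f_weight_def by simp
qed

lemma f_weight_ge:
  assumes "1 / 2 \<le> a"
  shows "f_weight a \<ge> (2 + sqrt 2) * (1 + sqrt 5)"
proof -
  have "((1 + sqrt 5) / 2)\<^sup>2 = golden_sq"
    by (simp add: golden_sq_def power2_eq_square field_simps)
  then have "(1 + sqrt 5) / 2 = sqrt golden_sq"
    using sqrt_5_bounds by (intro real_sqrt_unique[symmetric]) auto
  also have "\<dots> = golden_sq powr (1 / 2)" using golden_sq_bounds by (simp add: powr_half_sqrt)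
  also have "\<dots> \<le> golden_sq powr a" using assms golden_sq_bounds by (intro powr_mono) auto
  finally have "2 * (2 + sqrt 2) * ((1 + sqrt 5) / 2) \<le> f_weight a"
    unfolding f_weight_def by (intro mult_left_mono) auto
  moreover have "2 * (2 + sqrt 2) * ((1 + sqrt 5) / 2) = (2 + sqrt 2) * (1 + sqrt 5)" by simp
  ultimately show ?thesis by linarith
qed

lemma f_factor_ge_2: "f_factor \<ge> 2"
  using sqrt_5_bounds by (simp add: f_factor_def pos_le_divide_eq)

text \<open>The budget of iteration 1: \<open>25 / 8\<close> is the cost of a call per unit of Y,
  \<open>2 + 2 * sqrt 2\<close> bounds the geometric sum over the halvings, and 1 is the evaluation
  at the starting point.\<close>

lemma f_factor_bound:
  assumes "1 / 2 \<le> a"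
  shows "25 / 8 * (2 + 2 * sqrt 2) + 1 \<le> (f_factor - 1) * f_weight a"
proof -
  have "(2 + sqrt 2) * (7 - sqrt 5) \<ge> (2 + 707 / 500) * (7 - 22361 / 10000)"
    using sqrt_2_bounds sqrt_5_bounds by (intro mult_mono) auto
  moreover have "25 / 8 * (2 + 2 * sqrt 2) + 1 \<le> (2 + 707 / 500) * (7 - 22361 / 10000)"
    using sqrt_2_bounds by simp
  ultimately have "25 / 8 * (2 + 2 * sqrt 2) + 1 \<le> (2 + sqrt 2) * (7 - sqrt 5)"
    by linarith
  also have "(2 + sqrt 2) * (7 - sqrt 5) = (f_factor - 1) * ((2 + sqrt 2) * (1 + sqrt 5))"
  proof -
    have "(f_factor - 1) * (1 + sqrt 5) = 7 - sqrt 5"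
      using sqrt_5_bounds by (simp add: f_factor_def field_simps)
    then show ?thesis by (metis mult.assoc mult.commute)
  qed
  also have "\<dots> \<le> (f_factor - 1) * f_weight a"
    using f_weight_ge[OF assms] f_factor_ge_2 by (intro mult_left_mono) auto
  finally show ?thesis .
qed

text \<open>Halving the constant multiplies Y by 2 powr a in iteration 1, so the costs of all trials
  form a geometric sum dominated by its last term.\<close>

lemma halving_sum_bound:
  assumes "1 / 2 \<le> a" "a \<le> 1"
  shows "2 powr a / (1 - 2 powr (- a)) \<le> 2 + 2 * sqrt 2"
    and "0 < 1 - 2 powr (- a)"
proof -
  define t :: real where "t = 2 powr a"
  have "t \<ge> sqrt 2" using assms powr_mono[of "1 / 2" a 2] by (simp add: t_def powr_half_sqrt)
  have "t \<le> 2" using assms powr_mono[of a 1 2] by (simp add: t_def)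
  have t: "t > 1" using \<open>t \<ge> sqrt 2\<close> sqrt_2_bounds by linarith
  have inv: "2 powr (- a) = 1 / t" by (simp add: t_def powr_minus_divide)
  then show "0 < 1 - 2 powr (- a)" using t by simp
  \<comment> \<open>The quadratic t * t - (2 + 2 * sqrt 2) * (t - 1) has the roots sqrt 2 and 2 +
    sqrt 2, and \<open>t\<close> lies between them.\<close>
  have "(t - sqrt 2) * (2 + sqrt 2 - t) \<ge> 0"
    using \<open>t \<ge> sqrt 2\<close> \<open>t \<le> 2\<close> sqrt_2_bounds by (intro mult_nonneg_nonneg) linarith+
  then have "t * t \<le> (2 + 2 * sqrt 2) * (t - 1)"
    by (simp add: algebra_simps)
  then have "t * t / (t - 1) \<le> 2 + 2 * sqrt 2" using t by (simp add: pos_divide_le_eq)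
  moreover have "t / (1 - 1 / t) = t * t / (t - 1)" using t by (simp add: field_simps)
  ultimately show "2 powr a / (1 - 2 powr (- a)) \<le> 2 + 2 * sqrt 2"
    by (simp add: inv flip: t_def)
qed

text \<open>A lower bound free of \<open>a\<close>, for the case of negative logarithms: the
  constant is at least 16, the base at least \<open>20 * m\<close>, and a power with exponent at
  most 1 lowers no base below 1.\<close>

lemma leading_term_ge:
  assumes "1 / 2 \<le> a" "a \<le> 1" "m > 0"
  shows "f_factor * f_weight a * (8 * m) powr a \<ge> min 16 (320 * m)"
proof -
  define c where "c = f_factor * (2 * (2 + sqrt 2))"
  have c: "c \<ge> 16"
    using sqrt_5_bounds sqrt_2_bounds by (simp add: c_def f_factor_def pos_le_divide_eq)
  have "f_factor * f_weight a * (8 * m) powr a = c * (golden_sq * (8 * m)) powr a"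
    using golden_sq_bounds assms by (simp add: c_def f_weight_def powr_mult)
  also have "\<dots> \<ge> 16 * (20 * m) powr a"
  proof -
    have "5 / 2 * (8 * m) \<le> golden_sq * (8 * m)"
      using golden_sq_bounds assms by (intro mult_right_mono) auto
    then have "(20 * m) powr a \<le> (golden_sq * (8 * m)) powr a"
      using assms by (intro powr_mono2) (simp, simp, linarith)
    then show ?thesis using c by (intro mult_mono) auto
  qed
  also have "16 * (20 * m) powr a \<ge> min 16 (320 * m)"
  proof (cases "20 * m \<ge> 1")
    case True
    then have "(20 * m) powr a \<ge> 1" using assms by (intro ge_one_powr_ge_zero) auto
    then show ?thesis by simp
  next
    case False
    then have "(20 * m) powr a \<ge> (20 * m) powr 1" using assms by (intro powr_mono') auto
    then show ?thesis using assms by simp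
  qed
  finally show ?thesis .
qed

section \<open>Arithmetic of one inner and one outer step\<close>

text \<open>The arithmetic of \<open>inner_step\<close>, separated from the vectors. Variables
  starting with \<open>s\<close> are values of the linearisation of f, those starting with
  \<open>l\<close> values of that of g; \<open>cz\<close>, \<open>cx\<close> are divergences from
  the centre of the call, \<open>dz\<close>, \<open>d1\<close> those from the previous inner point,
  and \<open>P\<close> is \<gamma>^2 times the new \<open>lam\<close>. The two sides differ by the
  sum of the slacks of the hypotheses.\<close>

lemma gap_recursion:
  fixes \<alpha> \<gamma> G P e :: real
  assumes "fb \<le> (1 - \<alpha>) * sI + \<alpha> * (1 - \<gamma>) * sc + \<alpha> * \<gamma> * sx + q + \<alpha> * (\<gamma> * e)"
    and "(1 - \<alpha>) * sI \<le> (1 - \<alpha>) * fI" "\<alpha> * (1 - \<gamma>) * sc \<le> \<alpha> * (1 - \<gamma>) * fc"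
    and "\<alpha> * \<gamma> * sx \<le> \<alpha> * \<gamma> * (fz + vx)" "q \<le> P * d1"
    and l: "lb = (1 - \<alpha>) * lI + \<alpha> * (1 - \<gamma>) * lc + \<alpha> * \<gamma> * lx" "lx = lz + gx"
    and "\<alpha> * \<gamma> * (vx + gx) \<le> \<alpha> * G * (cz - cx - w) + ((1 - \<alpha>) * G + P) * (dz - d1 - w)"
    and "(1 - \<alpha>) * G * d1 \<ge> 0" "G * u' \<le> G * ((1 - \<alpha>) * u + \<alpha> * cx)"
  shows "fb + lb - (1 - \<gamma>) * (fc + lc) - \<gamma> * (fz + lz) + G * (w + u' - cz) - \<gamma> * e + P * w
    \<le> (1 - \<alpha>) * (fI + lI - (1 - \<gamma>) * (fc + lc) - \<gamma> * (fz + lz) + G * (dz + u - cz) - \<gamma> * e) + P * dz"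
  (is "?l \<le> ?r")
proof -
  have "?r - ?l =
      ((1 - \<alpha>) * sI + \<alpha> * (1 - \<gamma>) * sc + \<alpha> * \<gamma> * sx + q + \<alpha> * (\<gamma> * e) - fb)
      + ((1 - \<alpha>) * fI - (1 - \<alpha>) * sI) + (\<alpha> * (1 - \<gamma>) * fc - \<alpha> * (1 - \<gamma>) * sc)
      + (\<alpha> * \<gamma> * (fz + vx) - \<alpha> * \<gamma> * sx) + (P * d1 - q)
      + (\<alpha> * G * (cz - cx - w) + ((1 - \<alpha>) * G + P) * (dz - d1 - w) - \<alpha> * \<gamma> * (vx + gx))
      + (1 - \<alpha>) * G * d1 + (G * ((1 - \<alpha>) * u + \<alpha> * cx) - G * u')"
    unfolding l by (simp add: algebra_simps)
  then show ?thesis using assms by linarith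
qed

text \<open>The hypothesis keeps \<open>r\<close> below the positive root (sqrt 5 - 1) / 2 of r^2 =
  1 - r, where 1 / (1 - r) is the square of the golden ratio.\<close>

lemma golden_contraction:
  fixes r :: real
  assumes "0 < r" "r\<^sup>2 \<le> 1 - r"
  shows "1 / (1 - r) \<le> golden_sq" "r < 1"
proof -
  have "(2 * r + 1)\<^sup>2 \<le> 5" using assms(2) by (simp add: power2_eq_square algebra_simps)
  then have "2 * r + 1 \<le> sqrt 5" by (rule real_le_rsqrt)
  then have r: "(3 - sqrt 5) / 2 \<le> 1 - r" by simp
  then show "r < 1" using sqrt_5_bounds by simp
  have "1 = golden_sq * ((3 - sqrt 5) / 2)" by (simp add: golden_sq_def algebra_simps)
  also have "\<dots> \<le> golden_sq * (1 - r)"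
    using r golden_sq_bounds by (intro mult_left_mono) auto
  finally show "1 / (1 - r) \<le> golden_sq" using \<open>r < 1\<close> by (simp add: pos_divide_le_eq)
qed

text \<open>The source of the telescoping: if R = R' * (1 - r) powr a, it gives R' * r <= 2 * (R' -
  R).\<close>

lemma two_powr_one_minus_le:
  fixes r a :: real
  assumes "0 < r" "r < 1" "1 / 2 \<le> a"
  shows "2 * (1 - r) powr a \<le> 2 - r"
proof -
  have "(1 - r) powr a \<le> (1 - r) powr (1 / 2)" using assms by (intro powr_mono') auto
  also have "\<dots> = sqrt (1 - r)" using assms by (simp add: powr_half_sqrt)
  also have "\<dots> \<le> 1 - r / 2"
    using assms by (intro real_le_lsqrt) (auto simp: power2_eq_square algebra_simps)
  finally show ?thesis by simp
qed

section \<open>Bregman divergences and proximal steps\<close>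

text \<open>The function is differentiable only relative to \<open>X\<close>, which may have empty
  interior. The chain rule is therefore applied along the segment from \<open>x\<close> to
  \<open>z\<close>, parametrised by \<open>{0..1}\<close>, which convexity keeps in
  \<open>X\<close>.\<close>

lemma directional_derivative_within:
  fixes \<phi> :: "'a::real_normed_vector \<Rightarrow> real"
  assumes "(\<phi> has_derivative \<phi>') (at x within X)" "convex X" "x \<in> X" "z \<in> X"
  shows "((\<lambda>v. (\<phi> (x + v *\<^sub>R (z - x)) - \<phi> x) / v) \<longlongrightarrow> \<phi>' (z - x)) (at_right 0)"
proof -
  let ?p = "\<lambda>v::real. x + v *\<^sub>R (z - x)"
  have sub: "?p ` {0..1} \<subseteq> X"
  proof safe
    fix v :: real assume "v \<in> {0..1}"
    then have "(1 - v) *\<^sub>R x + v *\<^sub>R z \<in> X"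
      using assms by (intro convexD_alt) auto
    then show "?p v \<in> X" by (simp add: algebra_simps)
  qed
  have "(?p has_derivative (\<lambda>h. h *\<^sub>R (z - x))) (at 0 within {0..1})"
    by (auto intro!: derivative_eq_intros)
  moreover have "(\<phi> has_derivative \<phi>') (at (?p 0) within ?p ` {0..1})"
    using assms(1) sub by (auto intro: has_derivative_subset)
  ultimately have "((\<phi> \<circ> ?p) has_derivative (\<lambda>h. \<phi>' (h *\<^sub>R (z - x)))) (at 0 within {0..1})"
    using diff_chain_within by (fastforce simp: o_def)
  then have "((\<phi> \<circ> ?p) has_derivative (\<lambda>h. \<phi>' (z - x) * h)) (at 0 within {0..1})"
    using has_derivative_linear[OF assms(1)] by (simp add: linear_scale mult.commute)
  then have "((\<lambda>v. (\<phi> (?p v) - \<phi> x) / v) \<longlongrightarrow> \<phi>' (z - x)) (at 0 within {0..1})"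
    using has_field_derivative_iff[of "\<phi> \<circ> ?p" "\<phi>' (z - x)" 0 "{0..1}"]
    by (simp add: has_field_derivative_def)
  moreover have "at_right 0 = at 0 within {0..1::real}"
    by (simp add: at_within_Icc_at_right)
  ultimately show ?thesis by simp
qed

text \<open>Divide the inequality of strong convexity by \<open>v\<close> and let \<open>v\<close>
  tend to 0 from the right. The modulus may be 0, which later yields the tangent inequality for
  g.\<close>

lemma bregman_ge:
  assumes "strongly_convex_on X nrm \<mu> \<omega>" "is_norm nrm"
    and "(\<omega> has_derivative (\<lambda>h. grad_\<omega> x \<bullet> h)) (at x within X)" "x \<in> X" "z \<in> X"
  shows "bregman \<omega> grad_\<omega> x z \<ge> \<mu> / 2 * (nrm (z - x))\<^sup>2"
proof -
  have "convex X" using assms by (simp add: strongly_convex_on_def)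
  let ?n = "\<mu> / 2 * (nrm (z - x))\<^sup>2"
  have "eventually (\<lambda>v::real. v \<in> {0<..<1}) (at_right 0)"
    by (rule eventually_at_right_real) simp
  then have "eventually (\<lambda>v. (\<omega> (x + v *\<^sub>R (z - x)) - \<omega> x) / v \<le> \<omega> z - \<omega> x - ?n * (1 - v)) (at_right 0)"
  proof eventually_elim
    case (elim v)
    then have "\<omega> (v *\<^sub>R z + (1 - v) *\<^sub>R x) \<le> v * \<omega> z + (1 - v) * \<omega> x - \<mu> / 2 * v * (1 - v) * (nrm (z - x))\<^sup>2"
      using assms(1,4,5) by (auto simp: strongly_convex_on_def)
    moreover have "v *\<^sub>R z + (1 - v) *\<^sub>R x = x + v *\<^sub>R (z - x)" by (simp add: algebra_simps)
    ultimately have "\<omega> (x + v *\<^sub>R (z - x)) - \<omega> x \<le> (\<omega> z - \<omega> x - ?n * (1 - v)) * v"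
      by (simp add: algebra_simps)
    then show ?case using elim by (simp add: pos_divide_le_eq)
  qed
  moreover have "((\<lambda>v. \<omega> z - \<omega> x - ?n * (1 - v)) \<longlongrightarrow> \<omega> z - \<omega> x - ?n * (1 - 0)) (at_right 0)"
    by (intro tendsto_intros)
  ultimately have "grad_\<omega> x \<bullet> (z - x) \<le> \<omega> z - \<omega> x - ?n * (1 - 0)"
    using tendsto_le[OF _ _ directional_derivative_within[OF assms(3) \<open>convex X\<close> assms(4,5)]]
    by fastforce
  then show ?thesis by (simp add: bregman_def)
qed

lemma
  assumes "is_norm nrm"
  shows is_norm_0: "nrm 0 = 0"
    and is_norm_scale: "nrm (c *\<^sub>R x) = \<bar>c\<bar> * nrm x"
    and is_norm_triangle: "nrm (x + y) \<le> nrm x + nrm y"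
    and is_norm_nonneg: "nrm x \<ge> 0"
proof -
  show z: "nrm 0 = 0" "nrm (c *\<^sub>R x) = \<bar>c\<bar> * nrm x" "nrm (x + y) \<le> nrm x + nrm y"
    using assms by (auto simp: is_norm_def)
  have "nrm (x + (-1) *\<^sub>R x) \<le> nrm x + nrm ((-1) *\<^sub>R x)" "nrm ((-1) *\<^sub>R x) = \<bar>-1\<bar> * nrm x"
    using assms unfolding is_norm_def by blast+
  then show "nrm x \<ge> 0" using z by simp
qed

text \<open>Half of the equivalence of norms, needed for coercivity of the proximal objective.
  Expansion in the basis makes \<open>nrm\<close> Lipschitz, so it attains a positive minimum on the
  Euclidean unit sphere.\<close>

lemma is_norm_lower_bound:
  fixes nrm :: "'a::euclidean_space \<Rightarrow> real"
  assumes nrm: "is_norm nrm"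
  obtains c where "c > 0" "\<And>x. nrm x \<ge> c * norm x"
proof -
  define C where "C = (\<Sum>b\<in>Basis. nrm (b::'a))"
  have upper: "nrm x \<le> C * norm x" for x
  proof -
    have sum_le: "nrm (\<Sum>b\<in>S. h b) \<le> (\<Sum>b\<in>S. nrm (h b))" if "finite S" for S and h :: "'a \<Rightarrow> 'a"
      using that
    proof induction
      case empty then show ?case using is_norm_0[OF nrm] by simp
    next
      case (insert b S) then show ?case
        using is_norm_triangle[OF nrm, of "h b" "\<Sum>b\<in>S. h b"] by simp
    qed
    have "nrm x = nrm (\<Sum>b\<in>Basis. (x \<bullet> b) *\<^sub>R b)" by (simp add: euclidean_representation)
    also have "\<dots> \<le> (\<Sum>b\<in>Basis. nrm ((x \<bullet> b) *\<^sub>R b))" by (rule sum_le) simp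
    also have "\<dots> = (\<Sum>b\<in>Basis. \<bar>x \<bullet> b\<bar> * nrm b)" by (simp add: is_norm_scale[OF nrm])
    also have "\<dots> \<le> (\<Sum>b\<in>Basis. norm x * nrm b)"
      by (intro sum_mono mult_right_mono Basis_le_norm is_norm_nonneg[OF nrm])
    finally show ?thesis by (simp add: C_def sum_distrib_left mult.commute)
  qed
  have lip: "\<bar>nrm x - nrm y\<bar> \<le> C * norm (x - y)" for x y
    using is_norm_triangle[OF nrm, of "x - y" y] is_norm_triangle[OF nrm, of "y - x" x]
      upper[of "x - y"] upper[of "y - x"] by (simp add: norm_minus_commute abs_le_iff)
  have "C \<ge> 0" by (auto simp: C_def intro: sum_nonneg is_norm_nonneg[OF nrm])
  have cont: "continuous_on UNIV nrm"
    by (rule lipschitz_on_continuous_on[of C])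
       (use lip \<open>C \<ge> 0\<close> in \<open>auto intro!: lipschitz_onI simp: dist_real_def dist_norm\<close>)
  obtain b :: 'a where b: "b \<in> sphere 0 1"
    using nonempty_Basis norm_Basis by (metis ex_in_conv mem_sphere_0)
  then obtain y where y: "y \<in> sphere 0 1" "\<And>x. x \<in> sphere 0 1 \<Longrightarrow> nrm y \<le> nrm x"
    using continuous_attains_inf[of "sphere (0::'a) 1" nrm] continuous_on_subset[OF cont] by auto
  have "nrm y \<ge> 0" "nrm y \<noteq> 0"
    using is_norm_nonneg[OF nrm] y(1) nrm by (auto simp: is_norm_def)
  then have "nrm y > 0" by simp
  moreover have "nrm x \<ge> nrm y * norm x" for x
  proof (cases "x = 0")
    case False
    have "nrm y \<le> nrm ((1 / norm x) *\<^sub>R x)" using False by (intro y) simp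
    then show ?thesis using False by (simp add: is_norm_scale[OF nrm] field_simps)
  qed (simp add: is_norm_0[OF nrm])
  ultimately show ?thesis using that by blast
qed



lemma convex_imp_ge_tangent:
  fixes g :: "'a::euclidean_space \<Rightarrow> real"
  assumes "convex_on UNIV g" "GDERIV g x :> d"
  shows "g x + d \<bullet> (y - x) \<le> g y"
proof -
  have "bregman g (\<lambda>_. d) x y \<ge> 0 / 2 * (norm (y - x))\<^sup>2"
  proof (rule bregman_ge[where X = UNIV])
    show "strongly_convex_on UNIV norm 0 g"
      using assms(1) by (auto simp: strongly_convex_on_def convex_on_def)
    show "is_norm (norm :: 'a \<Rightarrow> real)"
      by (auto simp: is_norm_def norm_triangle_ineq)
    show "(g has_derivative (\<lambda>h. d \<bullet> h)) (at x within UNIV)"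
      using assms(2) by (simp add: gderiv_def inner_commute)
  qed auto
  then show ?thesis by (simp add: bregman_def)
qed

section \<open>Existence and optimality of proximal steps\<close>

locale bregman_setup =
  fixes X :: "'a::euclidean_space set"
    and nrm :: "'a \<Rightarrow> real"
    and \<omega> :: "'a \<Rightarrow> real"
    and grad_\<omega> :: "'a \<Rightarrow> 'a"
  assumes closed: "closed X" and convex: "convex X"
    and nrm: "is_norm nrm"
    and \<omega>_diff: "\<And>x. x \<in> X \<Longrightarrow> (\<omega> has_derivative (\<lambda>h. grad_\<omega> x \<bullet> h)) (at x within X)"
    and \<omega>_strong: "strongly_convex_on X nrm 1 \<omega>"
begin

abbreviation "D \<equiv> bregman \<omega> grad_\<omega>"

lemma V_ge:
  assumes "x \<in> X" "z \<in> X"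
  shows "(nrm (z - x))\<^sup>2 \<le> 2 * D x z"
  using bregman_ge[where grad_\<omega> = grad_\<omega>, OF \<omega>_strong nrm \<omega>_diff[OF assms(1)] assms] by simp

lemma V_nonneg: "x \<in> X \<Longrightarrow> z \<in> X \<Longrightarrow> D x z \<ge> 0"
  using V_ge[of x z] zero_le_power2[of "nrm (z - x)"] by linarith

lemma V_self: "D x x = 0"
  by (simp add: bregman_def)

lemma V_convex:
  assumes "y \<in> X" "z \<in> X" "0 \<le> \<alpha>" "\<alpha> \<le> 1"
  shows "D x ((1 - \<alpha>) *\<^sub>R y + \<alpha> *\<^sub>R z) \<le> (1 - \<alpha>) * D x y + \<alpha> * D x z"
proof -
  have "\<omega> ((1 - \<alpha>) *\<^sub>R y + \<alpha> *\<^sub>R z)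
      \<le> (1 - \<alpha>) * \<omega> y + \<alpha> * \<omega> z - 1 / 2 * (1 - \<alpha>) * \<alpha> * (nrm (y - z))\<^sup>2"
    using \<omega>_strong assms unfolding strongly_convex_on_def by simp
  moreover have "1 / 2 * (1 - \<alpha>) * \<alpha> * (nrm (y - z))\<^sup>2 \<ge> 0"
    using assms by simp
  ultimately have "\<omega> ((1 - \<alpha>) *\<^sub>R y + \<alpha> *\<^sub>R z) \<le> (1 - \<alpha>) * \<omega> y + \<alpha> * \<omega> z" by linarith
  then show ?thesis by (simp add: bregman_def inner_simps algebra_simps)
qed

lemma continuous_on_V: "continuous_on X (D x)"
proof -
  have "continuous_on X \<omega>"
    using \<omega>_diff has_derivative_continuous continuous_on_eq_continuous_within by blast
  then show ?thesis unfolding bregman_def by (intro continuous_intros)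
qed

text \<open>\<open>X\<close> may be unbounded, so compactness comes from coercivity: far from
  \<open>y\<close> the term \<open>p * D y z\<close> grows quadratically and beats the linear one,
  hence only a ball around \<open>y\<close> matters.\<close>

lemma prox_minimizer_exists:
  assumes "\<eta> \<ge> 0" "p > 0" "x \<in> X" "y \<in> X"
  shows "\<exists>w. is_arg_min (\<lambda>z. l \<bullet> z + \<eta> * D x z + p * D y z) (\<lambda>z. z \<in> X) w"
proof -
  define \<phi> where "\<phi> = (\<lambda>z. l \<bullet> z + \<eta> * D x z + p * D y z)"
  obtain c where c: "c > 0" "\<And>x. nrm x \<ge> c * norm x"
    using is_norm_lower_bound[OF nrm] by blast
  define K where "K = p * c\<^sup>2 / 2"
  define e where "e = \<eta> * D x y"
  \<comment> \<open>Chosen with \<open>K * R = norm l + e + K\<close>: for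
    \<open>r > R \<ge> 1\<close> this gives \<open>r * (K * r - norm l) > e\<close>, where
    \<open>e\<close> is the part of the value at \<open>y\<close> beyond the linear term.\<close>
  define R where "R = (norm l + e) / K + 1"
  have "K > 0" "e \<ge> 0" using assms c V_nonneg by (auto simp: K_def e_def)
  have "R \<ge> 1" using \<open>K > 0\<close> \<open>e \<ge> 0\<close> by (simp add: R_def)
  have outside: "\<phi> z > \<phi> y" if "z \<in> X" "norm (z - y) > R" for z
  proof -
    define r where "r = norm (z - y)"
    have "r > R" using that by (simp add: r_def)
    have "c * r \<ge> 0" using c \<open>r > R\<close> \<open>R \<ge> 1\<close> by simp
    then have "(c * r)\<^sup>2 \<le> (nrm (z - y))\<^sup>2" using c by (intro power_mono) (auto simp: r_def)
    then have "(c * r)\<^sup>2 \<le> 2 * D y z" using V_ge[of y z] assms that by linarith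
    then have "p * (c * r)\<^sup>2 \<le> p * (2 * D y z)" using assms by (intro mult_left_mono) auto
    then have 1: "K * r\<^sup>2 \<le> p * D y z" by (simp add: K_def power_mult_distrib)
    have 2: "l \<bullet> (y - z) \<le> norm l * r"
      using norm_cauchy_schwarz[of l "y - z"] by (simp add: r_def norm_minus_commute)
    have "K * r > norm l + e + K"
    proof -
      have "K * R = norm l + e + K" using \<open>K > 0\<close> by (simp add: R_def field_simps)
      then show ?thesis using \<open>r > R\<close> \<open>K > 0\<close> by (metis mult_strict_left_mono)
    qed
    then have "1 * (e + K) \<le> r * (K * r - norm l)"
      using \<open>r > R\<close> \<open>R \<ge> 1\<close> \<open>K > 0\<close> \<open>e \<ge> 0\<close> by (intro mult_mono) auto
    then have "e < K * r\<^sup>2 - norm l * r"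
      using \<open>K > 0\<close> by (simp add: power2_eq_square algebra_simps)
    moreover have "\<eta> * D x z \<ge> 0" using assms that V_nonneg by simp
    ultimately show ?thesis
      using 1 2 by (simp add: \<phi>_def e_def V_self inner_diff_right)
  qed
  have "compact (X \<inter> cball y R)" using closed by (intro closed_Int_compact) auto
  moreover have "continuous_on (X \<inter> cball y R) \<phi>"
    unfolding \<phi>_def
    by (intro continuous_intros continuous_on_subset[OF continuous_on_V]) auto
  moreover have "y \<in> X \<inter> cball y R" using assms \<open>R \<ge> 1\<close> by simp
  ultimately obtain w where w: "w \<in> X \<inter> cball y R" "\<And>z. z \<in> X \<inter> cball y R \<Longrightarrow> \<phi> w \<le> \<phi> z"
    using continuous_attains_inf[of "X \<inter> cball y R" \<phi>] by blast
  have "\<phi> w \<le> \<phi> z" if "z \<in> X" for z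
  proof (cases "norm (z - y) > R")
    case True
    then show ?thesis using outside[OF that] w(2)[of y] \<open>y \<in> X \<inter> cball y R\<close> by simp
  next
    case False
    then show ?thesis using w(2)[of z] that by (simp add: dist_norm norm_minus_commute)
  qed
  then have "is_arg_min \<phi> (\<lambda>z. z \<in> X) w"
    using w(1) by (auto simp: is_arg_min_def not_less)
  then show ?thesis by (auto simp: \<phi>_def)
qed

text \<open>At a minimiser the one-sided derivative towards each \<open>z\<close> is nonnegative.
  The identity D x z = D x w + D w z + (grad w - grad x) . (z - w) turns this into the extra term
  \<open>(\<eta> + p) * D w z\<close>. Existence comes first because \<open>arg_min_on\<close> is a
  choice operator.\<close>

lemma
  fixes l x y \<eta> p
  assumes "\<eta> \<ge> 0" "p > 0" "x \<in> X" "y \<in> X"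
  defines "w \<equiv> arg_min_on (\<lambda>z. l \<bullet> z + \<eta> * D x z + p * D y z) X"
  shows prox_in: "w \<in> X"
    and prox_three_point: "z \<in> X \<Longrightarrow>
      l \<bullet> w + \<eta> * D x w + p * D y w + (\<eta> + p) * D w z \<le> l \<bullet> z + \<eta> * D x z + p * D y z"
proof -
  define \<phi> where "\<phi> = (\<lambda>z. l \<bullet> z + \<eta> * D x z + p * D y z)"
  have w: "is_arg_min \<phi> (\<lambda>z. z \<in> X) w"
    using prox_minimizer_exists[OF assms(1-4), of l]
    unfolding w_def arg_min_on_def arg_min_def \<phi>_def by (rule someI_ex)
  then show "w \<in> X" by (simp add: is_arg_min_def)
  assume z: "z \<in> X"
  let ?d = "l + \<eta> *\<^sub>R (grad_\<omega> w - grad_\<omega> x) + p *\<^sub>R (grad_\<omega> w - grad_\<omega> y)"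
  have "(\<phi> has_derivative (\<lambda>h. ?d \<bullet> h)) (at w within X)"
    unfolding \<phi>_def bregman_def
    by (auto intro!: derivative_eq_intros \<omega>_diff[OF \<open>w \<in> X\<close>] simp: inner_simps algebra_simps)
  then have lim: "((\<lambda>v. (\<phi> (w + v *\<^sub>R (z - w)) - \<phi> w) / v) \<longlongrightarrow> ?d \<bullet> (z - w)) (at_right 0)"
    using convex \<open>w \<in> X\<close> z by (rule directional_derivative_within)
  have "eventually (\<lambda>v::real. v \<in> {0<..<1}) (at_right 0)"
    by (rule eventually_at_right_real) simp
  then have "eventually (\<lambda>v. (\<phi> (w + v *\<^sub>R (z - w)) - \<phi> w) / v \<ge> 0) (at_right 0)"
  proof eventually_elim
    case (elim v)
    then have "(1 - v) *\<^sub>R w + v *\<^sub>R z \<in> X" using convex \<open>w \<in> X\<close> z by (intro convexD_alt) auto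
    moreover have "(1 - v) *\<^sub>R w + v *\<^sub>R z = w + v *\<^sub>R (z - w)" by (simp add: algebra_simps)
    ultimately show ?case using w elim by (auto simp: is_arg_min_def not_less)
  qed
  then have "?d \<bullet> (z - w) \<ge> 0"
    by (intro tendsto_lowerbound[OF lim]) auto
  then show "l \<bullet> w + \<eta> * D x w + p * D y w + (\<eta> + p) * D w z \<le> l \<bullet> z + \<eta> * D x z + p * D y z"
    by (simp add: bregman_def inner_simps algebra_simps)
qed

end

section \<open>The subroutine\<close>

locale pfugs_problem =
  pfugs X nrm f g f' grad_g \<omega> grad_\<omega> \<epsilon> M0 x0 + bregman_setup X nrm \<omega> grad_\<omega>
  for X :: "'a::euclidean_space set" and nrm f g f' grad_g \<omega> grad_\<omega> \<epsilon> M0 x0 +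
  fixes \<nu> M\<^sub>\<nu> L :: real
  assumes \<epsilon>: "\<epsilon> > 0"
    and \<nu>: "0 \<le> \<nu>" "\<nu> \<le> 1"
    and M\<nu>: "M\<^sub>\<nu> > 0"
    and f_growth: "\<And>x y v. v \<in> subdifferential f x \<Longrightarrow>
          f y - f x - v \<bullet> (y - x) \<le> M\<^sub>\<nu> / (1 + \<nu>) * nrm (y - x) powr (1 + \<nu>)"
    and f': "\<And>k s t i x. f' k s t i x \<in> subdifferential f x"
    and g_convex: "convex_on UNIV g"
    and g_diff: "\<And>x. GDERIV g x :> grad_g x"
    and g_growth: "\<And>x y. g y - g x - grad_g x \<bullet> (y - x) \<le> L / 2 * (nrm (y - x))\<^sup>2"
    and L_le: "L \<le> M_bar \<nu> M\<^sub>\<nu> \<epsilon>"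
    and x0: "x0 \<in> X"
    and M0: "0 < M0" "M0 \<le> L"
begin

abbreviation "Mb \<equiv> M_bar \<nu> M\<^sub>\<nu> \<epsilon>"
definition "a = (1 + \<nu>) / (1 + 3 * \<nu>)"

lemma Mb_pos: "Mb > 0" using M_bar_pos \<nu> M\<nu> \<epsilon> by blast

lemma L_pos: "L > 0" using M0 by simp

lemma a_bounds: "1 / 2 \<le> a" "a \<le> 1"
  using \<nu> by (auto simp: a_def field_simps)

lemma subgradient_ineq: "f x + f' k s t i x \<bullet> (y - x) \<le> f y"
  using f'[of k s t i x] by (simp add: subdifferential_def)

lemma g_ge_tangent: "g x + grad_g x \<bullet> (y - x) \<le> g y"
  by (rule convex_imp_ge_tangent[OF g_convex g_diff])

lemma f_quadratic_bound:
  assumes "v \<in> subdifferential f x" "\<delta> > 0" "M \<ge> M_bar \<nu> M\<^sub>\<nu> \<delta>"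
  shows "f y \<le> f x + v \<bullet> (y - x) + M / 2 * (nrm (y - x))\<^sup>2 + \<delta> / 2"
  using f_growth[OF assms(1), of y]
    holder_le_quadratic[OF \<nu> M\<nu> assms(2) is_norm_nonneg[OF nrm, of "y - x"] assms(3)]
  by linarith

section \<open>One inner iteration\<close>

definition call_ok :: "'a call \<Rightarrow> bool" where
  "call_ok C \<longleftrightarrow> c_x C \<in> X \<and> c_xb C \<in> X \<and> c_L C > 0 \<and> 0 < c_\<gamma> C \<and> c_\<gamma> C \<le> 1 \<and>
     c_L C \<le> c_M0 C \<and> c_M0 C \<le> 2 * Mb"

definition lin_g :: "'a \<Rightarrow> 'a \<Rightarrow> real" where
  "lin_g u y = g u + grad_g u \<bullet> (y - u)"

abbreviation gam2L :: "'a call \<Rightarrow> real" where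
  "gam2L C \<equiv> c_L C * (c_\<gamma> C)\<^sup>2"

text \<open>
  Lyapunov function of a call: \<open>inner_gap C z I / lam I + \<gamma>\<^sup>2 * V (i_x I) z\<close> does not increase, where
  \<open>lam I = M * \<alpha>\<^sup>2\<close>. The term \<open>V (c_x C) (i_xt I)\<close> is kept because it pays for the
  quadratic term of test (G).
\<close>

definition inner_gap :: "'a call \<Rightarrow> 'a \<Rightarrow> 'a inner \<Rightarrow> real" where
  "inner_gap C z I = f (i_xb I) + lin_g (c_xu C) (i_xb I)
     - (1 - c_\<gamma> C) * (f (c_xb C) + lin_g (c_xu C) (c_xb C))
     - c_\<gamma> C * (f z + lin_g (c_xu C) z)
     + gam2L C * (V (i_x I) z + V (c_x C) (i_xt I) - V (c_x C) z) - c_\<gamma> C * \<epsilon> / 2"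

definition inner_points :: "'a call \<Rightarrow> 'a inner \<Rightarrow> bool" where
  "inner_points C I \<longleftrightarrow> i_x I \<in> X \<and> i_xt I \<in> X \<and>
     i_xb I = (1 - c_\<gamma> C) *\<^sub>R c_xb C + c_\<gamma> C *\<^sub>R i_xt I"

abbreviation lam :: "'a inner \<Rightarrow> real" where "lam I \<equiv> i_M I * (i_\<alpha> I)\<^sup>2"

lemma inner_trial_simps:
  "i_M (inner_trial C t I i) = 2 ^ i * inner_fac C t I * i_M I"
  "i_\<alpha> (inner_trial C t I i) =
     (if t = 0 then 1 else pos_root (i_M (inner_trial C t I i)) (lam I))"
  "i_xu (inner_trial C t I i) = (1 - c_\<gamma> C) *\<^sub>R c_xb C + c_\<gamma> C *\<^sub>R
     ((1 - i_\<alpha> (inner_trial C t I i)) *\<^sub>R i_xt I + i_\<alpha> (inner_trial C t I i) *\<^sub>R i_x I)"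
  "i_v (inner_trial C t I i) = f' (c_k C) (c_s C) (t + 1) i (i_xu (inner_trial C t I i))"
  "i_x (inner_trial C t I i) = arg_min_on (\<lambda>z.
     (grad_g (c_xu C) + i_v (inner_trial C t I i)) \<bullet> z + (c_L C * c_\<gamma> C) * V (c_x C) z
     + (c_L C * c_\<gamma> C * (1 - i_\<alpha> (inner_trial C t I i)) / i_\<alpha> (inner_trial C t I i)
        + c_\<gamma> C * i_M (inner_trial C t I i) * i_\<alpha> (inner_trial C t I i)) * V (i_x I) z) X"
  "i_xt (inner_trial C t I i) = (1 - i_\<alpha> (inner_trial C t I i)) *\<^sub>R i_xt I
     + i_\<alpha> (inner_trial C t I i) *\<^sub>R i_x (inner_trial C t I i)"
  "i_xb (inner_trial C t I i) = (1 - c_\<gamma> C) *\<^sub>R c_xb C + c_\<gamma> C *\<^sub>R i_xt (inner_trial C t I i)"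
  by (simp_all add: inner_trial_def Let_def)

text \<open>Test (F) bounds f at the new point, its linear part splits along a convex combination,
  and the three-point inequality compares with \<open>z\<close>. The displacement in (F) is \<gamma>
  * \<alpha> times the proximal step, so its quadratic term is paid by \<open>V (i_x I)\<close>. The
  alternative \<open>i_\<alpha> J = 1\<close> covers inner iteration 1, where the old x-tilde has
  weight 0.\<close>

lemma inner_step:
  fixes C t I i
  defines "J \<equiv> inner_trial C t I i"
  assumes C: "call_ok C" and x: "i_x I \<in> X"
    and M: "i_M J > 0" and \<alpha>: "0 < i_\<alpha> J" "i_\<alpha> J \<le> 1"
    and prev: "inner_points C I \<or> i_\<alpha> J = 1"
    and F: "test_F C J"
  shows "inner_points C J"
    and "z \<in> X \<Longrightarrow> inner_gap C z J + (c_\<gamma> C)\<^sup>2 * lam J * V (i_x J) z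
           \<le> (1 - i_\<alpha> J) * inner_gap C z I + (c_\<gamma> C)\<^sup>2 * lam J * V (i_x I) z"
proof -
  define \<gamma> L \<alpha> M x' v xu xb where "\<gamma> = c_\<gamma> C" and "L = c_L C" and "\<alpha> = i_\<alpha> J" and "M = i_M J"
    and "x' = i_x J" and "v = i_v J" and "xu = i_xu J" and "xb = i_xb J"
  define p where "p = L * \<gamma> * (1 - \<alpha>) / \<alpha> + \<gamma> * M * \<alpha>"
  have pos: "L > 0" "\<gamma> > 0" "\<gamma> \<le> 1" "0 < \<alpha>" "\<alpha> \<le> 1" "M > 0"
    using C M assms(4,5) \<alpha> by (auto simp: call_ok_def L_def \<gamma>_def \<alpha>_def M_def)
  have cX: "c_x C \<in> X" "c_xb C \<in> X" using C by (auto simp: call_ok_def)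
  have "p > 0" unfolding p_def using pos by (intro add_nonneg_pos) auto
  have x'_eq: "x' = arg_min_on (\<lambda>z. (grad_g (c_xu C) + v) \<bullet> z + (L * \<gamma>) * V (c_x C) z + p * V (i_x I) z) X"
    unfolding x'_def J_def by (simp add: inner_trial_simps(5) p_def L_def \<gamma>_def \<alpha>_def M_def v_def J_def)
  have x': "x' \<in> X"
    unfolding x'_eq using pos \<open>p > 0\<close> cX x by (intro prox_in) auto
  have xt': "i_xt J = (1 - \<alpha>) *\<^sub>R i_xt I + \<alpha> *\<^sub>R x'"
    and xb': "xb = (1 - \<gamma>) *\<^sub>R c_xb C + \<gamma> *\<^sub>R i_xt J"
    and xu: "xu = (1 - \<gamma>) *\<^sub>R c_xb C + \<gamma> *\<^sub>R ((1 - \<alpha>) *\<^sub>R i_xt I + \<alpha> *\<^sub>R i_x I)"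
    unfolding \<alpha>_def x'_def xb_def xu_def J_def \<gamma>_def
    by (rule inner_trial_simps)+
  have "i_xt J \<in> X"
  proof (cases "\<alpha> = 1")
    case False
    then show ?thesis
      using prev convex x' pos unfolding xt' \<alpha>_def[symmetric] inner_points_def
      by (intro convexD_alt) auto
  qed (simp add: xt' x')
  then show "inner_points C J"
    using x' xb' by (simp add: inner_points_def x'_def xb_def \<gamma>_def)
  assume z: "z \<in> X"
  have three: "(grad_g (c_xu C) + v) \<bullet> x' + (L * \<gamma>) * V (c_x C) x' + p * V (i_x I) x' + (L * \<gamma> + p) * V x' z
      \<le> (grad_g (c_xu C) + v) \<bullet> z + (L * \<gamma>) * V (c_x C) z + p * V (i_x I) z"
    unfolding x'_eq using pos \<open>p > 0\<close> cX x z by (intro prox_three_point) auto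
  have sub: "f xu + v \<bullet> (y - xu) \<le> f y" for y
    unfolding v_def xu_def J_def inner_trial_simps(4) by (rule subgradient_ineq)
  have xb_eq: "xb = (1 - \<alpha>) *\<^sub>R i_xb I + (\<alpha> * (1 - \<gamma>)) *\<^sub>R c_xb C + (\<alpha> * \<gamma>) *\<^sub>R x'"
  proof (cases "\<alpha> = 1")
    case False
    then have *: "i_xb I = (1 - \<gamma>) *\<^sub>R c_xb C + \<gamma> *\<^sub>R i_xt I"
      using prev by (simp add: inner_points_def \<alpha>_def \<gamma>_def)
    show ?thesis unfolding * xb' xt' by (simp add: algebra_simps)
  qed (simp add: xb' xt')
  have "xb - xu = (\<gamma> * \<alpha>) *\<^sub>R (x' - i_x I)"
    by (simp add: xb' xt' xu algebra_simps)
  then have "(nrm (xb - xu))\<^sup>2 = (\<gamma> * \<alpha>)\<^sup>2 * (nrm (x' - i_x I))\<^sup>2"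
    by (simp add: is_norm_scale[OF nrm] power_mult_distrib)
  also have "\<dots> \<le> (\<gamma> * \<alpha>)\<^sup>2 * (2 * V (i_x I) x')"
    using V_ge[OF x x'] by (intro mult_left_mono) auto
  finally have "M / 2 * (nrm (xb - xu))\<^sup>2 \<le> M / 2 * ((\<gamma> * \<alpha>)\<^sup>2 * (2 * V (i_x I) x'))"
    using pos by (intro mult_left_mono) auto
  then have quad: "M / 2 * (nrm (xb - xu))\<^sup>2 \<le> \<gamma>\<^sup>2 * (M * \<alpha>\<^sup>2) * V (i_x I) x'"
    by (simp add: power_mult_distrib mult_ac)
  have "f xb \<le> f xu + v \<bullet> (xb - xu) + M / 2 * (nrm (xb - xu))\<^sup>2 + \<alpha> * (\<gamma> * (\<epsilon> / 2))"
    using F by (simp add: mult_ac test_F_def xb_def xu_def v_def M_def \<gamma>_def \<alpha>_def)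
  also have "f xu + v \<bullet> (xb - xu) = (1 - \<alpha>) * (f xu + v \<bullet> (i_xb I - xu))
      + \<alpha> * (1 - \<gamma>) * (f xu + v \<bullet> (c_xb C - xu)) + \<alpha> * \<gamma> * (f xu + v \<bullet> (x' - xu))"
    unfolding xb_eq by (simp add: inner_simps algebra_simps)
  finally have f1: "f xb \<le> (1 - \<alpha>) * (f xu + v \<bullet> (i_xb I - xu))
      + \<alpha> * (1 - \<gamma>) * (f xu + v \<bullet> (c_xb C - xu)) + \<alpha> * \<gamma> * (f xu + v \<bullet> (x' - xu))
      + M / 2 * (nrm (xb - xu))\<^sup>2 + \<alpha> * (\<gamma> * (\<epsilon> / 2))" .
  have f2: "(1 - \<alpha>) * (f xu + v \<bullet> (i_xb I - xu)) \<le> (1 - \<alpha>) * f (i_xb I)"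
    "\<alpha> * (1 - \<gamma>) * (f xu + v \<bullet> (c_xb C - xu)) \<le> \<alpha> * (1 - \<gamma>) * f (c_xb C)"
    using pos by (intro mult_left_mono sub; simp)+
  have "f xu + v \<bullet> (x' - xu) \<le> f z + v \<bullet> (x' - z)"
    using sub[of z] by (simp add: inner_simps)
  then have f3: "\<alpha> * \<gamma> * (f xu + v \<bullet> (x' - xu)) \<le> \<alpha> * \<gamma> * (f z + v \<bullet> (x' - z))"
    using pos by (intro mult_left_mono) auto
  define lg where "lg = lin_g (c_xu C)"
  have l1: "lg xb = (1 - \<alpha>) * lg (i_xb I) + \<alpha> * (1 - \<gamma>) * lg (c_xb C) + \<alpha> * \<gamma> * lg x'"
    unfolding lg_def lin_g_def xb_eq by (simp add: inner_simps algebra_simps)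
  have l2: "lg x' = lg z + grad_g (c_xu C) \<bullet> (x' - z)"
    unfolding lg_def lin_g_def by (simp add: inner_simps)
  have "v \<bullet> (x' - z) + grad_g (c_xu C) \<bullet> (x' - z)
      \<le> (L * \<gamma>) * V (c_x C) z + p * V (i_x I) z - (L * \<gamma>) * V (c_x C) x' - p * V (i_x I) x'
        - (L * \<gamma> + p) * V x' z"
    using three by (simp add: inner_simps)
  then have "\<alpha> * \<gamma> * (v \<bullet> (x' - z) + grad_g (c_xu C) \<bullet> (x' - z))
      \<le> \<alpha> * \<gamma> * ((L * \<gamma>) * V (c_x C) z + p * V (i_x I) z - (L * \<gamma>) * V (c_x C) x' - p * V (i_x I) x'
        - (L * \<gamma> + p) * V x' z)"
    using pos by (intro mult_left_mono) auto
  also have "\<dots> = \<alpha> * (L * \<gamma>\<^sup>2) * (V (c_x C) z - V (c_x C) x' - V x' z)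
      + (\<alpha> * \<gamma> * p) * (V (i_x I) z - V (i_x I) x' - V x' z)"
    by (simp add: power2_eq_square algebra_simps)
  \<comment> \<open>This identity is the reason for the form of \<open>p\<close>: one part continues
    the gap of the previous inner iterate with weight \<open>1 - \<alpha>\<close>, the other is the
    new \<open>lam\<close> times \<gamma>^2.\<close>
  also have "\<alpha> * \<gamma> * p = (1 - \<alpha>) * (L * \<gamma>\<^sup>2) + \<gamma>\<^sup>2 * (M * \<alpha>\<^sup>2)"
    using pos by (simp add: p_def power2_eq_square field_simps)
  finally have key: "\<alpha> * \<gamma> * (v \<bullet> (x' - z) + grad_g (c_xu C) \<bullet> (x' - z))
      \<le> \<alpha> * (L * \<gamma>\<^sup>2) * (V (c_x C) z - V (c_x C) x' - V x' z)
      + ((1 - \<alpha>) * (L * \<gamma>\<^sup>2) + \<gamma>\<^sup>2 * (M * \<alpha>\<^sup>2)) * (V (i_x I) z - V (i_x I) x' - V x' z)" .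
  have drop: "(1 - \<alpha>) * (L * \<gamma>\<^sup>2) * V (i_x I) x' \<ge> 0"
    using pos V_nonneg[OF x x'] by simp
  have "V (c_x C) (i_xt J) \<le> (1 - \<alpha>) * V (c_x C) (i_xt I) + \<alpha> * V (c_x C) x'"
  proof (cases "\<alpha> = 1")
    case False
    then show ?thesis using prev x' pos unfolding xt'
      by (intro V_convex) (auto simp: inner_points_def \<alpha>_def)
  qed (simp add: xt')
  then have "(L * \<gamma>\<^sup>2) * V (c_x C) (i_xt J) \<le> (L * \<gamma>\<^sup>2) * ((1 - \<alpha>) * V (c_x C) (i_xt I) + \<alpha> * V (c_x C) x')"
    using pos by (intro mult_left_mono) auto
  with f1 f2 f3 quad l1 l2 key drop
  have "f xb + lg xb - (1 - \<gamma>) * (f (c_xb C) + lg (c_xb C)) - \<gamma> * (f z + lg z)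
      + L * \<gamma>\<^sup>2 * (V x' z + V (c_x C) (i_xt J) - V (c_x C) z) - \<gamma> * (\<epsilon> / 2)
      + \<gamma>\<^sup>2 * (M * \<alpha>\<^sup>2) * V x' z
    \<le> (1 - \<alpha>) * (f (i_xb I) + lg (i_xb I) - (1 - \<gamma>) * (f (c_xb C) + lg (c_xb C)) - \<gamma> * (f z + lg z)
      + L * \<gamma>\<^sup>2 * (V (i_x I) z + V (c_x C) (i_xt I) - V (c_x C) z) - \<gamma> * (\<epsilon> / 2))
      + \<gamma>\<^sup>2 * (M * \<alpha>\<^sup>2) * V (i_x I) z"
    by (intro gap_recursion)
  then show "inner_gap C z J + (c_\<gamma> C)\<^sup>2 * lam J * V (i_x J) z
      \<le> (1 - i_\<alpha> J) * inner_gap C z I + (c_\<gamma> C)\<^sup>2 * lam J * V (i_x I) z"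
    by (simp add: inner_gap_def lg_def L_def \<gamma>_def \<alpha>_def M_def x'_def xb_def)
qed

section \<open>A uniform bound on the inner estimates\<close>

text \<open>
  \<open>M_max\<close> bounds the estimates \<open>M\<^sub>t\<close> of all inner iterations, except possibly of the last one, where
  the factor \<open>c\<close> may be arbitrarily large.
\<close>

definition sqrt_ratio :: "'a call \<Rightarrow> real" where
  "sqrt_ratio C = (2 * Mb / gam2L C) powr a * c_\<gamma> C"

definition M_max :: "'a call \<Rightarrow> real" where
  "M_max C = c_L C * (sqrt_ratio C)\<^sup>2"

lemma gam2L_bounds:
  assumes "call_ok C"
  shows "gam2L C > 0" "gam2L C \<le> 2 * Mb"
proof -
  have C: "c_L C > 0" "0 < c_\<gamma> C" "c_\<gamma> C \<le> 1" "c_L C \<le> 2 * Mb"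
    using assms by (auto simp: call_ok_def)
  then show "gam2L C > 0" by simp
  have "gam2L C \<le> c_L C * 1"
    using C by (intro mult_left_mono power_le_one) auto
  also have "\<dots> \<le> 2 * Mb" using C by simp
  finally show "gam2L C \<le> 2 * Mb" .
qed

lemma sqrt_ratio_pos: "call_ok C \<Longrightarrow> sqrt_ratio C > 0"
  using gam2L_bounds[of C] Mb_pos by (simp add: sqrt_ratio_def call_ok_def)

lemma M_max_eq:
  assumes "call_ok C"
  shows "M_max C = 2 * Mb * (2 * Mb / gam2L C) powr (2 * a - 1)"
proof -
  define r where "r = 2 * Mb / gam2L C"
  have "r > 0" using gam2L_bounds[OF assms] Mb_pos by (simp add: r_def)
  have "M_max C = gam2L C * (r powr a)\<^sup>2"
    by (simp add: M_max_def sqrt_ratio_def r_def power_mult_distrib)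
  also have "(r powr a)\<^sup>2 = r powr (2 * a)"
    by (simp add: power2_eq_square flip: powr_add)
  also have "r powr (2 * a) = r * r powr (2 * a - 1)"
    using \<open>r > 0\<close> powr_add[of r 1 "2 * a - 1"] by simp
  also have "gam2L C * (r * r powr (2 * a - 1)) = 2 * Mb * r powr (2 * a - 1)"
    using gam2L_bounds[OF assms] by (simp add: r_def)
  finally show ?thesis by (simp add: r_def)
qed

lemma M_max_ge:
  assumes "call_ok C"
  shows "2 * Mb \<le> M_max C" "c_M0 C \<le> M_max C"
proof -
  have "1 \<le> (2 * Mb / gam2L C) powr (2 * a - 1)"
    using gam2L_bounds[OF assms] a_bounds by (intro ge_one_powr_ge_zero) auto
  then show "2 * Mb \<le> M_max C"
    using Mb_pos mult_left_mono[of 1 _ "2 * Mb"] by (simp add: M_max_eq[OF assms])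
  then show "c_M0 C \<le> M_max C" using assms by (simp add: call_ok_def)
qed

text \<open>The tolerance in (F) shrinks with \<gamma> * \<alpha>, but the last hypothesis gives
  (\<gamma> * \<alpha>)^2 >= 1 / s. The required constant is thus at most Mb * s powr (q / 2), and
  it remains to see m <= s powr (1 - q / 2). Since 1 - q / 2 = 1 / (2 * a), this is m powr (2 * a)
  <= s, which fixes the exponent \<open>a\<close>.\<close>

lemma curvature_estimate_suffices:
  assumes C: "call_ok C" and "\<alpha> > 0" "M \<ge> M_max C / 2" "M * \<alpha>\<^sup>2 \<ge> c_L C"
  shows "M \<ge> M_bar \<nu> M\<^sub>\<nu> (c_\<gamma> C * \<alpha> * \<epsilon>)"
proof -
  define q where "q = (1 - \<nu>) / (1 + \<nu>)"
  define s where "s = M / gam2L C"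
  define m where "m = Mb / gam2L C"
  have g: "gam2L C > 0" "c_\<gamma> C > 0" "c_L C > 0"
    using gam2L_bounds[OF C] C by (auto simp: call_ok_def)
  have "M > 0" using M_max_ge[OF C] assms Mb_pos by linarith
  have "m > 0" "s > 0" using g Mb_pos \<open>M > 0\<close> by (auto simp: m_def s_def)
  have "q \<ge> 0" using \<nu> by (simp add: q_def)
  have aq: "1 - q / 2 = 1 / (2 * a)"
    using \<nu> by (simp add: q_def a_def field_simps)
  have "m powr (2 * a) = m * m powr (2 * a - 1)"
    using \<open>m > 0\<close> powr_add[of m 1 "2 * a - 1"] by simp
  also have "\<dots> \<le> m * (2 * m) powr (2 * a - 1)"
    using \<open>m > 0\<close> a_bounds by (intro mult_left_mono powr_mono2) auto
  also have "\<dots> = M_max C / 2 / gam2L C"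
    by (simp add: M_max_eq[OF C] m_def)
  also have "\<dots> \<le> s" unfolding s_def using assms g by (intro divide_right_mono) auto
  finally have "(m powr (2 * a)) powr (1 / (2 * a)) \<le> s powr (1 / (2 * a))"
    using a_bounds by (intro powr_mono2) auto
  then have "m \<le> s powr (1 - q / 2)"
    using \<open>m > 0\<close> a_bounds by (simp add: powr_powr aq)
  then have "m * s powr (q / 2) \<le> s powr (1 - q / 2) * s powr (q / 2)"
    by (intro mult_right_mono) auto
  also have "\<dots> = s" using \<open>s > 0\<close> by (simp flip: powr_add)
  finally have "Mb * s powr (q / 2) \<le> M"
    using g by (simp add: m_def s_def divide_simps)
  moreover have "(c_\<gamma> C * \<alpha>) powr (- q) \<le> s powr (q / 2)"
  proof -
    have "1 / s = (c_\<gamma> C)\<^sup>2 * c_L C / M" by (simp add: s_def)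
    also have "\<dots> \<le> (c_\<gamma> C)\<^sup>2 * \<alpha>\<^sup>2"
      using assms(4) \<open>M > 0\<close> g by (simp add: pos_divide_le_eq mult_left_mono mult_ac)
    finally have "1 / s \<le> (c_\<gamma> C * \<alpha>)\<^sup>2" by (simp add: power_mult_distrib)
    then have "((c_\<gamma> C * \<alpha>)\<^sup>2) powr (- (q / 2)) \<le> (1 / s) powr (- (q / 2))"
      using \<open>q \<ge> 0\<close> \<open>s > 0\<close> by (intro powr_mono2') auto
    also have "((c_\<gamma> C * \<alpha>)\<^sup>2) powr (- (q / 2)) = (c_\<gamma> C * \<alpha>) powr (- q)"
      using powr_powr[of "c_\<gamma> C * \<alpha>" 2 "- (q / 2)"] g assms(2) by (simp add: powr_numeral)
    also have "(1 / s) powr (- (q / 2)) = s powr (q / 2)"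
      using \<open>s > 0\<close> by (simp add: powr_minus powr_divide)
    finally show ?thesis .
  qed
  ultimately have "Mb * (c_\<gamma> C * \<alpha>) powr (- q) \<le> M"
    using mult_left_mono[of "(c_\<gamma> C * \<alpha>) powr (- q)" "s powr (q / 2)" Mb] Mb_pos by linarith
  then show ?thesis
    using M_bar_scale[OF \<nu> \<epsilon>, of "c_\<gamma> C * \<alpha>" M\<^sub>\<nu>] g assms(2) by (simp add: q_def)
qed

lemma test_F_holds:
  assumes "call_ok C" "J = inner_trial C t I i" "i_\<alpha> J > 0" "i_M J \<ge> M_max C / 2" "lam J \<ge> c_L C"
  shows "test_F C J"
proof -
  have "i_v J \<in> subdifferential f (i_xu J)"
    unfolding assms(2) inner_trial_simps(4) by (rule f')
  moreover have "c_\<gamma> C * i_\<alpha> J * \<epsilon> > 0"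
    using assms \<epsilon> by (simp add: call_ok_def)
  ultimately show ?thesis
    using f_quadratic_bound curvature_estimate_suffices assms unfolding test_F_def by blast
qed

text \<open>
  The factor is chosen so that, whenever the unchanged estimate would carry \<open>M * \<alpha>\<^sup>2\<close> to the target
  or below it, the next value hits the target exactly.
\<close>

lemma inner_fac_cases:
  fixes C t I
  defines "M' \<equiv> inner_fac C t I * i_M I"
  assumes "t \<ge> 1" "c_L C > 0" "i_M I > 0" "i_\<alpha> I > 0" "lam I > c_L C"
  shows "M' \<ge> i_M I"
    and "M' = i_M I \<and> M' * (pos_root M' (lam I))\<^sup>2 > c_L C \<or> M' * (pos_root M' (lam I))\<^sup>2 = c_L C"
proof -
  define M \<alpha> L \<Lambda> where "M = i_M I" and "\<alpha> = i_\<alpha> I" and "L = c_L C" and "\<Lambda> = M * \<alpha>\<^sup>2"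
  have pos: "M > 0" "\<alpha> > 0" "L > 0" "\<Lambda> > L" "\<Lambda> > 0"
    using assms by (auto simp: M_def \<alpha>_def L_def \<Lambda>_def)
  \<comment> \<open>The closed form of the root for an unchanged estimate. The condition tested by
    the algorithm then reads \<open>\<Lambda> * (1 - r) \<le> L\<close>: the next value would reach
    or pass the target.\<close>
  define r where "r = (\<alpha> * sqrt (\<alpha>\<^sup>2 + 4) - \<alpha>\<^sup>2) / 2"
  have sq: "(sqrt (\<alpha>\<^sup>2 + 4))\<^sup>2 = \<alpha>\<^sup>2 + 4" by simp
  have "\<alpha> < sqrt (\<alpha>\<^sup>2 + 4)" using pos by (intro real_less_rsqrt) simp
  then have "r > 0" using pos by (simp add: r_def power2_eq_square)
  have "r\<^sup>2 = \<alpha>\<^sup>2 * (1 - r)"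
  proof -
    have "2 * r + \<alpha>\<^sup>2 = \<alpha> * sqrt (\<alpha>\<^sup>2 + 4)" by (simp add: r_def field_simps)
    then have "(2 * r + \<alpha>\<^sup>2)\<^sup>2 = \<alpha>\<^sup>2 * (\<alpha>\<^sup>2 + 4)" by (simp add: power_mult_distrib sq)
    then show ?thesis by (simp add: power2_eq_square algebra_simps)
  qed
  then have eq: "M * r\<^sup>2 = \<Lambda> * (1 - r)" by (simp add: \<Lambda>_def)
  have root: "pos_root M \<Lambda> = r"
    using pos \<open>r > 0\<close> eq by (intro pos_root_eqI) auto
  have test: "M * (\<alpha> ^ 4 + 2 * \<alpha>\<^sup>2 - \<alpha> ^ 3 * sqrt (\<alpha>\<^sup>2 + 4)) / 2 = \<Lambda> * (1 - r)"
    by (simp add: \<Lambda>_def r_def eval_nat_numeral field_simps)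
  have "M' \<ge> M \<and> (M' = M \<and> M' * (pos_root M' \<Lambda>)\<^sup>2 > L \<or> M' * (pos_root M' \<Lambda>)\<^sup>2 = L)"
  proof (cases "\<Lambda> * (1 - r) \<le> L")
    case True
    then have "t \<ge> 1 \<and> M * (\<alpha> ^ 4 + 2 * \<alpha>\<^sup>2 - \<alpha> ^ 3 * sqrt (\<alpha>\<^sup>2 + 4)) / 2 \<le> L"
      using \<open>t \<ge> 1\<close> unfolding test by blast
    then have "inner_fac C t I = L * \<alpha> ^ 4 * M / (\<Lambda> - L)\<^sup>2"
      unfolding inner_fac_def Let_def M_def \<alpha>_def L_def \<Lambda>_def by (rule if_P)
    then have M': "M' = L * \<Lambda>\<^sup>2 / (\<Lambda> - L)\<^sup>2"
      by (simp add: M'_def \<Lambda>_def power_mult_distrib flip: M_def) (simp add: power2_eq_square power4_eq_xxxx)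
    \<comment> \<open>The root for which \<open>\<Lambda> * (1 - s)\<close> is exactly
      \<open>L\<close>; the prescribed factor is the one making the new estimate equal to L /
      s^2.\<close>
    define s where "s = 1 - L / \<Lambda>"
    have s: "s = (\<Lambda> - L) / \<Lambda>" "s > 0" using pos by (auto simp: s_def field_simps)
    have hit: "M' * s\<^sup>2 = L" using pos by (simp add: M' s(1) power_divide)
    have "M' > 0" using pos by (simp add: M')
    have "M' * s\<^sup>2 = \<Lambda> * (1 - s)" unfolding hit using pos by (simp add: s_def)
    then have "pos_root M' \<Lambda> = s" using pos \<open>M' > 0\<close> s by (intro pos_root_eqI) auto
    moreover have "M \<le> M'"
    proof -
      have "s \<le> r" using True pos by (simp add: s_def field_simps)
      then have "M * s\<^sup>2 \<le> M * r\<^sup>2" using pos s(2) by (intro mult_left_mono power_mono) auto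
      also have "\<dots> \<le> M' * s\<^sup>2" unfolding hit eq by (rule True)
      finally show ?thesis using s(2) by simp
    qed
    ultimately show ?thesis using hit by simp
  next
    case False
    then have "\<not> (t \<ge> 1 \<and> M * (\<alpha> ^ 4 + 2 * \<alpha>\<^sup>2 - \<alpha> ^ 3 * sqrt (\<alpha>\<^sup>2 + 4)) / 2 \<le> L)"
      unfolding test by blast
    then have "inner_fac C t I = 1"
      unfolding inner_fac_def Let_def M_def \<alpha>_def L_def by (rule if_not_P)
    then show ?thesis using False by (simp add: M'_def root eq flip: M_def)
  qed
  then show "M' \<ge> i_M I"
    and "M' = i_M I \<and> M' * (pos_root M' (lam I))\<^sup>2 > c_L C \<or> M' * (pos_root M' (lam I))\<^sup>2 = c_L C"
    by (simp_all add: M_def \<Lambda>_def \<alpha>_def L_def)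
qed

section \<open>Invariant and termination of a call\<close>

text \<open>Holds after each inner iteration that does not stop, hence the strict
  \<open>lam I > c_L C\<close>. The bound on \<open>t\<close> reflects the growth of 1 / sqrt lam by
  at least 1 / (2 sqrt M_max) per iteration. The bound on \<open>n\<close> charges one evaluation
  per iteration and the rest to doublings of the estimate, which never decreases.\<close>

definition inner_inv :: "'a call \<Rightarrow> nat \<Rightarrow> 'a inner \<Rightarrow> nat \<Rightarrow> bool" where
  "inner_inv C t I n \<longleftrightarrow> t \<ge> 1 \<and> inner_points C I \<and> i_\<alpha> I > 0 \<and> lam I > c_L C \<and>
     c_M0 C \<le> i_M I \<and> i_M I \<le> M_max C \<and>
     real t + 1 \<le> 2 * sqrt (M_max C / lam I) \<and>
     real n \<le> real t + log 2 (i_M I / c_M0 C) \<and>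
     (\<forall>z\<in>X. inner_gap C z I + (c_\<gamma> C)\<^sup>2 * lam I * V (i_x I) z \<le> (c_\<gamma> C)\<^sup>2 * lam I * V (c_x C) z)"

definition call_result :: "'a call \<Rightarrow> 'a inner \<Rightarrow> nat \<Rightarrow> bool" where
  "call_result C I n \<longleftrightarrow> inner_points C I \<and>
     real n \<le> 2 * sqrt_ratio C + 2 * log 2 (sqrt_ratio C) \<and>
     (\<forall>z\<in>X. inner_gap C z I + gam2L C * V (i_x I) z \<le> gam2L C * V (c_x C) z)"

text \<open>These facts concern every trial value, accepted or not. Doubling the estimate lowers
  \<alpha> and raises lam = (1 - \<alpha>) * lam I, so the line search cannot carry
  \<open>lam\<close> below the target once its first trial value does not.\<close>

lemma inner_trial_estimates:
  fixes C t I n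
  defines "J \<equiv> inner_trial C t I"
  assumes C: "call_ok C" and I: "t = 0 \<and> I = inner_start C \<or> inner_inv C t I n"
  shows "i_M (J i) = 2 ^ i * i_M (J 0)" "i_M (J 0) \<ge> i_M I" "i_M (J 0) > 0"
    and "0 < i_\<alpha> (J i)" "i_\<alpha> (J i) \<le> 1" "lam (J i) \<ge> c_L C"
    and "i_M (J 0) = i_M I \<or> t \<ge> 1 \<and> lam (J 0) = c_L C"
    and "t \<ge> 1 \<Longrightarrow> lam (J i) = (1 - i_\<alpha> (J i)) * lam I"
proof -
  have C': "c_L C > 0" "c_L C \<le> c_M0 C" using C by (auto simp: call_ok_def)
  show M2: "i_M (J i) = 2 ^ i * i_M (J 0)" for i
    by (simp add: J_def inner_trial_simps(1))
  have "i_M (J 0) \<ge> i_M I \<and> i_M (J 0) > 0 \<and> 0 < i_\<alpha> (J i) \<and> i_\<alpha> (J i) \<le> 1 \<and> lam (J i) \<ge> c_L C \<and>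
      (i_M (J 0) = i_M I \<or> t \<ge> 1 \<and> lam (J 0) = c_L C) \<and>
      (t \<ge> 1 \<longrightarrow> lam (J i) = (1 - i_\<alpha> (J i)) * lam I)"
  proof (cases "t = 0")
    case True
    then have I: "I = inner_start C" using I by (auto simp: inner_inv_def)
    have M: "i_M (J 0) = c_M0 C"
      using True by (simp add: J_def inner_trial_simps(1) I inner_start_def inner_fac_def)
    have \<alpha>: "i_\<alpha> (J i) = 1" using True by (simp add: J_def inner_trial_simps(2))
    have "1 * c_M0 C \<le> 2 ^ i * c_M0 C" using C' by (intro mult_right_mono) auto
    then have "i_M (J i) \<ge> c_L C" unfolding M2[of i] M using C' by linarith
    then show ?thesis using C' M \<alpha> True by (simp add: I inner_start_def)
  next
    case False
    then have "inner_inv C t I n" using I by simp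
    then have t: "t \<ge> 1" "i_M I > 0" "i_\<alpha> I > 0" "lam I > c_L C"
      using C' by (auto simp: inner_inv_def)
    have M0: "i_M (J 0) = inner_fac C t I * i_M I"
      by (simp add: J_def inner_trial_simps(1))
    have \<alpha>: "i_\<alpha> (J i) = pos_root (i_M (J i)) (lam I)" for i
      using False by (simp add: J_def inner_trial_simps(2))
    note fac = inner_fac_cases[OF t(1) C'(1) t(2-4), folded M0]
    have pos: "i_M (J 0) > 0" using fac(1) t by linarith
    then have Mi: "i_M (J i) > 0" "i_M (J 0) \<le> i_M (J i)" for i by (simp_all add: M2[of i])
    have lam: "lam (J i) = (1 - i_\<alpha> (J i)) * lam I" for i
      using pos_root_eq[of "i_M (J i)" "lam I"] Mi t C' by (simp add: \<alpha> mult.commute)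
    have "i_\<alpha> (J i) \<le> i_\<alpha> (J 0)"
      using pos_root_antimono[OF pos _ Mi(2)] t C' by (simp add: \<alpha>)
    then have "lam (J i) \<ge> lam (J 0)"
      using t C' unfolding lam by (intro mult_right_mono) auto
    moreover have "lam (J 0) \<ge> c_L C" using fac(2) by (auto simp: \<alpha>)
    moreover have "i_M (J 0) = i_M I \<or> lam (J 0) = c_L C" using fac(2) by (auto simp: \<alpha>)
    ultimately show ?thesis
      using pos fac(1) lam[of i] t C' pos_root_pos[of "i_M (J i)" "lam I"]
        pos_root_less_1[of "i_M (J i)" "lam I"] Mi by (auto simp: \<alpha>)
  qed
  then show "i_M (J 0) \<ge> i_M I" "i_M (J 0) > 0"
    "0 < i_\<alpha> (J i)" "i_\<alpha> (J i) \<le> 1" "lam (J i) \<ge> c_L C"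
    "i_M (J 0) = i_M I \<or> t \<ge> 1 \<and> lam (J 0) = c_L C"
    "t \<ge> 1 \<Longrightarrow> lam (J i) = (1 - i_\<alpha> (J i)) * lam I"
    by auto
qed

lemma inner_progress:
  assumes C: "call_ok C" and I: "t = 0 \<and> I = inner_start C \<and> n = 0 \<or> inner_inv C t I n"
    and reach: "inner_reach C t I n"
  obtains J n' where "inner_reach C (t + 1) J n'"
    "inner_inv C (t + 1) J n' \<or> inner_stop C (t + 1) J \<and> call_result C J n'"
proof -
  define J where "J = inner_trial C t I"
  have I': "t = 0 \<and> I = inner_start C \<or> inner_inv C t I n" using I by auto
  note est = inner_trial_estimates[OF C I', folded J_def]
  have C': "c_L C > 0" "c_L C \<le> c_M0 C" "0 < c_\<gamma> C" using C by (auto simp: call_ok_def)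
  have ratio: "sqrt_ratio C > 0" "M_max C > 0" using sqrt_ratio_pos[OF C] C' by (auto simp: M_max_def)
  have I_M: "c_M0 C \<le> i_M I" "i_M I \<le> M_max C"
    using I M_max_ge[OF C] by (auto simp: inner_inv_def inner_start_def)
  have stop: "\<not> inner_stop C t I"
    using I by (auto simp: inner_inv_def inner_stop_def)
  have F: "test_F C (J i)" if "i_M (J i) \<ge> M_max C / 2" for i
    using test_F_holds[OF C _ est(4) that est(6)] by (simp add: J_def)
  obtain i0 where "M_max C / 2 / i_M (J 0) < 2 ^ i0"
    using real_arch_pow[of 2] by auto
  then have "M_max C / 2 \<le> i_M (J i0)"
    using est(3) by (simp add: est(1)[of i0] pos_divide_less_eq)
  then have ex: "\<exists>i. test_F C (J i)" using F by blast
  define i where "i = (LEAST i. test_F C (J i))"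
  have i: "test_F C (J i)" "\<And>j. j < i \<Longrightarrow> \<not> test_F C (J j)"
    using LeastI_ex[OF ex] not_less_Least by (auto simp: i_def)
  define n' where "n' = n + (i + 1)"
  have reach': "inner_reach C (t + 1) (J i) n'"
    unfolding n'_def J_def using reach stop i by (intro inner_reach.step) (auto simp: J_def)
  \<comment> \<open>A doubling happens only after a failed test, hence from below
    \<open>M_max C / 2\<close>. Without doubling, only the factor that hits the target can raise the
    estimate.\<close>
  have M_cases: "i_M (J i) \<le> M_max C \<or> i = 0 \<and> t \<ge> 1 \<and> lam (J i) = c_L C"
  proof (cases i)
    case 0
    then show ?thesis using est(7) I_M by auto
  next
    case (Suc k)
    then have "i_M (J k) < M_max C / 2" using F[of k] i(2)[of k] by (simp add: not_le[symmetric]) blast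
    then show ?thesis using est(1)[of i] est(1)[of k] Suc by simp
  qed
  have x: "i_x I \<in> X" and prev: "inner_points C I \<or> i_\<alpha> (J i) = 1"
    using I C by (auto simp: inner_inv_def inner_points_def inner_start_def call_ok_def
        J_def inner_trial_simps(2))
  have MJ: "i_M (J i) \<ge> i_M I" "i_M (J i) \<ge> 2 ^ i * i_M I"
  proof -
    show "i_M (J i) \<ge> 2 ^ i * i_M I" unfolding est(1)[of i] using est(2) by simp
    have "1 * i_M I \<le> 2 ^ i * i_M I" using I_M C' by (intro mult_right_mono) auto
    then show "i_M (J i) \<ge> i_M I" using \<open>i_M (J i) \<ge> 2 ^ i * i_M I\<close> by linarith
  qed
  have pos: "i_M (J i) > 0" "i_M I > 0" "c_M0 C > 0" using MJ I_M C' by linarith+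
  note step = inner_step[OF C x pos(1)[unfolded J_def] est(4)[of i, unfolded J_def]
      est(5)[of i, unfolded J_def] prev[unfolded J_def] i(1)[unfolded J_def], folded J_def]
  have points: "inner_points C (J i)" by (rule step(1))
  have gap: "\<forall>z\<in>X. inner_gap C z (J i) + (c_\<gamma> C)\<^sup>2 * lam (J i) * V (i_x (J i)) z
      \<le> (c_\<gamma> C)\<^sup>2 * lam (J i) * V (c_x C) z"
  proof
    fix z assume z: "z \<in> X"
    show "inner_gap C z (J i) + (c_\<gamma> C)\<^sup>2 * lam (J i) * V (i_x (J i)) z
      \<le> (c_\<gamma> C)\<^sup>2 * lam (J i) * V (c_x C) z"
    proof (cases "t = 0")
      case True
      then have "i_\<alpha> (J i) = 1" "i_x I = c_x C"
        using I by (auto simp: J_def inner_trial_simps(2) inner_inv_def inner_start_def)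
      then show ?thesis using step(2)[OF z] by simp
    next
      case False
      then have inv: "inner_inv C t I n" and t: "t \<ge> 1" using I by auto
      have lam: "lam (J i) = (1 - i_\<alpha> (J i)) * lam I" by (rule est(8)[OF t])
      have "inner_gap C z I + (c_\<gamma> C)\<^sup>2 * lam I * V (i_x I) z \<le> (c_\<gamma> C)\<^sup>2 * lam I * V (c_x C) z"
        using inv z by (simp add: inner_inv_def)
      then have "(1 - i_\<alpha> (J i)) * (inner_gap C z I + (c_\<gamma> C)\<^sup>2 * lam I * V (i_x I) z)
          \<le> (1 - i_\<alpha> (J i)) * ((c_\<gamma> C)\<^sup>2 * lam I * V (c_x C) z)"
        using est(5)[of i] by (intro mult_left_mono) auto
      then show ?thesis using step(2)[OF z] unfolding lam by (simp add: algebra_simps)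
    qed
  qed
  have count: "real n' \<le> real t + 1 + log 2 (i_M (J i) / c_M0 C)"
  proof -
    have "real n \<le> real t + log 2 (i_M I / c_M0 C)"
      using I pos by (auto simp: inner_inv_def inner_start_def)
    moreover have "real i + log 2 (i_M I / c_M0 C) = log 2 (2 ^ i * i_M I / c_M0 C)"
      using pos by (simp add: log_mult log_divide log_nat_power)
    moreover have "\<dots> \<le> log 2 (i_M (J i) / c_M0 C)"
      using pos MJ(2) by (simp add: divide_right_mono)
    ultimately show ?thesis by (simp add: n'_def)
  qed
  have log_ratio: "log 2 (M_max C / c_M0 C) \<le> 2 * log 2 (sqrt_ratio C)"
  proof -
    have "log 2 (M_max C / c_M0 C) \<le> log 2 (M_max C / c_L C)"
      using C' pos ratio by (simp add: divide_left_mono)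
    also have "M_max C / c_L C = sqrt_ratio C ^ 2" using C' by (simp add: M_max_def)
    also have "log 2 (sqrt_ratio C ^ 2) = 2 * log 2 (sqrt_ratio C)"
      using ratio by (simp add: log_nat_power)
    finally show ?thesis .
  qed
  have sqrt_M_max: "sqrt (M_max C / c_L C) = sqrt_ratio C"
    using C' ratio by (simp add: M_max_def)
  have gap': "lam (J i) = c_L C \<Longrightarrow> call_result C (J i) n'"
    if "real t + 1 \<le> 2 * sqrt_ratio C" "log 2 (i_M (J i) / c_M0 C) \<le> 2 * log 2 (sqrt_ratio C) \<or> 
      real n' \<le> 2 * sqrt_ratio C + 2 * log 2 (sqrt_ratio C)"
    using points gap count that by (auto simp: call_result_def mult.commute)
  show ?thesis
  proof (rule that[OF reach'])
    show "inner_inv C (t + 1) (J i) n' \<or> inner_stop C (t + 1) (J i) \<and> call_result C (J i) n'"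
    proof (cases "i_M (J i) \<le> M_max C")
      case True
      have lam_pos: "lam (J i) > 0" using pos est(4)[of i] by simp
      \<comment> \<open>Since the estimate is at most \<open>M_max C\<close>, the increment of 1 /
        sqrt lam contributes at least 1 after scaling by \<open>2 * sqrt (M_max C)\<close>.\<close>
      have T: "real t + 2 \<le> 2 * sqrt (M_max C / lam (J i))"
      proof (cases "t = 0")
        case t0: True
        then have "i_\<alpha> (J i) = 1" by (simp add: J_def inner_trial_simps(2))
        then show ?thesis using True pos t0 by simp
      next
        case False
        then have inv: "inner_inv C t I n" using I by auto
        then have lamI: "lam I > 0" using C' by (auto simp: inner_inv_def)
        have \<alpha>: "i_\<alpha> (J i) = pos_root (i_M (J i)) (lam I)"
          using False by (simp add: J_def inner_trial_simps(2))
        have "real t + 2 \<le> 2 * sqrt (M_max C / lam I) + 1" using inv by (simp add: inner_inv_def)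
        also have "\<dots> \<le> 2 * sqrt (M_max C / lam I) + sqrt (M_max C / i_M (J i))"
          using True pos by simp
        also have "\<dots> = 2 * sqrt (M_max C) * (1 / sqrt (lam I) + 1 / (2 * sqrt (i_M (J i))))"
          by (simp add: real_sqrt_divide algebra_simps)
        also have "\<dots> \<le> 2 * sqrt (M_max C) * (1 / sqrt (lam (J i)))"
          using inverse_sqrt_pos_root_increment[OF pos(1) lamI] ratio
          by (intro mult_left_mono) (auto simp: \<alpha>)
        finally show ?thesis by (simp add: real_sqrt_divide)
      qed
      show ?thesis
      proof (cases "lam (J i) = c_L C")
        case stop: True
        have "real t + 1 \<le> 2 * sqrt_ratio C" using T unfolding stop sqrt_M_max by simp
        moreover have "log 2 (i_M (J i) / c_M0 C) \<le> log 2 (M_max C / c_M0 C)"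
          using pos True ratio by (simp add: divide_right_mono)
        ultimately show ?thesis using gap' stop log_ratio by (auto simp: inner_stop_def)
      next
        case False
        then have "lam (J i) > c_L C" using est(6)[of i] by simp
        then have "inner_inv C (t + 1) (J i) n'"
          using points est(4)[of i] I_M MJ(1) True T count gap
          unfolding inner_inv_def by (auto simp: algebra_simps)
        then show ?thesis ..
      qed
    next
      \<comment> \<open>The factor alone lifted the estimate above \<open>M_max C\<close>. This
        iteration is the last and costs a single evaluation, so the count uses the estimate of the
        preceding state.\<close>
      case False
      then have 0: "i = 0" "t \<ge> 1" "lam (J i) = c_L C" using M_cases by auto
      then have inv: "inner_inv C t I n" using I by auto
      have "2 * sqrt (M_max C / lam I) \<le> 2 * sqrt (M_max C / c_L C)"
        using inv C' ratio by (auto simp: inner_inv_def intro!: divide_left_mono)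
      then have t: "real t + 1 \<le> 2 * sqrt_ratio C"
        using inv unfolding sqrt_M_max by (auto simp: inner_inv_def)
      have "log 2 (i_M I / c_M0 C) \<le> log 2 (M_max C / c_M0 C)"
        using pos I_M ratio by (simp add: divide_right_mono)
      moreover have "real n \<le> real t + log 2 (i_M I / c_M0 C)" using inv by (simp add: inner_inv_def)
      ultimately have "real n' \<le> 2 * sqrt_ratio C + 2 * log 2 (sqrt_ratio C)"
        using t log_ratio 0 by (simp add: n'_def)
      then show ?thesis using gap' t 0 by (auto simp: inner_stop_def)
    qed
  qed
qed

text \<open>While the call runs, \<open>lam\<close> exceeds \<open>c_L C\<close>, so the invariant
  keeps \<open>t\<close> below \<open>2 * sqrt_ratio C\<close>.\<close>

lemma subroutine_terminates:
  assumes C: "call_ok C"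
  obtains I n where "subroutine C I n" "call_result C I n"
proof -
  have "\<exists>J n'. subroutine C J n' \<and> call_result C J n'"
    if "t = 0 \<and> I = inner_start C \<and> n = 0 \<or> inner_inv C t I n" "inner_reach C t I n" for t I n
    using that
  proof (induction "nat \<lceil>2 * sqrt_ratio C\<rceil> - t" arbitrary: t I n rule: less_induct)
    case less
    obtain J n' where J: "inner_reach C (t + 1) J n'"
      "inner_inv C (t + 1) J n' \<or> inner_stop C (t + 1) J \<and> call_result C J n'"
      using inner_progress[OF C less.prems] by blast
    show ?case
    proof (cases "inner_inv C (t + 1) J n'")
      case True
      have L: "c_L C > 0" "lam J > c_L C" "M_max C > 0"
        using C True sqrt_ratio_pos[OF C] by (auto simp: call_ok_def inner_inv_def M_max_def)
      have "sqrt (M_max C / lam J) \<le> sqrt (M_max C / c_L C)"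
        using L by (auto intro!: divide_left_mono)
      also have "\<dots> = sqrt_ratio C" using L sqrt_ratio_pos[OF C] by (simp add: M_max_def)
      finally have "real (t + 1) < 2 * sqrt_ratio C"
        using True by (auto simp: inner_inv_def)
      then have "nat \<lceil>2 * sqrt_ratio C\<rceil> - (t + 1) < nat \<lceil>2 * sqrt_ratio C\<rceil> - t"
        by linarith
      then show ?thesis using less.hyps J(1) True by blast
    next
      case False
      then show ?thesis using J by (auto simp: subroutine_def)
    qed
  qed
  then show ?thesis using that inner_reach.start by blast
qed

end

section \<open>The outer iterations\<close>

locale pfugs_solution =
  pfugs_problem X nrm f g f' grad_g \<omega> grad_\<omega> \<epsilon> M0 x0 \<nu> M\<^sub>\<nu> L
  for X :: "'a::euclidean_space set" and nrm f g f' grad_g \<omega> grad_\<omega> \<epsilon> M0 x0 \<nu> M\<^sub>\<nu> L +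
  fixes xs :: 'a and Vs :: real
  assumes xs: "xs \<in> X" and Vs: "Vs = V x0 xs" "Vs > 0"
    and nondegenerate: "(4 * sqrt 2 + 3) * sqrt (L * Vs / \<epsilon>) \<ge> 1"
begin

section \<open>Potential and invariants of the outer iterations\<close>

definition "u = L * Vs / \<epsilon>"
definition "m = Mb * Vs / \<epsilon>"
definition "B = log_bracket \<nu> m u"
definition "g_bound = (4 * sqrt 2 + 3) * sqrt u"
definition "f_bound = f_factor * f_weight a * (8 * m) powr a + (g_bound + log 2 (8 * m)) * B"
definition "F z = f z + g z"

definition found :: bool where
  "found \<longleftrightarrow> (\<exists>z ng nf. computes z ng nf \<and> eps_solution X f g \<epsilon> xs z \<and>
     real ng \<le> g_bound \<and> real nf \<le> f_bound)"

lemma u_m: "u > 0" "u \<le> m" "1 / 75 \<le> u" "g_bound\<^sup>2 \<le> 75 * u" "g_bound \<ge> 1"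
proof -
  show "u > 0" using L_pos Vs(2) \<epsilon> by (simp add: u_def)
  show "u \<le> m" using L_le Vs(2) \<epsilon> by (simp add: u_def m_def divide_right_mono mult_right_mono)
  show g: "g_bound \<ge> 1" using nondegenerate by (simp add: g_bound_def u_def)
  have "(4 * sqrt 2 + 3)\<^sup>2 = 41 + 24 * sqrt 2" by (simp add: power2_eq_square algebra_simps)
  then have "(4 * sqrt 2 + 3)\<^sup>2 \<le> 75" using sqrt_2_bounds by simp
  then have "(4 * sqrt 2 + 3)\<^sup>2 * (sqrt u)\<^sup>2 \<le> 75 * (sqrt u)\<^sup>2" by (intro mult_right_mono) auto
  then show *: "g_bound\<^sup>2 \<le> 75 * u" using \<open>u > 0\<close> by (simp add: g_bound_def power_mult_distrib)
  have "1 \<le> g_bound\<^sup>2" using g by simp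
  then show "1 / 75 \<le> u" using * by simp
qed

lemma m_pos: "m > 0" using u_m by linarith

lemma weight_pos: "f_weight a > 0"
  using golden_sq_bounds by (simp add: f_weight_def add_pos_nonneg)

text \<open>The first trial point may already be a solution, so the bound must admit one evaluation
  even when its logarithms are negative.\<close>

lemma first_evaluation_le_f_bound: "1 \<le> f_bound"
proof (cases "8 * m \<le> 1")
  case True
  then show ?thesis
    using log_bracket_product_ge[of \<nu> u m g_bound] \<nu> u_m leading_term_ge[of a m] a_bounds m_pos
    unfolding f_bound_def B_def by linarith
next
  case False
  have "min 16 (320 * m) \<ge> 1" using False by (simp add: min_def)
  moreover have "(g_bound + log 2 (8 * m)) * B \<ge> 0"
    using False u_m \<nu> log_bracket_nonneg[of \<nu> u m] by (simp add: B_def)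
  ultimately show ?thesis
    using leading_term_ge[of a m] a_bounds m_pos unfolding f_bound_def by linarith
qed

definition gam :: "'a iterate \<Rightarrow> real" where
  "gam P = o_L P * (o_\<gamma> P)\<^sup>2"

text \<open>The last conjunct is the outer potential. The divergence term on its left makes it
  reproduce itself under the recursion of \<open>call_gap\<close>.\<close>

definition iter_ok :: "'a iterate \<Rightarrow> bool" where
  "iter_ok P \<longleftrightarrow> o_x P \<in> X \<and> o_xb P \<in> X \<and> o_L P > 0 \<and> o_L P \<le> 2 * Mb \<and> 0 < o_\<gamma> P \<and> o_\<gamma> P \<le> 1 \<and>
     F (o_xb P) - F xs + 2 * gam P * V (o_x P) xs \<le> 2 * gam P * Vs + \<epsilon> / 2"

definition solved :: "'a iterate \<Rightarrow> bool" where
  "solved P \<longleftrightarrow> eps_solution X f g \<epsilon> xs (o_xb P)"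

definition R :: "'a iterate \<Rightarrow> real" where
  "R P = (2 * Mb / gam P) powr a"

lemma gam_bounds:
  assumes "iter_ok P"
  shows "gam P > 0" "gam P \<le> o_L P" "gam P \<le> 2 * Mb"
proof -
  have P: "o_L P > 0" "o_L P \<le> 2 * Mb" "0 < o_\<gamma> P" "o_\<gamma> P \<le> 1" using assms by (auto simp: iter_ok_def)
  then show "gam P > 0" by (simp add: gam_def)
  have "gam P \<le> o_L P * 1" unfolding gam_def using P by (intro mult_left_mono power_le_one) auto
  then show "gam P \<le> o_L P" "gam P \<le> 2 * Mb" using P by linarith+
qed

lemma R_ge_1: "iter_ok P \<Longrightarrow> R P \<ge> 1"
  using gam_bounds[of P] a_bounds by (simp add: R_def ge_one_powr_ge_zero)

lemma unsolved_gam: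
  assumes "iter_ok P" "\<not> solved P"
  shows "gam P > \<epsilon> / (4 * Vs)"
proof -
  have P: "o_x P \<in> X" "o_xb P \<in> X"
    "F (o_xb P) - F xs + 2 * gam P * V (o_x P) xs \<le> 2 * gam P * Vs + \<epsilon> / 2"
    using assms(1) by (auto simp: iter_ok_def)
  have "F (o_xb P) - F xs > \<epsilon>" using assms(2) P by (simp add: solved_def eps_solution_def F_def)
  moreover have "2 * gam P * V (o_x P) xs \<ge> 0"
    using gam_bounds[OF assms(1)] V_nonneg[OF P(1) xs] by simp
  ultimately have "\<epsilon> < 4 * (gam P * Vs)" using P(3) by linarith
  then show ?thesis using Vs(2) by (simp add: pos_divide_less_eq mult_ac)
qed

lemma unsolved_bounds:
  assumes "iter_ok P" "gam P > \<epsilon> / (4 * Vs)"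
  shows "R P \<le> (8 * m) powr a" "8 * m > 1" "B \<ge> 0"
proof -
  note gam = gam_bounds[OF assms(1)]
  have *: "\<epsilon> < 4 * Vs * gam P" using assms(2) Vs(2) by (simp add: pos_divide_less_eq mult_ac)
  have "2 * Mb * \<epsilon> \<le> 2 * Mb * (4 * Vs * gam P)" using * Mb_pos by (intro mult_left_mono) auto
  then have "2 * Mb / gam P \<le> 8 * m"
    using gam \<epsilon> by (simp add: m_def pos_divide_le_eq pos_le_divide_eq mult_ac)
  then show "R P \<le> (8 * m) powr a"
    unfolding R_def using gam Mb_pos a_bounds by (intro powr_mono2) auto
  have "4 * Vs * gam P \<le> 4 * Vs * (2 * Mb)" using gam Vs(2) by (intro mult_left_mono) auto
  then have "\<epsilon> < 8 * (Mb * Vs)" using * by (simp add: mult_ac)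
  then show "8 * m > 1" using \<epsilon> by (simp add: m_def)
  then show "B \<ge> 0" unfolding B_def using \<nu> u_m by (intro log_bracket_nonneg) auto
qed

lemma test_G_holds: "l \<ge> L \<Longrightarrow> test_G l x y"
  using g_growth[of y x] mult_right_mono[of L l "(nrm (y - x))\<^sup>2"]
  by (simp add: test_G_def)

text \<open>The displacement in (G) is \<gamma> times \<open>i_xt I - c_x C\<close>, so its
  quadratic term cancels against \<open>V (c_x C) (i_xt I)\<close> in \<open>inner_gap\<close>. The
  factor 2 arises because \<open>inner_gap\<close> and the Lyapunov term, with \<open>lam\<close> at
  its target, each contribute \<open>gam2L C\<close> times the divergences.\<close>

lemma call_gap:
  assumes C: "call_ok C" and res: "call_result C I n"
    and xu: "c_xu C = (1 - c_\<gamma> C) *\<^sub>R c_xb C + c_\<gamma> C *\<^sub>R c_x C"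
    and G: "test_G (c_L C) (c_xu C) (i_xb I)"
  shows "F (i_xb I) \<le> (1 - c_\<gamma> C) * F (c_xb C) + c_\<gamma> C * F xs
     + 2 * gam2L C * (V (c_x C) xs - V (i_x I) xs) + c_\<gamma> C * \<epsilon> / 2"
proof -
  define \<gamma> G where "\<gamma> = c_\<gamma> C" and "G = gam2L C"
  have G_eq: "c_L C * \<gamma>\<^sup>2 = G" by (simp add: G_def \<gamma>_def)
  have C': "c_x C \<in> X" "c_xb C \<in> X" "0 < \<gamma>" "\<gamma> \<le> 1" "c_L C > 0"
    using C by (auto simp: call_ok_def \<gamma>_def)
  have I: "i_xt I \<in> X" "i_xb I = (1 - \<gamma>) *\<^sub>R c_xb C + \<gamma> *\<^sub>R i_xt I"
    using res by (auto simp: call_result_def inner_points_def \<gamma>_def)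
  have "i_xb I - c_xu C = \<gamma> *\<^sub>R (i_xt I - c_x C)"
    unfolding I xu \<gamma>_def[symmetric] by (simp add: algebra_simps)
  then have "(nrm (i_xb I - c_xu C))\<^sup>2 = \<gamma>\<^sup>2 * (nrm (i_xt I - c_x C))\<^sup>2"
    using C' by (simp add: is_norm_scale[OF nrm] power_mult_distrib)
  also have "\<dots> \<le> \<gamma>\<^sup>2 * (2 * V (c_x C) (i_xt I))"
    using V_ge[OF C'(1) I(1)] by (intro mult_left_mono) auto
  finally have "c_L C / 2 * (nrm (i_xb I - c_xu C))\<^sup>2 \<le> c_L C / 2 * (\<gamma>\<^sup>2 * (2 * V (c_x C) (i_xt I)))"
    using C' by (intro mult_left_mono) auto
  also have "\<dots> = G * V (c_x C) (i_xt I)" by (simp add: G_def \<gamma>_def)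
  finally have 1: "g (i_xb I) \<le> lin_g (c_xu C) (i_xb I) + G * V (c_x C) (i_xt I)"
    using G by (simp add: test_G_def lin_g_def)
  have "inner_gap C xs I + G * V (i_x I) xs \<le> G * V (c_x C) xs"
    using res xs by (simp add: call_result_def G_def)
  then have 2: "f (i_xb I) + lin_g (c_xu C) (i_xb I) + 2 * (G * V (i_x I) xs) + G * V (c_x C) (i_xt I)
      \<le> (1 - \<gamma>) * (f (c_xb C) + lin_g (c_xu C) (c_xb C)) + \<gamma> * (f xs + lin_g (c_xu C) xs)
        + 2 * (G * V (c_x C) xs) + \<gamma> * \<epsilon> / 2"
    unfolding inner_gap_def \<gamma>_def[symmetric] G_eq
    by (simp add: distrib_left right_diff_distrib)
  have lin: "lin_g (c_xu C) z \<le> g z" for z unfolding lin_g_def by (rule g_ge_tangent)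
  have "(1 - \<gamma>) * (f (c_xb C) + lin_g (c_xu C) (c_xb C)) \<le> (1 - \<gamma>) * F (c_xb C)"
    "\<gamma> * (f xs + lin_g (c_xu C) xs) \<le> \<gamma> * F xs"
    unfolding F_def using C' lin by (intro mult_left_mono; simp)+
  then have "F (i_xb I) \<le> (1 - \<gamma>) * F (c_xb C) + \<gamma> * F xs
      + 2 * (G * V (c_x C) xs) - 2 * (G * V (i_x I) xs) + \<gamma> * \<epsilon> / 2"
    using 1 2 unfolding F_def[of "i_xb I"] by linarith
  then show ?thesis by (simp add: G_def \<gamma>_def right_diff_distrib)
qed

lemma first_point_exists:
  obtains i where "first_test i" "\<And>j. j < i \<Longrightarrow> \<not> first_test j" "2 ^ i * M0 \<le> 2 * Mb"
proof -
  have test: "first_test i" if "2 ^ i * M0 \<ge> Mb" for i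
    unfolding first_test_def Let_def
    using that L_le f_quadratic_bound[OF f' \<epsilon> that] by (auto intro!: test_G_holds)
  obtain i0 where "Mb / M0 < 2 ^ i0" using real_arch_pow[of 2] by auto
  then have "first_test i0" using M0 by (intro test) (simp add: pos_divide_less_eq)
  then have ex: "\<exists>i. first_test i" by blast
  define i where "i = (LEAST i. first_test i)"
  have i: "first_test i" "\<And>j. j < i \<Longrightarrow> \<not> first_test j"
    using LeastI_ex[OF ex] not_less_Least by (auto simp: i_def)
  moreover have "2 ^ i * M0 \<le> 2 * Mb"
  proof (cases i)
    case 0
    then show ?thesis using M0 L_le Mb_pos by simp
  next
    case (Suc j)
    then have "2 ^ j * M0 < Mb" using test[of j] i(2)[of j] by (meson lessI not_le)
    then show ?thesis using Suc by simp
  qed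
  ultimately show ?thesis using that by blast
qed

text \<open>The same constant serves f and g, and the proximal step weighs \<open>V x0\<close> with
  twice that constant, which absorbs both quadratic terms.\<close>

lemma first_point_ok:
  assumes test: "first_test i" and le: "2 ^ i * M0 \<le> 2 * Mb"
  shows "iter_ok (first_point i)" "o_\<gamma> (first_point i) = 1" "o_L (first_point i) = 2 ^ i * M0"
proof -
  define P M v x where "P = first_point i" and "M = 2 ^ i * M0" and "v = f' 1 1 1 0 x0"
    and "x = o_x P"
  have "M > 0" using M0 by (simp add: M_def)
  show \<gamma>: "o_\<gamma> (first_point i) = 1" and L: "o_L (first_point i) = 2 ^ i * M0"
    by (simp_all add: first_point_def Let_def)
  have x_eq: "x = arg_min_on (\<lambda>z. (grad_g x0 + v) \<bullet> z + M * V x0 z + M * V x0 z) X"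
    unfolding x_def P_def first_point_def Let_def v_def M_def by simp
  have x: "x \<in> X" unfolding x_eq using \<open>M > 0\<close> x0 by (intro prox_in) auto
  have xb: "o_xb P = x" by (simp add: x_def P_def first_point_def Let_def)
  have three: "(grad_g x0 + v) \<bullet> x + M * V x0 x + M * V x0 x + (M + M) * V x xs
      \<le> (grad_g x0 + v) \<bullet> xs + M * V x0 xs + M * V x0 xs"
    unfolding x_eq using \<open>M > 0\<close> x0 xs by (intro prox_three_point) auto
  have t: "g x \<le> g x0 + grad_g x0 \<bullet> (x - x0) + M / 2 * (nrm (x - x0))\<^sup>2"
    "f x \<le> f x0 + v \<bullet> (x - x0) + M / 2 * (nrm (x - x0))\<^sup>2 + \<epsilon> / 2"
    using test by (auto simp: first_test_def Let_def test_G_def x_def P_def M_def v_def)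
  have "M / 2 * (nrm (x - x0))\<^sup>2 \<le> M / 2 * (2 * V x0 x)"
    using V_ge[OF x0 x] \<open>M > 0\<close> by (intro mult_left_mono) auto
  then have q: "M / 2 * (nrm (x - x0))\<^sup>2 \<le> M * V x0 x" by simp
  have lin: "f x0 + v \<bullet> (xs - x0) \<le> f xs" "g x0 + grad_g x0 \<bullet> (xs - x0) \<le> g xs"
    unfolding v_def by (rule subgradient_ineq g_ge_tangent)+
  have "F x - F xs + 2 * M * V x xs \<le> 2 * M * Vs + \<epsilon> / 2"
    using three t q lin unfolding F_def Vs(1) by (simp add: inner_simps algebra_simps)
  moreover have "gam P = M" by (simp add: gam_def P_def \<gamma> L M_def)
  ultimately show "iter_ok (first_point i)"
    using x xb \<open>M > 0\<close> le \<gamma> L by (simp add: iter_ok_def P_def x_def M_def mult.commute)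
qed

text \<open>
  With \<open>log 2 Y \<le> 9/16 * Y\<close> the logarithmic part of the cost of a call in iteration 1 is absorbed
  into the geometric sum of the leading parts.
\<close>

definition halving_ok :: "nat \<Rightarrow> 'a iterate \<Rightarrow> nat \<Rightarrow> bool" where
  "halving_ok s P nf \<longleftrightarrow> reach (Passed1 s P) 1 nf \<and> iter_ok P \<and> o_\<gamma> P = 1 \<and>
     o_L P * 2 ^ s \<le> 4 * Mb \<and> real nf \<le> f_bound \<and>
     real nf \<le> 1 + 25 / 8 * R P / (1 - 2 powr (- a))"

text \<open>
  Trials are counted from \<open>s = 0\<close> here. The summand \<open>f_weight a * R P * o_\<gamma> P / sqrt (2 ^ s)\<close> is the
  credit for the remaining trials of the iteration: a call spends the fraction \<open>1 - 1 / sqrt 2\<close> of it.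
\<close>

definition trial_ok :: "nat \<Rightarrow> nat \<Rightarrow> 'a iterate \<Rightarrow> nat \<Rightarrow> nat \<Rightarrow> bool" where
  "trial_ok k s P ng nf \<longleftrightarrow> reach (Trial k (s + 1) P) ng nf \<and> iter_ok P \<and>
     gam P > \<epsilon> / (4 * Vs) \<and> 2 ^ s * o_L P < 2 * L \<and>
     real nf + f_weight a * R P * o_\<gamma> P / sqrt (2 ^ s)
       \<le> f_factor * f_weight a * R P + (real ng - 1) * B \<and>
     real ng + log 2 (2 * L / (2 ^ s * o_L P)) \<le> 2 * sqrt (2 * L / gam P)"

lemma halving_start: "\<exists>P. halving_ok 1 P 1"
proof -
  obtain i where i: "first_test i" "\<And>j. j < i \<Longrightarrow> \<not> first_test j" "2 ^ i * M0 \<le> 2 * Mb"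
    using first_point_exists by blast
  let ?P = "first_point i"
  note P = first_point_ok[OF i(1,3)]
  have "reach (Passed1 1 ?P) 1 1" using i by (intro reach.first) auto
  moreover have "25 / 8 * R ?P / (1 - 2 powr (- a)) \<ge> 0"
    using R_ge_1[OF P(1)] halving_sum_bound[OF a_bounds] by simp
  ultimately have "halving_ok 1 ?P 1"
    using P i(3) first_evaluation_le_f_bound by (simp add: halving_ok_def mult.commute)
  then show ?thesis by blast
qed

lemma halving_gam:
  assumes inv: "halving_ok s P nf" and "\<not> found"
  shows "gam P > \<epsilon> / (4 * Vs)"
proof -
  have "reach (Passed1 s P) 1 nf" "iter_ok P" "real nf \<le> f_bound" using inv by (auto simp: halving_ok_def)
  moreover have "real 1 \<le> g_bound" using u_m by simp
  ultimately have "\<not> solved P"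
    using \<open>\<not> found\<close> unfolding found_def solved_def computes_def by blast
  then show ?thesis using unsolved_gam \<open>iter_ok P\<close> by blast
qed

text \<open>An unsolved iterate has 2 L / \<Gamma> below 8 * u, and 2 * sqrt (8 * u) = 4 * sqrt 2 *
  sqrt u.\<close>

lemma trial_gradient_count:
  assumes "trial_ok k s P ng nf"
  shows "real ng \<le> 4 * sqrt 2 * sqrt u"
proof -
  have P: "iter_ok P" "gam P > \<epsilon> / (4 * Vs)" "2 ^ s * o_L P < 2 * L"
    "real ng + log 2 (2 * L / (2 ^ s * o_L P)) \<le> 2 * sqrt (2 * L / gam P)"
    using assms by (auto simp: trial_ok_def)
  have l: "2 ^ s * o_L P > 0" using P(1) by (simp add: iter_ok_def)
  have "log 2 (2 * L / (2 ^ s * o_L P)) \<ge> 0" using P(3) l L_pos by simp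
  then have 1: "real ng \<le> 2 * sqrt (2 * L / gam P)" using P(4) by linarith
  have "\<epsilon> < 4 * Vs * gam P" using P(2) Vs(2) by (simp add: pos_divide_less_eq mult_ac)
  then have "2 * L * \<epsilon> \<le> 2 * L * (4 * Vs * gam P)" using L_pos by (intro mult_left_mono) auto
  then have "2 * L / gam P \<le> 8 * u"
    using gam_bounds[OF P(1)] \<epsilon> by (simp add: u_def pos_divide_le_eq pos_le_divide_eq mult_ac)
  then have "sqrt (2 * L / gam P) \<le> sqrt (8 * u)" by simp
  also have "sqrt (8 * u) = 2 * sqrt 2 * sqrt u"
    using real_sqrt_mult[of 4 2] by (simp add: real_sqrt_mult)
  finally show ?thesis using 1 by simp
qed

lemma halving_step:
  assumes inv: "halving_ok s P nf" and "\<not> found"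
  shows "(\<exists>P' nf'. halving_ok (s + 1) P' nf') \<or> (\<exists>nf'. trial_ok 2 0 P 1 nf')"
proof -
  have P: "iter_ok P" "o_\<gamma> P = 1" "reach (Passed1 s P) 1 nf" using inv by (auto simp: halving_ok_def)
  define l where "l = o_L P"
  have l: "l > 0" "l \<le> 2 * Mb" "gam P = l" using P by (auto simp: iter_ok_def gam_def l_def)
  have gam: "gam P > \<epsilon> / (4 * Vs)" using halving_gam[OF assms] .
  note bounds = unsolved_bounds[OF P(1) gam]
  define C where "C = call1 (s + 1) P"
  have C_simps: "c_L C = l / 2" "c_\<gamma> C = 1" "c_x C = x0" "c_xb C = x0" "c_xu C = x0"
    "c_M0 C = max M0 (l / 2)"
    by (simp_all add: C_def call1_def Let_def l_def)
  have C: "call_ok C"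
    using l x0 M0 L_le Mb_pos by (auto simp: call_ok_def C_simps)
  obtain I n where I: "subroutine C I n" "call_result C I n" using subroutine_terminates[OF C] by blast
  have Y: "sqrt_ratio C = 2 powr a * R P"
    using l Mb_pos powr_mult[of 2 "2 * Mb / l" a] by (simp add: sqrt_ratio_def C_simps R_def mult_ac)
  have "real n \<le> 2 * sqrt_ratio C + 2 * log 2 (sqrt_ratio C)" using I by (simp add: call_result_def)
  then have n: "real n \<le> 25 / 8 * (2 powr a * R P)"
    using log2_le_linear[OF sqrt_ratio_pos[OF C]] unfolding Y by linarith
  define w where "w = 1 - 2 powr (- a)"
  have w: "w > 0" "2 powr a / w \<le> 2 + 2 * sqrt 2"
    using halving_sum_bound[OF a_bounds] by (auto simp: w_def)
  \<comment> \<open>The geometric sum including the new call, whose Y is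
    \<open>2 powr a * R P\<close>; the choice of \<open>w\<close> gives
    \<open>1 + 2 powr a * w = 2 powr a\<close>.\<close>
  have sum: "real (nf + n) \<le> 1 + 25 / 8 * (2 powr a * R P) / w"
  proof -
    have "real nf \<le> 1 + 25 / 8 * R P / w" using inv by (simp add: halving_ok_def w_def)
    moreover have "1 + 2 powr a * w = 2 powr a"
      by (simp add: w_def right_diff_distrib flip: powr_add)
    moreover have "25 / 8 * ((1 + 2 powr a * w) * R P) / w = 25 / 8 * R P / w + 25 / 8 * (2 powr a * R P)"
      using w(1) by (simp add: field_simps)
    ultimately show ?thesis using n by simp
  qed
  have "25 / 8 * (2 powr a * R P) / w = 25 / 8 * R P * (2 powr a / w)" by simp
  also have "\<dots> \<le> 25 / 8 * R P * (2 + 2 * sqrt 2)"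
    using w R_ge_1[OF P(1)] by (intro mult_left_mono) auto
  finally have "real (nf + n) \<le> R P * (25 / 8 * (2 + 2 * sqrt 2) + 1)"
    using sum R_ge_1[OF P(1)] unfolding distrib_left by (simp only: mult_ac)
  also have "\<dots> \<le> R P * ((f_factor - 1) * f_weight a)"
    using f_factor_bound[OF a_bounds(1)] R_ge_1[OF P(1)] by (intro mult_left_mono) auto
  \<comment> \<open>All of iteration 1, with the rejected call included, is paid and the credit for
    iteration 2 is left over.\<close>
  finally have total: "real (nf + n) + f_weight a * R P \<le> f_factor * f_weight a * R P"
    by (simp add: algebra_simps)
  show ?thesis
  proof (cases "test_G (c_L C) (c_xu C) (i_xb I)")
    case True
    define P' where "P' = call_output C I"
    have P': "o_x P' = i_x I" "o_xb P' = i_xb I" "o_L P' = l / 2" "o_\<gamma> P' = 1"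
      by (simp_all add: P'_def call_output_def C_simps)
    have gam': "gam P' = l / 2" by (simp add: gam_def P')
    have pts: "i_x I \<in> X" "i_xb I \<in> X"
      using I by (auto simp: call_result_def inner_points_def C_simps)
    have "F (i_xb I) \<le> F xs + 2 * (l / 2) * (Vs - V (i_x I) xs) + \<epsilon> / 2"
      using call_gap[OF C I(2) _ True] by (simp add: C_simps Vs(1))
    then have ok: "iter_ok P'"
      using pts l by (simp add: iter_ok_def P' gam' algebra_simps)
    have "R P' = 2 powr a * R P" using Y by (simp add: R_def gam' sqrt_ratio_def C_simps)
    then have cost: "real (nf + n) \<le> 1 + 25 / 8 * R P' / w" using sum by simp
    have "real (nf + n) \<le> f_factor * f_weight a * R P"
      using total weight_pos R_ge_1[OF P(1)] mult_nonneg_nonneg[of "f_weight a" "R P"] by linarith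
    also have "\<dots> \<le> f_factor * f_weight a * (8 * m) powr a"
      using bounds f_factor_ge_2 weight_pos by (intro mult_left_mono) auto
    also have "\<dots> \<le> f_bound"
      using bounds u_m by (simp add: f_bound_def)
    finally have "real (nf + n) \<le> f_bound" .
    moreover have "reach (Passed1 (s + 1) P') 1 (nf + n)"
      unfolding P'_def by (rule reach.halve[OF P(3) C_def I(1) True])
    ultimately have "halving_ok (s + 1) P' (nf + n)"
      using ok cost inv unfolding halving_ok_def w_def by (simp add: P' l_def)
    then show ?thesis by blast
  next
    case False
    then have lL: "l < 2 * L" using test_G_holds[of "l / 2"] by (force simp: C_simps)
    have "reach (Done 1 P) 1 (nf + n)" by (rule reach.finish1[OF P(3) C_def I(1) False])
    from reach.enter[OF this] have "reach (Trial 2 1 P) 1 (nf + n)" by (simp add: numeral_2_eq_2)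
    moreover have "1 + log 2 (2 * L / l) \<le> 2 * sqrt (2 * L / l)"
    proof -
      have "sqrt (2 * L / l) \<ge> 1" using l lL by simp
      then have "2 * log 2 (sqrt (2 * L / l)) \<le> 2 * sqrt (2 * L / l) - 1" by (rule two_log2_le)
      moreover have "2 * log 2 (sqrt (2 * L / l)) = log 2 (sqrt (2 * L / l) ^ 2)"
        using l L_pos by (subst log_nat_power) auto
      ultimately show ?thesis using l L_pos by simp
    qed
    ultimately have "trial_ok 2 0 P 1 (nf + n)"
      using P gam total lL l by (simp add: trial_ok_def flip: l_def)
    then show ?thesis by blast
  qed
qed

lemma trial_step:
  assumes inv: "trial_ok k s P ng nf" and "\<not> found"
  shows "\<exists>k' s' P' nf'. trial_ok k' s' P' (ng + 1) nf'"
proof -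
  have P: "iter_ok P" "gam P > \<epsilon> / (4 * Vs)" "reach (Trial k (s + 1) P) ng nf"
    using inv by (auto simp: trial_ok_def)
  note gam = gam_bounds[OF P(1)] and bounds = unsolved_bounds[OF P(1,2)]
  have oP: "o_x P \<in> X" "o_xb P \<in> X" "o_L P > 0" "0 < o_\<gamma> P" "o_\<gamma> P \<le> 1"
    using P(1) by (auto simp: iter_ok_def)
  define l where "l = 2 ^ s * o_L P"
  have l: "l > 0" "o_L P \<le> l" "gam P \<le> l" "l < 2 * L"
  proof -
    have "1 * o_L P \<le> 2 ^ s * o_L P" using oP by (intro mult_right_mono) auto
    then show "l > 0" "o_L P \<le> l" "gam P \<le> l" unfolding l_def using oP gam by linarith+
    show "l < 2 * L" using inv by (simp add: trial_ok_def l_def)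
  qed
  define r where "r = pos_root l (gam P)"
  have r: "0 < r" "r < 1" "l * r\<^sup>2 = gam P * (1 - r)"
    using pos_root[OF l(1) gam(1)] by (auto simp: r_def)
  \<comment> \<open>Each trial constant \<open>l\<close> is at least \<open>gam P\<close>, which
    forces \<open>r\<close> below the golden section.\<close>
  have "l * r\<^sup>2 \<le> l * (1 - r)" unfolding r(3) using l r by (intro mult_right_mono) auto
  then have "r\<^sup>2 \<le> 1 - r" using l by simp
  note golden = golden_contraction(1)[OF r(1) this]
  have r_le: "r \<le> o_\<gamma> P / sqrt (2 ^ s)"
  proof -
    have "l * r\<^sup>2 \<le> gam P * 1" unfolding r(3) using r gam by (intro mult_left_mono) auto
    then have "2 ^ s * r\<^sup>2 \<le> (o_\<gamma> P)\<^sup>2" using oP by (simp add: l_def gam_def mult_ac)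
    then have "r\<^sup>2 \<le> (o_\<gamma> P)\<^sup>2 / 2 ^ s" by (simp add: pos_le_divide_eq mult.commute)
    then have "r \<le> sqrt ((o_\<gamma> P)\<^sup>2 / 2 ^ s)" by (rule real_le_rsqrt)
    then show ?thesis using oP by (simp add: real_sqrt_divide)
  qed
  define C where "C = call2 k (s + 1) P"
  have C_simps: "c_L C = l" "c_\<gamma> C = r" "c_x C = o_x P" "c_xb C = o_xb P"
    "c_xu C = (1 - r) *\<^sub>R o_xb P + r *\<^sub>R o_x P" "c_M0 C = max M0 l"
    by (simp_all add: C_def call2_def Let_def l_def r_def gam_def)
  have C: "call_ok C"
    using l r oP M0 L_le Mb_pos by (auto simp: call_ok_def C_simps)
  obtain I n where I: "subroutine C I n" "call_result C I n" using subroutine_terminates[OF C] by blast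
  \<comment> \<open>The value of \<open>R\<close> after this trial if it is accepted.\<close>
  define R' where "R' = (2 * Mb / (gam P * (1 - r))) powr a"
  have R': "R P = R' * (1 - r) powr a" "R' > 0"
  proof -
    have "2 * Mb / gam P = 2 * Mb / (gam P * (1 - r)) * (1 - r)" using r by simp
    then show "R P = R' * (1 - r) powr a"
      using r gam Mb_pos unfolding R_def R'_def by (metis powr_mult)
    show "R' > 0" using r gam Mb_pos by (simp add: R'_def)
  qed
  have Y: "sqrt_ratio C = R' * r"
    by (simp add: sqrt_ratio_def C_simps R'_def r(3))
  have R'_le: "R' \<le> golden_sq powr a * R P"
  proof -
    have "R' = (1 / (1 - r)) powr a * R P" using r by (simp add: R'(1) powr_divide)
    also have "\<dots> \<le> golden_sq powr a * R P"
      using golden r a_bounds R_ge_1[OF P(1)] by (intro mult_right_mono powr_mono2) auto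
    finally show ?thesis .
  qed
  have "R' * r \<le> golden_sq powr a * R P * (o_\<gamma> P / sqrt (2 ^ s))"
    using R'_le r_le r R_ge_1[OF P(1)] by (intro mult_mono) auto
  then have Y_le: "2 * sqrt_ratio C \<le> 2 * golden_sq powr a * (R P * o_\<gamma> P / sqrt (2 ^ s))"
    unfolding Y by simp
  \<comment> \<open>With \<Gamma> = l r^2, the square of Y is (2 Mb / l) powr (2 a) times (l /
    \<Gamma>) powr (2 a - 1). The first base is at most \<open>8 * m\<close> because
    \<open>l \<ge> gam P\<close>, the second at most \<open>32 * u\<close> because
    \<open>l < 2 * L\<close> and \<Gamma> is at least a quarter of \<open>gam P\<close>.\<close>
  have log_Y: "2 * log 2 (sqrt_ratio C) \<le> B"
  proof -
    define \<Gamma> where "\<Gamma> = gam P * (1 - r)"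
    have \<Gamma>: "\<Gamma> > 0" "\<Gamma> = l * r\<^sup>2" using gam r by (auto simp: \<Gamma>_def)
    have \<epsilon>Vs: "\<epsilon> < 4 * Vs * gam P" using P(2) Vs(2) by (simp add: pos_divide_less_eq mult_ac)
    have "2 * log 2 (sqrt_ratio C) = 2 * a * log 2 (2 * Mb / \<Gamma>) + log 2 (r\<^sup>2)"
      using r l(1) \<Gamma> Mb_pos unfolding Y R'_def \<Gamma>_def[symmetric]
      by (simp add: log_mult log_powr log_nat_power)
    also have "log 2 (r\<^sup>2) = - log 2 (l / \<Gamma>)"
    proof -
      have "l / \<Gamma> = 1 / r\<^sup>2" using l(1) unfolding \<Gamma>(2) by simp
      then show ?thesis using r(1) by (simp add: log_divide)
    qed
    also have "log 2 (2 * Mb / \<Gamma>) = log 2 (2 * Mb / l) + log 2 (l / \<Gamma>)"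
      using \<Gamma>(1) l Mb_pos by (simp add: log_divide log_mult)
    finally have "2 * log 2 (sqrt_ratio C) = 2 * a * log 2 (2 * Mb / l) + (2 * a - 1) * log 2 (l / \<Gamma>)"
      by (simp add: algebra_simps)
    also have "\<dots> \<le> 2 * a * log 2 (8 * m) + (2 * a - 1) * log 2 (32 * u)"
    proof -
      have "\<epsilon> \<le> 4 * Vs * l" using \<epsilon>Vs l(3) Vs(2) mult_left_mono[of "gam P" l "4 * Vs"] by linarith
      then have "2 * Mb * \<epsilon> \<le> 2 * Mb * (4 * Vs * l)" using Mb_pos by (intro mult_left_mono) auto
      then have "2 * Mb / l \<le> 8 * m"
        using l \<epsilon> by (simp add: m_def pos_divide_le_eq pos_le_divide_eq mult_ac)
      then have 1: "log 2 (2 * Mb / l) \<le> log 2 (8 * m)" using l Mb_pos m_pos by simp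
      have "1 / (1 - r) \<le> 4" using golden golden_sq_bounds by linarith
      then have "gam P \<le> 4 * \<Gamma>" using r gam by (simp add: \<Gamma>_def pos_divide_le_eq)
      then have "4 * Vs * gam P \<le> 4 * Vs * (4 * \<Gamma>)" using Vs(2) by (intro mult_left_mono) auto
      then have "\<epsilon> \<le> 16 * Vs * \<Gamma>" using \<epsilon>Vs by simp
      then have "l * \<epsilon> \<le> (2 * L) * (16 * Vs * \<Gamma>)" using l \<epsilon> by (intro mult_mono) auto
      then have "l / \<Gamma> \<le> 32 * u"
        using \<Gamma>(1) \<epsilon> by (simp add: u_def pos_divide_le_eq pos_le_divide_eq mult_ac)
      then have 2: "log 2 (l / \<Gamma>) \<le> log 2 (32 * u)" using l \<Gamma>(1) u_m by simp
      show ?thesis using 1 2 a_bounds by (intro add_mono mult_left_mono) auto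
    qed
    \<comment> \<open>The logarithms of 8 and 32 contribute 3 (2 + 2 \<nu>) + 5 (1 - \<nu>) = 11 +
      \<nu>, which is at most 13 + 3 \<nu>.\<close>
    also have "\<dots> \<le> B"
    proof -
      have "log 2 (8 * m) = 3 + log 2 m" "log 2 (32 * u) = 5 + log 2 u"
        using log_nat_power[of 2 2 3] log_nat_power[of 2 2 5] m_pos u_m by (simp_all add: log_mult)
      moreover have "(3 * \<nu> + 1) * (2 * a) = 2 + 2 * \<nu>" "(3 * \<nu> + 1) * (2 * a - 1) = 1 - \<nu>"
        using \<nu> by (simp_all add: a_def field_simps)
      ultimately have "(3 * \<nu> + 1) * (2 * a * log 2 (8 * m) + (2 * a - 1) * log 2 (32 * u))
          = (2 + 2 * \<nu>) * (3 + log 2 m) + (1 - \<nu>) * (5 + log 2 u)"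
        by (metis distrib_left mult.assoc)
      also have "\<dots> \<le> (3 * \<nu> + 1) * B"
        unfolding B_def log_bracket_eq[OF \<nu>(1)] using \<nu> by (simp add: algebra_simps)
      finally show ?thesis using \<nu> by (simp only: mult_le_cancel_left_pos)
    qed
    finally show ?thesis .
  qed
  define q where "q = R P * o_\<gamma> P / sqrt (2 ^ s)"
  have "q \<ge> 0" using R_ge_1[OF P(1)] oP by (simp add: q_def)
  have n: "real n \<le> 2 * golden_sq powr a * q + B"
    using I(2) Y_le log_Y by (simp add: call_result_def q_def)
  have nf: "real nf + f_weight a * q \<le> f_factor * f_weight a * R P + (real ng - 1) * B"
    using inv by (simp add: trial_ok_def q_def)
  have ng: "real ng + log 2 (2 * L / l) \<le> 2 * sqrt (2 * L / gam P)"
    using inv by (simp add: trial_ok_def l_def)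
  have weight: "f_weight a = 2 * golden_sq powr a * (2 + sqrt 2)" by (simp add: f_weight_def)
  show ?thesis
  proof (cases "test_G (c_L C) (c_xu C) (i_xb I)")
    case False
    then have lL: "l < L" using test_G_holds[of l] by (force simp: C_simps)
    have "reach (Trial k (Suc s + 1) P) (ng + 1) (nf + n)"
      using reach.reject[OF P(3) C_def I(1) False] by simp
    moreover have "real (nf + n) + f_weight a * (q / sqrt 2)
        \<le> f_factor * f_weight a * R P + real ng * B"
    proof -
      \<comment> \<open>Since (2 + sqrt 2) * (1 - 1 / sqrt 2) = 1, the credit pays for the call and
        keeps the share belonging to the next trial.\<close>
      have "f_weight a * q = 2 * golden_sq powr a * q + f_weight a * (q / sqrt 2)"
      proof -
        have eq: "(2 + sqrt 2) * q = q + (2 + sqrt 2) * (q / sqrt 2)"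
          by (simp add: field_simps)
        show ?thesis unfolding weight mult.assoc eq by (simp only: distrib_left)
      qed
      then show ?thesis using nf n by (simp add: left_diff_distrib)
    qed
    moreover have "f_weight a * R P * o_\<gamma> P / sqrt (2 ^ Suc s) = f_weight a * (q / sqrt 2)"
      by (simp add: q_def real_sqrt_mult mult_ac)
    \<comment> \<open>A rejection adds one gradient evaluation and doubles the constant, so the left
      side of the gradient count does not change.\<close>
    moreover have "log 2 (2 * L / (2 ^ Suc s * o_L P)) = log 2 (2 * L / l) - 1"
    proof -
      have "log 2 (2 * L / (2 ^ Suc s * o_L P)) = log 2 ((2 * L / l) / 2)" by (simp add: l_def)
      also have "\<dots> = log 2 (2 * L / l) - 1" using l L_pos by (subst log_divide) auto
      finally show ?thesis .
    qed
    ultimately have "trial_ok k (Suc s) P (ng + 1) (nf + n)"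
      using P ng lL unfolding trial_ok_def by (simp add: l_def)
    then show ?thesis by blast
  next
    case True
    define P' where "P' = call_output C I"
    have P': "o_x P' = i_x I" "o_xb P' = i_xb I" "o_L P' = l" "o_\<gamma> P' = r"
      by (simp_all add: P'_def call_output_def C_simps)
    have gam': "gam P' = gam P * (1 - r)" by (simp add: gam_def[of P'] P' r(3))
    have pts: "i_x I \<in> X" "i_xb I \<in> X"
      using I convexD_alt[OF convex oP(2), of "i_xt I" r] r
      by (auto simp: call_result_def inner_points_def C_simps)
    have "F (i_xb I) \<le> (1 - r) * F (o_xb P) + r * F xs
        + 2 * gam P' * (V (o_x P) xs - V (i_x I) xs) + r * \<epsilon> / 2"
      using call_gap[OF C I(2) _ True] by (simp add: C_simps gam' r(3))
    moreover have "(1 - r) * (F (o_xb P) - F xs + 2 * gam P * V (o_x P) xs) \<le> (1 - r) * (2 * gam P * Vs + \<epsilon> / 2)"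
      using P(1) r by (intro mult_left_mono) (auto simp: iter_ok_def)
    ultimately have "F (i_xb I) - F xs + 2 * gam P' * V (i_x I) xs \<le> 2 * gam P' * Vs + \<epsilon> / 2"
      unfolding gam' by (simp add: field_simps)
    then have ok: "iter_ok P'"
      using pts l L_le r by (simp add: iter_ok_def P')
    have reach: "reach (Done k P') (ng + 1) (nf + n)"
      unfolding P'_def by (rule reach.accept[OF P(3) C_def I(1) True])
    have gq: "2 * golden_sq powr a * q \<le> f_weight a * q"
      unfolding weight using \<open>q \<ge> 0\<close> by (intro mult_right_mono) (auto simp: mult_le_cancel_left1)
    then have nf_n: "real (nf + n) \<le> f_factor * f_weight a * R P + real ng * B"
      using nf n by (simp add: left_diff_distrib)
    \<comment> \<open>The count so far is at most \<open>4 * sqrt 2 * sqrt u\<close>. The final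
      evaluation is covered by the summand \<open>3 * sqrt u\<close> of \<open>g_bound\<close>,
      because u > 1/8 gives sqrt u >= 1/3.\<close>
    have "\<not> solved P'"
    proof
      assume "solved P'"
      have *: "\<epsilon> < 4 * Vs * gam P" using P(2) Vs(2) by (simp add: pos_divide_less_eq mult_ac)
      have ng_le: "real ng \<le> 4 * sqrt 2 * sqrt u" by (rule trial_gradient_count[OF inv])
      have "4 * Vs * gam P \<le> 4 * Vs * (2 * L)" using l gam Vs(2) by (intro mult_left_mono) auto
      then have "\<epsilon> < 8 * (L * Vs)" using * by (simp add: mult_ac)
      then have "1 / 8 < u" using \<epsilon> by (simp add: u_def pos_less_divide_eq)
      then have "1 / 3 \<le> sqrt u" by (intro real_le_rsqrt) (simp add: power2_eq_square)
      then have ng': "real (ng + 1) \<le> g_bound" using ng_le by (simp add: g_bound_def distrib_right)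
      have "real (nf + n) \<le> f_factor * f_weight a * R P + real ng * B" by (rule nf_n)
      also have "\<dots> \<le> f_factor * f_weight a * (8 * m) powr a + (g_bound + log 2 (8 * m)) * B"
      proof -
        have "log 2 (8 * m) \<ge> 0" using bounds by simp
        then have "real ng \<le> g_bound + log 2 (8 * m)" using ng' by simp
        then show ?thesis
          using bounds f_factor_ge_2 weight_pos by (intro add_mono mult_left_mono mult_right_mono) auto
      qed
      finally have "real (nf + n) \<le> f_bound" by (simp add: f_bound_def)
      then show False
        using \<open>\<not> found\<close> \<open>solved P'\<close> reach ng' unfolding found_def computes_def solved_def by blast
    qed
    then have g': "gam P' > \<epsilon> / (4 * Vs)" using unsolved_gam ok by blast
    have "reach (Trial (k + 1) (0 + 1) P') (ng + 1) (nf + n)"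
      using reach.enter[OF reach] by simp
    moreover have "real (nf + n) + f_weight a * R' * r \<le> f_factor * f_weight a * R' + real ng * B"
    proof -
      \<comment> \<open>The growth from \<open>R P\<close> to \<open>R'\<close> finances a fresh
        credit for the next iteration.\<close>
      have "R' * (2 * (1 - r) powr a) \<le> R' * (2 - r)"
        using two_powr_one_minus_le[OF r(1,2) a_bounds(1)] R' by (intro mult_left_mono) auto
      then have "R' * r \<le> 2 * (R' - R P)" by (simp add: R'(1) algebra_simps)
      moreover have "R' - R P \<ge> 0"
      proof -
        have "(1 - r) powr a \<le> 1" using r a_bounds by (intro powr_le1) auto
        then show ?thesis using R' mult_left_mono[of "(1 - r) powr a" 1 R'] by simp
      qed
      then have "2 * (R' - R P) \<le> f_factor * (R' - R P)"
        using f_factor_ge_2 by (intro mult_right_mono)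
      ultimately have "f_weight a * (R' * r) \<le> f_weight a * (f_factor * (R' - R P))"
        using weight_pos by (intro mult_left_mono) auto
      then show ?thesis using nf_n by (simp add: algebra_simps)
    qed
    moreover have "R P' = R'" by (simp add: R_def R'_def gam')
    \<comment> \<open>An accepted trial raises the right side by at least sqrt (2 L / l), which is
      at least 1.\<close>
    moreover have "real ng + 1 + log 2 (2 * L / l) \<le> 2 * sqrt (2 * L / gam P')"
    proof -
      have "1 / sqrt (gam P) + 1 / (2 * sqrt l) \<le> 1 / sqrt (gam P')"
        using inverse_sqrt_pos_root_increment[OF l(1) gam(1)] by (simp add: gam_def[of P'] P' r_def)
      then have "2 * sqrt (2 * L) * (1 / sqrt (gam P) + 1 / (2 * sqrt l)) \<le> 2 * sqrt (2 * L) * (1 / sqrt (gam P'))"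
        using L_pos by (intro mult_left_mono) auto
      then have "2 * sqrt (2 * L / gam P) + sqrt (2 * L / l) \<le> 2 * sqrt (2 * L / gam P')"
        by (simp add: real_sqrt_divide algebra_simps)
      moreover have "sqrt (2 * L / l) \<ge> 1" using l by simp
      ultimately show ?thesis using ng by linarith
    qed
    ultimately have "trial_ok (k + 1) 0 P' (ng + 1) (nf + n)"
      using ok g' l unfolding trial_ok_def by (simp add: P')
    then show ?thesis by blast
  qed
qed

lemma solution_found: found
proof (rule ccontr)
  assume "\<not> found"
  have halving: "\<exists>k s P ng nf. trial_ok k s P ng nf"
  proof (rule ccontr)
    assume none: "\<not> ?thesis"
    have all: "\<exists>P nf. halving_ok (Suc s) P nf" for s
    proof (induction s)
      case 0
      then show ?case using halving_start by auto
    next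
      case (Suc s)
      then show ?case using halving_step[OF _ \<open>\<not> found\<close>] none by (metis Suc_eq_plus1)
    qed
    obtain s where s: "16 * m < 2 ^ s" using real_arch_pow[of 2] by auto
    obtain P nf where "halving_ok (Suc (Suc s)) P nf" using all by blast
    moreover from this have "gam P = o_L P" "o_L P * 2 ^ Suc (Suc s) \<le> 4 * Mb"
      by (auto simp: halving_ok_def gam_def)
    moreover have "gam P > \<epsilon> / (4 * Vs)" by (rule halving_gam[OF calculation(1) \<open>\<not> found\<close>])
    ultimately have "\<epsilon> < 4 * Vs * gam P" "gam P * 2 ^ s \<le> Mb"
      using Vs(2) by (simp_all add: pos_divide_less_eq mult_ac)
    then have "\<epsilon> * 2 ^ s < 4 * Vs * gam P * 2 ^ s" by (intro mult_strict_right_mono) auto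
    also have "\<dots> \<le> 4 * Vs * Mb"
      using Vs(2) \<open>gam P * 2 ^ s \<le> Mb\<close> unfolding mult.assoc by (intro mult_left_mono) auto
    finally have "2 ^ s < 4 * m"
      using \<epsilon> by (simp add: m_def pos_less_divide_eq mult_ac)
    then show False using s m_pos by simp
  qed
  have "\<exists>k s P ng nf. trial_ok k s P ng nf \<and> ng \<ge> j" for j
  proof (induction j)
    case 0
    then show ?case using halving by blast
  next
    case (Suc j)
    then obtain k s P ng nf where "trial_ok k s P ng nf" "ng \<ge> j" by blast
    moreover from this obtain k' s' P' nf' where "trial_ok k' s' P' (ng + 1) nf'"
      using trial_step[OF _ \<open>\<not> found\<close>] by blast
    ultimately show ?case by (metis Suc_eq_plus1 Suc_le_mono)
  qed
  moreover obtain j where "4 * sqrt 2 * sqrt u < real j" using reals_Archimedean2 by blast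
  ultimately show False using trial_gradient_count by (meson not_le of_nat_mono order_trans)
qed

end

theorem theorem5p4:
  fixes X :: "(real ^ 'n) set"
    and nrm :: "real ^ 'n \<Rightarrow> real"
    and f g \<omega> :: "real ^ 'n \<Rightarrow> real"
    and grad_g grad_\<omega> :: "real ^ 'n \<Rightarrow> real ^ 'n"
    and f' :: "nat \<Rightarrow> nat \<Rightarrow> nat \<Rightarrow> nat \<Rightarrow> real ^ 'n \<Rightarrow> real ^ 'n"
    and \<epsilon> \<nu> M\<^sub>\<nu> L M0 Mb Vs D :: real
    and x0 xs :: "real ^ 'n"
  assumes X: "X \<noteq> {}" "closed X" "convex X"
    and nrm: "is_norm nrm"
    and \<epsilon>: "\<epsilon> > 0"
    and \<nu>: "0 \<le> \<nu>" "\<nu> \<le> 1"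
    and pos: "M\<^sub>\<nu> > 0" "L > 0"
    and f_convex: "convex_on UNIV f"
    and f_growth: "\<And>x y v. v \<in> subdifferential f x \<Longrightarrow>
          f y - f x - v \<bullet> (y - x) \<le> M\<^sub>\<nu> / (1 + \<nu>) * nrm (y - x) powr (1 + \<nu>)"
    and f': "\<And>k s t i x. f' k s t i x \<in> subdifferential f x"
    and g_convex: "convex_on UNIV g"
    and g_diff: "\<And>x. GDERIV g x :> grad_g x"
    and g_growth: "\<And>x y. g y - g x - grad_g x \<bullet> (y - x) \<le> L / 2 * (nrm (y - x))\<^sup>2"
    and \<omega>_diff: "\<And>x. x \<in> X \<Longrightarrow> (\<omega> has_derivative (\<lambda>h. grad_\<omega> x \<bullet> h)) (at x within X)"
    and \<omega>_strong: "strongly_convex_on X nrm 1 \<omega>"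
    and Mb: "Mb = M_bar \<nu> M\<^sub>\<nu> \<epsilon>"
    and L_le: "L \<le> Mb"
    and opt: "is_arg_min (\<lambda>x. f x + g x) (\<lambda>x. x \<in> X) xs"
    and x0: "x0 \<in> X"
    and M0: "0 < M0" "M0 \<le> L"
    and Vs: "Vs = bregman \<omega> grad_\<omega> x0 xs" "Vs > 0"
    and D: "D = (32 + 16 * sqrt 2) * (1 + sqrt 5) powr ((1 - \<nu>) / (1 + 3 * \<nu>))
                  * 2 powr ((1 + \<nu>) / (1 + 3 * \<nu>))"
    and nondegenerate: "(4 * sqrt 2 + 3) * sqrt (L * Vs / \<epsilon>) \<ge> 1"
  shows "\<exists>z ng nf. pfugs.computes X nrm f g f' grad_g \<omega> grad_\<omega> \<epsilon> M0 x0 z ng nf \<and>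
           eps_solution X f g \<epsilon> xs z \<and>
           real ng \<le> (4 * sqrt 2 + 3) * sqrt (L * Vs / \<epsilon>) \<and>
           real nf \<le> D * (Mb * Vs / \<epsilon>) powr ((1 + \<nu>) / (1 + 3 * \<nu>))
             + ((4 * sqrt 2 + 3) * (L * Vs / \<epsilon>) powr (1 / 2) + log 2 (8 * Mb * Vs / \<epsilon>))
               * ((13 + 3 * \<nu>) / (3 * \<nu> + 1)
                  + (2 + 2 * \<nu>) / (3 * \<nu> + 1) * log 2 (Mb * Vs / \<epsilon>)
                  + (1 - \<nu>) / (3 * \<nu> + 1) * log 2 (L * Vs / \<epsilon>))"
proof -
  interpret pfugs_solution X nrm f g f' grad_g \<omega> grad_\<omega> \<epsilon> M0 x0 \<nu> M\<^sub>\<nu> L xs Vs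
    using assms by unfold_locales (auto simp: is_arg_min_def)
  have u: "u = L * Vs / \<epsilon>" "u > 0" and m: "m = Mb * Vs / \<epsilon>" "m > 0"
    using u_m m_pos by (simp_all add: u_def m_def Mb)
  have a: "a = (1 + \<nu>) / (1 + 3 * \<nu>)" "2 * a - 1 = (1 - \<nu>) / (1 + 3 * \<nu>)"
    using \<nu> by (auto simp: a_def field_simps)
  have f: "f_bound = D * (Mb * Vs / \<epsilon>) powr ((1 + \<nu>) / (1 + 3 * \<nu>))
      + ((4 * sqrt 2 + 3) * (L * Vs / \<epsilon>) powr (1 / 2) + log 2 (8 * Mb * Vs / \<epsilon>))
        * ((13 + 3 * \<nu>) / (3 * \<nu> + 1)
           + (2 + 2 * \<nu>) / (3 * \<nu> + 1) * log 2 (Mb * Vs / \<epsilon>)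
           + (1 - \<nu>) / (3 * \<nu> + 1) * log 2 (L * Vs / \<epsilon>))"
  proof -
    have "8 * Mb * Vs / \<epsilon> = 8 * m" "(L * Vs / \<epsilon>) powr (1 / 2) = sqrt u"
      using u by (simp_all add: m(1) powr_half_sqrt)
    moreover have "D * m powr a = f_factor * f_weight a * (8 * m) powr a"
      using leading_term_eq[OF m(2), of a] unfolding D a(2) by (simp only: a(1))
    ultimately show ?thesis
      unfolding f_bound_def g_bound_def B_def log_bracket_def
      by (simp only: flip: u(1) m(1) a(1))
  qed
  have found by (rule solution_found)
  then show ?thesis
    unfolding found_def f g_bound_def u(1) .
qed

end
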